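(* Let $p\in[1,\infty]$, $1/p+1/q=1$, let $\xi\in L^p(\mathscr F,\mathbb R^d)$ and $f\in L^q_+(\mathscr F)$. If $0\in\mathrm{ri}(\mathrm{conv}\,\varkappa_\xi)$ a.s., then the following conditions are equivalent: (i) $v_p:=\sup\{\mathsf E(fX):\ \|X^-\|_p\le 1,\ X\in K\}<\infty$, where $K=\{(\gamma,\xi):\gamma\in L^\infty(\mathscr H,D_\xi)\}$; (ii) there exists a random variable $g\in L^q(\mathscr F)$ such that $\mathsf E(g\xi|\mathscr H)=0$ and $g\ge f$ (a.s.); (iii) $s(a|T_p)\in L^q(\mathscr H)$, where $a=\mathsf E(f\xi|\mathscr H)$ and $s(a|T_p)$ denotes the random variable $\omega\mapsto s(a(\omega)|T_p(\omega))$.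
   Context: $(\Omega,\mathscr F,\mathsf P)$ is a probability space, $\mathscr H\subset\mathscr F$ is a sub-$\sigma$-algebra, $\mathsf E$ is expectation with respect to $\mathsf P$, $(x,y)$ is the scalar product in $\mathbb R^d$ and $|x|=(x,x)^{1/2}$. For real $t$ (or a real random variable) $t^-=\max\{-t,0\}$. For a $\sigma$-algebra $\mathscr G\subset\mathscr F$, $L^p(\mathscr G)$, $1\le p\le\infty$, is the usual Banach space of ($\mathsf P$-equivalence classes of) real $\mathscr G$-measurable functions with norm $\|\cdot\|_p$; $L^p_+(\mathscr G)$ is the set of its non-negative elements. If $F$ is a set-valued mapping assigning to each $\omega$ a set $F(\omega)\subset\mathbb R^d$ (in particular $F\equiv\mathbb R^d$), $L^p(\mathscr G,F)$ is the set of equivalence classes of $\mathscr G$-measurable $\mathbb R^d$-valued functions $\eta$ with $|\eta|\in L^p$ and $\eta\in F$ a.s. Any function measurable with respect to the $\mathsf P$-completion $\mathscr H^{\mathsf P}$ of $\mathscr H$ is identified with an $\mathscr H$-measurable modification, so $L^q(\mathscr H^{\mathsf P})=L^q(\mathscr H)$. $\mathsf P_\xi(\omega,dx)$ is the regular conditional distribution of $\xi$ with respect to $\mathscr H$; $\varkappa_\xi(\omega)\subset\mathbb R^d$ is the (closed) support of the measure $\mathsf P_\xi(\omega,\cdot)$; $D_\xi(\omega)$ is the linear span of $\varkappa_\xi(\omega)$. $\mathrm{conv}\,A$ and $\mathrm{ri}\,A$ are the convex hull and the relative interior of $A\subset\mathbb R^d$, and $s(x|A)=\sup_{y\in A}(x,y)$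 is the support function. For $\omega\in\Omega$, $h\in\mathbb R^d$ put $$\psi_p(\omega,h)=\Big(\int_{\mathbb R^d}[(h,x)^-]^p\,\mathsf P_\xi(\omega,dx)\Big)^{1/p},\ p\in[1,\infty);\qquad \psi_\infty(\omega,h)=s(-h|\varkappa_\xi(\omega)),$$ and $$T_p(\omega)=\{h\in D_\xi(\omega):\psi_p(\omega,h)\le 1\}.$$ *)

theory Defs
  imports "HOL-Probability.Probability"
begin

text \<open>
  A sub-\<open>\<sigma>\<close>-algebra \<open>H\<close> of a probability space \<open>M\<close> is represented, as in
  \<^theory>\<open>HOL-Probability.Conditional_Expectation\<close>, by a measure of which only the
  space and the measurable sets matter (\<^const>\<open>subalgebra\<close>). The measure that enters norms and
  ``almost surely'' is always that of \<open>M\<close>. Exponents are of type \<^typ>\<open>ennreal\<close>, where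
  \<open>1 / \<infinity> = 0\<close> and \<open>1 / 0 = \<infinity>\<close>.
\<close>

definition neg_part :: "real \<Rightarrow> real" where
  "neg_part t = max (- t) 0"

text \<open>
  For finite \<open>p\<close> the case distinction only extends the power \<open>t powr (1 / p)\<close> to \<open>t = \<infinity>\<close>.
\<close>

definition Lp_norm :: "'a measure \<Rightarrow> ennreal \<Rightarrow> ('a \<Rightarrow> 'b::real_normed_vector) \<Rightarrow> ennreal" where
  "Lp_norm M p X =
     (if p = \<infinity> then esssup M (\<lambda>w. ennreal (norm (X w)))
      else let I = (\<integral>\<^sup>+ w. ennreal (norm (X w) powr enn2real p) \<partial>M)
           in if I = \<infinity> then \<infinity> else ennreal (enn2real I powr (1 / enn2real p)))"

text \<open>
  The space \<open>L\<^sup>p(G)\<close> for a sub-\<open>\<sigma>\<close>-algebra \<open>G\<close> of \<open>M\<close>. Its elements here are functions rather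
  than equivalence classes; equalities between them are stated almost everywhere.
\<close>

definition Lp :: "'a measure \<Rightarrow> 'a measure \<Rightarrow> ennreal
    \<Rightarrow> ('a \<Rightarrow> 'b::{real_normed_vector, second_countable_topology}) set" where
  "Lp M G p = {X \<in> borel_measurable G. Lp_norm M p X < \<infinity>}"

definition Lp_nonneg :: "'a measure \<Rightarrow> 'a measure \<Rightarrow> ennreal \<Rightarrow> ('a \<Rightarrow> real) set" where
  "Lp_nonneg M G p = {X \<in> Lp M G p. AE w in M. 0 \<le> X w}"

definition Lp_sel :: "'a measure \<Rightarrow> 'a measure \<Rightarrow> ennreal
    \<Rightarrow> ('a \<Rightarrow> 'b::{real_normed_vector, second_countable_topology} set) \<Rightarrow> ('a \<Rightarrow> 'b) set" where
  "Lp_sel M G p F = {X \<in> Lp M G p. AE w in M. X w \<in> F w}"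

text \<open>
  Membership in \<open>L\<^sup>p(G)\<close> for an extended-real valued function, which need only be measurable with
  respect to the completion of \<open>G\<close>: it has a finite \<open>G\<close>-measurable modification lying in \<open>L\<^sup>p(G)\<close>.
\<close>

definition in_Lp_mod :: "'a measure \<Rightarrow> 'a measure \<Rightarrow> ennreal \<Rightarrow> ('a \<Rightarrow> ereal) \<Rightarrow> bool" where
  "in_Lp_mod M G p u \<longleftrightarrow> (\<exists>Y\<in>Lp M G p. AE w in M. u w = ereal (Y w))"

text \<open>\<^const>\<open>real_cond_exp\<close> is available for real functions only, hence the components.\<close>

definition vec_cond_exp :: "'a measure \<Rightarrow> 'a measure \<Rightarrow> ('a \<Rightarrow> real^'d) \<Rightarrow> 'a \<Rightarrow> real^'d" where
  "vec_cond_exp M H X w = (\<chi> i. real_cond_exp M H (\<lambda>v. X v $ i) w)"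

text \<open>
  \<open>K\<close> is a regular conditional distribution of \<open>X\<close> given \<open>H\<close>: a probability kernel from \<open>H\<close> to the
  Borel sets such that \<open>K(\<cdot>, B)\<close> is a version of \<open>P(X \<in> B | H)\<close> for every Borel set \<open>B\<close>.
\<close>

definition regular_cond_distr ::
    "'a measure \<Rightarrow> 'a measure \<Rightarrow> ('a \<Rightarrow> 'b::topological_space) \<Rightarrow> ('a \<Rightarrow> 'b measure) \<Rightarrow> bool" where
  "regular_cond_distr M H X K \<longleftrightarrow>
     K \<in> H \<rightarrow>\<^sub>M prob_algebra borel \<and>
     (\<forall>B\<in>sets borel. AE w in M.
        measure (K w) B = real_cond_exp M H (\<lambda>v. indicator B (X v)) w)"

definition closed_support :: "'b::topological_space measure \<Rightarrow> 'b set" where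
  "closed_support N = {x. \<forall>U. open U \<longrightarrow> x \<in> U \<longrightarrow> 0 < emeasure N U}"

definition support_fun :: "'b::real_inner \<Rightarrow> 'b set \<Rightarrow> ereal" where
  "support_fun x A = (SUP y\<in>A. ereal (x \<bullet> y))"

text \<open>
  In the remaining definitions \<open>N\<close> is the conditional distribution at one point \<open>\<omega>\<close>. The value
  of \<open>psi\<close> is in \<^typ>\<open>ereal\<close> because the support function may be negative.
\<close>

definition D_span :: "'b::real_inner measure \<Rightarrow> 'b set" where
  "D_span N = span (closed_support N)"

definition psi :: "ennreal \<Rightarrow> 'b::real_inner measure \<Rightarrow> 'b \<Rightarrow> ereal" where
  "psi p N h =
     (if p = \<infinity> then support_fun (- h) (closed_support N)
      else enn2ereal (Lp_norm N p (\<lambda>x. neg_part (h \<bullet> x))))"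

definition T_set :: "ennreal \<Rightarrow> 'b::real_inner measure \<Rightarrow> 'b set" where
  "T_set p N = {h \<in> D_span N. psi p N h \<le> 1}"

definition K_set :: "'a measure \<Rightarrow> 'a measure \<Rightarrow> ('a \<Rightarrow> 'b measure)
    \<Rightarrow> ('a \<Rightarrow> 'b::{real_inner, second_countable_topology}) \<Rightarrow> ('a \<Rightarrow> real) set" where
  "K_set M H P X = {(\<lambda>w. \<gamma> w \<bullet> X w) | \<gamma>. \<gamma> \<in> Lp_sel M H \<infinity> (\<lambda>w. D_span (P w))}"

end

theory Submission
  imports Defs
begin

text \<open>
  The three conditions are linked by (ii) \<open>\<Longrightarrow>\<close> (i) \<open>\<Longrightarrow>\<close> (iii) \<open>\<Longrightarrow>\<close> (ii).

  If \<open>g \<ge> f\<close> and \<open>E(g \<xi> | H) = 0\<close>, then \<open>E(f X) = E((f - g) X) \<le> E((g - f) X\<^sup>-)\<close> for \<open>X \<in> K\<close>, and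
  Hoelder's inequality bounds the right-hand side by the norm of \<open>g - f\<close>
  (\<open>bounded_of_dominating_variable\<close>).

  If the supremum in (i) is finite, let \<open>\<gamma>\<close> be an \<open>H\<close>-measurable selection of \<open>T\<^sub>p\<close> with
  \<open>a \<bullet> \<gamma> \<ge> s(a|T\<^sub>p) / 2\<close>. For an \<open>H\<close>-measurable \<open>w \<ge> 0\<close> with \<open>\<parallel>w\<parallel>\<^sub>p \<le> 1\<close> the variable
  \<open>X = w \<gamma> \<bullet> \<xi>\<close> is admissible, so \<open>E(w s(a|T\<^sub>p) / 2) \<le> E(w (a \<bullet> \<gamma>)) = E(f X)\<close> is bounded, at
  first for truncations that make \<open>w \<gamma>\<close> bounded. The converse of Hoelder's inequality gives (iii)
  (\<open>support_fun_in_Lp\<close>).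

  The substance is the step from (iii) to (ii). Conditionally on \<open>H\<close> it is a finite-dimensional
  moment problem for the law \<open>N\<close> of \<open>\<xi>\<close>: find a density \<open>k \<ge> 0\<close> with \<open>\<integral> k(x) x N(dx) = - a\<close> whose
  \<open>L\<^sup>q\<close>-norm is bounded in terms of \<open>s(a|T\<^sub>p)\<close>; then \<open>g = f + k(\<xi>)\<close>. The finite-dimensional
  separation argument (\<open>mem_closure_means\<close>) shows that the means \<open>\<integral> k(x) x N(dx)\<close>, with \<open>k\<close> in the
  unit ball of \<open>L\<^sup>q\<close>, come arbitrarily close to \<open>- a / c\<close> whenever \<open>c > s(a|T\<^sub>p)\<close>. The functions
  \<open>k\<close> can be taken from a countable family that depends measurably on \<open>N\<close>: for finite \<open>p\<close> they are
  averages of \<open>((h \<bullet> x)\<^sup>-)\<^sup>p\<^sup>-\<^sup>1\<close>, normalised, with \<open>h\<close> in a countable dense set, and for \<open>p = \<infinity>\<close>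
  averages of normalised indicators of half-spaces. A first approximation leaves a small residual in
  place of \<open>a\<close>. Since \<open>0\<close> lies in the relative interior of the convex hull of the support, the gauge
  \<open>\<psi>\<^sub>p\<close> is coercive on \<open>D\<close>, so a residual that is small in norm also has a small support function and
  can be treated in the same way, at a small cost in norm. Summing the corrections
  (\<open>density_of_residuals\<close>) gives an exact solution for every \<open>p \<in> [1, \<infinity>]\<close>, without weak
  compactness, which would not be available for \<open>q = 1\<close>. Choosing at each step the first admissible
  member of the family makes \<open>k\<close> jointly measurable (\<open>dominating_variable_exists\<close>).

  The same family provides countably many \<open>H\<close>-measurable selections of \<open>D\<close> that are dense in \<open>D\<close>. They
  give the selection \<open>\<gamma>\<close> above, the measurability of \<open>s(a|T\<^sub>p)\<close> and a substitute for the measurable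
  orthogonal projection onto \<open>D\<close> in the proof that \<open>a \<in> D\<close> (\<open>AE_a_in_D\<close>).
\<close>

section \<open>Lebesgue norms\<close>

lemma powr_weighted_mean_le:
  fixes u v r l :: real
  assumes "1 \<le> r" "0 \<le> u" "0 \<le> v" "0 \<le> l" "l \<le> 1"
  shows "(l * u + (1 - l) * v) powr r \<le> l * u powr r + (1 - l) * v powr r"
proof -
  have scale: "(c * x) powr r \<le> c * x powr r" if "0 \<le> c" "c \<le> 1" "0 \<le> x" for c x :: real
  proof -
    have "c powr r \<le> c powr 1"
      using that assms(1) powr_mono'[of 1 r c] by auto
    then show ?thesis
      using that by (simp add: powr_mult mult_right_mono)
  qed
  consider "u = 0" | "v = 0" | "0 < u" "0 < v"
    using assms by linarith
  then show ?thesis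
  proof cases
    case 1
    then show ?thesis using scale[of "1 - l" v] assms by simp
  next
    case 2
    then show ?thesis using scale[of l u] assms by simp
  next
    case 3
    then show ?thesis
      using convex_onD[OF powr_convex[OF assms(1)], of "1 - l" u v] assms by simp
  qed
qed

lemma Lp_norm_top_le_iff:
  assumes "X \<in> borel_measurable N"
  shows "Lp_norm N \<top> X \<le> c \<longleftrightarrow> (AE x in N. ennreal (norm (X x)) \<le> c)"
proof
  assume "Lp_norm N \<top> X \<le> c"
  moreover have "AE x in N. ennreal (norm (X x)) \<le> Lp_norm N \<top> X"
    using esssup_AE by (simp add: Lp_norm_def)
  ultimately show "AE x in N. ennreal (norm (X x)) \<le> c"
    by (auto elim: eventually_mono)
next
  assume "AE x in N. ennreal (norm (X x)) \<le> c"
  then show "Lp_norm N \<top> X \<le> c"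
    using assms by (auto simp: Lp_norm_def intro!: esssup_I)
qed

lemma Lp_norm_finite_le_iff:
  assumes "0 < r" "0 \<le> c"
  shows "Lp_norm N (ennreal r) X \<le> ennreal c \<longleftrightarrow>
    (\<integral>\<^sup>+ x. ennreal (norm (X x) powr r) \<partial>N) \<le> ennreal (c powr r)"
proof -
  define I where "I = (\<integral>\<^sup>+ x. ennreal (norm (X x) powr r) \<partial>N)"
  have L: "Lp_norm N (ennreal r) X = (if I = \<infinity> then \<infinity> else ennreal (enn2real I powr (1 / r)))"
    using assms by (simp add: Lp_norm_def I_def Let_def)
  show ?thesis
  proof (cases "I = \<infinity>")
    case True
    then show ?thesis using assms by (simp add: L I_def[symmetric] top_unique)
  next
    case False
    then obtain J where J: "I = ennreal J" "0 \<le> J"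
      by (cases I) auto
    have "J powr (1 / r) \<le> c \<longleftrightarrow> J \<le> c powr r"
    proof
      assume "J powr (1 / r) \<le> c"
      then have "(J powr (1 / r)) powr r \<le> c powr r"
        using assms by (intro powr_mono2) auto
      then show "J \<le> c powr r" using assms J by (simp add: powr_powr)
    next
      assume "J \<le> c powr r"
      then have "J powr (1 / r) \<le> (c powr r) powr (1 / r)"
        using assms J by (intro powr_mono2) auto
      then show "J powr (1 / r) \<le> c" using assms by (simp add: powr_powr)
    qed
    then show ?thesis
      using J assms False by (simp add: L I_def[symmetric])
  qed
qed

lemma exponent_cases:
  assumes "1 \<le> (p::ennreal)"
  obtains "p = \<infinity>" | r where "p = ennreal r" "1 \<le> r"
proof (cases p)
  case (real r)
  then show ?thesis using assms that by (auto simp: ennreal_ge_1)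
next
  case top
  then show ?thesis using that by simp
qed

lemma Lp_norm_norm: "Lp_norm N p (\<lambda>x. norm (X x)) = Lp_norm N p X"
  by (simp add: Lp_norm_def)

lemma Lp_norm_mono:
  assumes [measurable]: "X \<in> borel_measurable N" "Y \<in> borel_measurable N"
    and p: "1 \<le> p" and le: "AE x in N. norm (X x) \<le> norm (Y x)"
  shows "Lp_norm N p X \<le> Lp_norm N p Y"
proof (cases "Lp_norm N p Y")
  case (real c)
  note c = this
  show ?thesis
    using p
  proof (cases rule: exponent_cases)
    case 1
    have "AE x in N. ennreal (norm (Y x)) \<le> ennreal c"
      using c Lp_norm_top_le_iff[of Y N "ennreal c"] 1 by simp
    with le have "AE x in N. ennreal (norm (X x)) \<le> ennreal c"
      by eventually_elim (meson ennreal_leI order_trans)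
    then show ?thesis using c Lp_norm_top_le_iff[of X N "ennreal c"] 1 by simp
  next
    case (2 r)
    have "(\<integral>\<^sup>+ x. ennreal (norm (X x) powr r) \<partial>N) \<le> (\<integral>\<^sup>+ x. ennreal (norm (Y x) powr r) \<partial>N)"
      using le by (intro nn_integral_mono_AE) (auto elim!: eventually_mono intro!: ennreal_leI powr_mono2 simp: 2(2) order_trans[OF zero_le_one 2(2)])
    then show ?thesis
      using c 2 Lp_norm_finite_le_iff[of r c N X] Lp_norm_finite_le_iff[of r c N Y] by auto
  qed
qed simp

text \<open>
  Minkowski's inequality. After normalisation to the unit balls it is convexity of \<open>t \<mapsto> t\<^sup>r\<close>,
  applied with the weights \<open>a / (a + b)\<close> and \<open>b / (a + b)\<close>.
\<close>

lemma Lp_norm_add_le: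
  fixes X Y :: "'a \<Rightarrow> 'b::{real_normed_vector, second_countable_topology}"
  assumes [measurable]: "X \<in> borel_measurable N" "Y \<in> borel_measurable N"
    and p: "1 \<le> p" and ab: "0 \<le> a" "0 \<le> b"
    and X: "Lp_norm N p X \<le> ennreal a" and Y: "Lp_norm N p Y \<le> ennreal b"
  shows "Lp_norm N p (\<lambda>x. X x + Y x) \<le> ennreal (a + b)"
  using p
proof (cases rule: exponent_cases)
  case 1
  have "AE x in N. norm (X x) \<le> a" "AE x in N. norm (Y x) \<le> b"
    using X Y ab by (simp_all add: 1 Lp_norm_top_le_iff)
  then have "AE x in N. norm (X x + Y x) \<le> a + b"
    by eventually_elim (metis add_mono norm_triangle_le)
  then show ?thesis using ab by (simp add: 1 Lp_norm_top_le_iff del: ennreal_plus)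
next
  case (2 r)
  have pos: "Lp_norm N p (\<lambda>x. X x + Y x) \<le> ennreal (a' + b')"
    if ab': "0 < a'" "0 < b'" "a \<le> a'" "b \<le> b'" for a' b'
  proof -
    define l where "l = a' / (a' + b')"
    have l: "0 \<le> l" "l \<le> 1" "1 - l = b' / (a' + b')"
      using ab' by (auto simp: l_def field_simps)
    have "Lp_norm N p X \<le> ennreal a'" "Lp_norm N p Y \<le> ennreal b'"
      using X Y ab' by (auto intro: order_trans ennreal_leI)
    then have IX: "(\<integral>\<^sup>+ x. ennreal (norm (X x) powr r) \<partial>N) \<le> ennreal (a' powr r)"
      and IY: "(\<integral>\<^sup>+ x. ennreal (norm (Y x) powr r) \<partial>N) \<le> ennreal (b' powr r)"
      using 2 ab' by (simp_all add: Lp_norm_finite_le_iff)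
    define A where "A = (a' + b') powr r * l / a' powr r"
    define B where "B = (a' + b') powr r * (1 - l) / b' powr r"
    have nn: "0 \<le> A" "0 \<le> B"
      using l(1,2) by (simp_all add: A_def B_def)
    have pt: "norm (X x + Y x) powr r \<le> A * norm (X x) powr r + B * norm (Y x) powr r" for x
    proof -
      have "norm (X x + Y x) powr r \<le> (norm (X x) + norm (Y x)) powr r"
        using 2 by (intro powr_mono2 norm_triangle_ineq) auto
      also have "norm (X x) + norm (Y x) = (a' + b') * (l * (norm (X x) / a') + (1 - l) * (norm (Y x) / b'))"
      proof -
        have "(a' + b') * l = a'" "(a' + b') * (1 - l) = b'"
          using ab' by (simp_all add: l_def divide_simps)
        then show ?thesis
          using ab' by (simp add: distrib_left mult.assoc[symmetric])
      qed
      also have "\<dots> powr r = (a' + b') powr r * (l * (norm (X x) / a') + (1 - l) * (norm (Y x) / b')) powr r"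
        using ab' l by (intro powr_mult)
      also have "\<dots> \<le> (a' + b') powr r * (l * (norm (X x) / a') powr r + (1 - l) * (norm (Y x) / b') powr r)"
        using ab' l 2 by (intro mult_left_mono powr_weighted_mean_le) auto
      finally show ?thesis
        using ab' by (simp add: powr_divide algebra_simps A_def B_def)
    qed
    have "(\<integral>\<^sup>+ x. ennreal (norm (X x + Y x) powr r) \<partial>N) \<le>
       (\<integral>\<^sup>+ x. ennreal A * ennreal (norm (X x) powr r) + ennreal B * ennreal (norm (Y x) powr r) \<partial>N)"
      using pt nn by (intro nn_integral_mono)
        (simp add: ennreal_mult'[symmetric] ennreal_plus[symmetric] del: ennreal_plus)
    also have "\<dots> = ennreal A * (\<integral>\<^sup>+ x. ennreal (norm (X x) powr r) \<partial>N)
        + ennreal B * (\<integral>\<^sup>+ x. ennreal (norm (Y x) powr r) \<partial>N)"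
      by (simp add: nn_integral_add nn_integral_cmult)
    also have "\<dots> \<le> ennreal A * ennreal (a' powr r) + ennreal B * ennreal (b' powr r)"
      by (intro add_mono mult_left_mono IX IY) auto
    also have "\<dots> = ennreal (A * a' powr r + B * b' powr r)"
      using nn by (simp add: ennreal_mult'[symmetric] ennreal_plus[symmetric] del: ennreal_plus)
    also have "A * a' powr r + B * b' powr r = (a' + b') powr r"
    proof -
      have "A * a' powr r = (a' + b') powr r * l" "B * b' powr r = (a' + b') powr r * (1 - l)"
        using ab' by (simp_all add: A_def B_def)
      then show ?thesis by (simp only: distrib_left[symmetric]) simp
    qed
    finally show ?thesis
      using 2 ab' by (simp add: Lp_norm_finite_le_iff del: ennreal_plus)
  qed
  show ?thesis
  proof (rule ennreal_le_epsilon)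
    fix e :: real assume "0 < e"
    then have "Lp_norm N p (\<lambda>x. X x + Y x) \<le> ennreal ((a + e / 2) + (b + e / 2))"
      using ab by (intro pos) auto
    also have "\<dots> = ennreal (a + b) + ennreal e"
      using ab \<open>0 < e\<close> by (simp add: ennreal_plus[symmetric] algebra_simps del: ennreal_plus)
    finally show "Lp_norm N p (\<lambda>x. X x + Y x) \<le> ennreal (a + b) + ennreal e" .
  qed
qed

lemma Lp_norm_scaleR_le:
  fixes X :: "'a \<Rightarrow> 'b::{real_normed_vector, second_countable_topology}"
  assumes [measurable]: "X \<in> borel_measurable N"
    and p: "1 \<le> p" and a: "0 \<le> a" and X: "Lp_norm N p X \<le> ennreal a"
  shows "Lp_norm N p (\<lambda>x. c *\<^sub>R X x) \<le> ennreal (\<bar>c\<bar> * a)"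
  using p
proof (cases rule: exponent_cases)
  case 1
  have "AE x in N. norm (X x) \<le> a"
    using X a by (simp add: 1 Lp_norm_top_le_iff)
  then have "AE x in N. norm (c *\<^sub>R X x) \<le> \<bar>c\<bar> * a"
    by eventually_elim (simp add: mult_left_mono)
  then show ?thesis using a by (simp add: 1 Lp_norm_top_le_iff)
next
  case (2 r)
  have IX: "(\<integral>\<^sup>+ x. ennreal (norm (X x) powr r) \<partial>N) \<le> ennreal (a powr r)"
    using X a 2 by (simp add: Lp_norm_finite_le_iff)
  have "(\<integral>\<^sup>+ x. ennreal (norm (c *\<^sub>R X x) powr r) \<partial>N)
      = ennreal (\<bar>c\<bar> powr r) * (\<integral>\<^sup>+ x. ennreal (norm (X x) powr r) \<partial>N)"
    by (simp add: powr_mult ennreal_mult' nn_integral_cmult)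
  also have "\<dots> \<le> ennreal (\<bar>c\<bar> powr r) * ennreal (a powr r)"
    by (intro mult_left_mono IX) simp
  also have "\<dots> = ennreal ((\<bar>c\<bar> * a) powr r)"
    using a by (simp add: powr_mult ennreal_mult')
  finally show ?thesis
    using a 2 by (simp add: Lp_norm_finite_le_iff)
qed

text \<open>
  Fatou's lemma, in the form that passes from partial sums of densities to their sum and from
  truncations to the untruncated function.
\<close>

lemma Lp_norm_limit_le:
  fixes X :: "nat \<Rightarrow> 'a \<Rightarrow> 'b::{real_normed_vector, second_countable_topology}"
  assumes [measurable]: "\<And>n. X n \<in> borel_measurable N" "Y \<in> borel_measurable N"
    and p: "1 \<le> p" and c: "0 \<le> c" and X: "\<And>n. Lp_norm N p (X n) \<le> ennreal c"
    and lim: "AE x in N. (\<lambda>n. X n x) \<longlonglongrightarrow> Y x"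
  shows "Lp_norm N p Y \<le> ennreal c"
  using p
proof (cases rule: exponent_cases)
  case 1
  have "AE x in N. \<forall>n. norm (X n x) \<le> c"
    using X c by (simp add: 1 Lp_norm_top_le_iff AE_all_countable)
  with lim have "AE x in N. norm (Y x) \<le> c"
    by eventually_elim (rule LIMSEQ_le_const2[OF tendsto_norm], auto)
  then show ?thesis using c by (simp add: 1 Lp_norm_top_le_iff)
next
  case (2 r)
  have "(\<integral>\<^sup>+ x. ennreal (norm (Y x) powr r) \<partial>N)
      = (\<integral>\<^sup>+ x. liminf (\<lambda>n. ennreal (norm (X n x) powr r)) \<partial>N)"
  proof (rule nn_integral_cong_AE)
    show "AE x in N. ennreal (norm (Y x) powr r) = liminf (\<lambda>n. ennreal (norm (X n x) powr r))"
      using lim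
    proof eventually_elim
      case (elim x)
      have "(\<lambda>n. norm (X n x) powr r) \<longlonglongrightarrow> norm (Y x) powr r"
        using elim 2 by (intro tendsto_powr' tendsto_norm tendsto_const) auto
      then have "(\<lambda>n. ennreal (norm (X n x) powr r)) \<longlonglongrightarrow> ennreal (norm (Y x) powr r)"
        by (rule tendsto_ennrealI)
      then show ?case by (metis lim_imp_Liminf trivial_limit_sequentially)
    qed
  qed
  also have "\<dots> \<le> liminf (\<lambda>n. (\<integral>\<^sup>+ x. ennreal (norm (X n x) powr r) \<partial>N))"
    by (intro nn_integral_liminf) auto
  also have "\<dots> \<le> limsup (\<lambda>n. (\<integral>\<^sup>+ x. ennreal (norm (X n x) powr r) \<partial>N))"
    by (simp add: Liminf_le_Limsup)
  also have "\<dots> \<le> ennreal (c powr r)"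
    using X c 2 by (intro Limsup_bounded always_eventually allI) (simp add: Lp_norm_finite_le_iff)
  finally show ?thesis
    using c 2 by (simp add: Lp_norm_finite_le_iff)
qed

lemma Lp_norm_eq_0D:
  assumes [measurable]: "X \<in> borel_measurable N"
    and p: "1 \<le> p" and 0: "Lp_norm N p X = 0"
  shows "AE x in N. X x = 0"
  using p
proof (cases rule: exponent_cases)
  case 1
  then show ?thesis
    using 0 Lp_norm_top_le_iff[of X N 0] by simp
next
  case (2 r)
  have "(\<integral>\<^sup>+ x. ennreal (norm (X x) powr r) \<partial>N) = 0"
    using 0 2 Lp_norm_finite_le_iff[of r 0 N X] by simp
  then show ?thesis by (simp add: nn_integral_0_iff_AE)
qed

section \<open>Conjugate exponents and norm-attaining functions\<close>

definition conjugate :: "ennreal \<Rightarrow> ennreal \<Rightarrow> bool" where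
  "conjugate p q \<longleftrightarrow> 1 \<le> p \<and> 1 / p + 1 / q = 1"

lemma conjugate_cases:
  assumes "conjugate p q"
  obtains "p = 1" "q = \<infinity>" | "p = \<infinity>" "q = 1"
    | r s where "p = ennreal r" "q = ennreal s" "1 < r" "1 < s" "1 / r + 1 / s = 1"
proof -
  have p: "1 \<le> p" and pq: "1 / p + 1 / q = 1"
    using assms by (auto simp: conjugate_def)
  consider "p = \<infinity>" | "q = \<infinity>" | r s where "p = ennreal r" "q = ennreal s" "1 \<le> r" "0 \<le> s"
    using p by (cases p; cases q) (auto simp: ennreal_ge_1)
  then show thesis
  proof cases
    case 1
    then have "1 / q = 1" using pq by simp
    then have "q = 1"
      by (simp add: divide_eq_1_ennreal)
    with 1 that show ?thesis by blast
  next
    case 2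
    then have "1 / p = 1" using pq by simp
    then have "p = 1"
      by (simp add: divide_eq_1_ennreal)
    with 2 that show ?thesis by blast
  next
    case (3 r s)
    have "s \<noteq> 0" using pq 3 by (auto simp: divide_ennreal_def)
    then have s: "0 < s" using 3 by simp
    have "ennreal (1 / r + 1 / s) = 1"
      using pq 3 s divide_ennreal[of 1 r] divide_ennreal[of 1 s] by simp
    then have e: "1 / r + 1 / s = 1"
      using 3 s by (simp only: ennreal_eq_1)
    have "0 < 1 / r" "0 < 1 / s" using 3 s by simp_all
    then have "1 / r < 1" "1 / s < 1" using e by linarith+
    then have "1 < r" "1 < s" using 3 s by simp_all
    with 3 e that show ?thesis by blast
  qed
qed

lemma conjugate_sym:
  assumes "conjugate p q"
  shows "conjugate q p"
  using assms
proof (cases rule: conjugate_cases)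
  case (3 r s)
  then show ?thesis
    using assms by (auto simp: conjugate_def ennreal_ge_1 add.commute)
qed (simp_all add: conjugate_def)

lemma conjugate_ge_1: "conjugate p q \<Longrightarrow> 1 \<le> p" "conjugate p q \<Longrightarrow> 1 \<le> q"
  using conjugate_sym[of p q] by (auto simp: conjugate_def)

text \<open>
  For \<open>1 < p < \<infinity>\<close> this is Young's inequality for the normalised functions, integrated; functions of
  norm \<open>0\<close> are normalised by slightly larger bounds.
\<close>

lemma Hoelder:
  fixes X :: "'a \<Rightarrow> 'b::{real_normed_vector, second_countable_topology}"
    and Y :: "'a \<Rightarrow> 'c::{real_normed_vector, second_countable_topology}"
  assumes pq: "conjugate p q"
    and [measurable]: "X \<in> borel_measurable N" "Y \<in> borel_measurable N"
    and ab: "0 \<le> a" "0 \<le> b"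
    and X: "Lp_norm N p X \<le> ennreal a" and Y: "Lp_norm N q Y \<le> ennreal b"
  shows "(\<integral>\<^sup>+ x. ennreal (norm (X x) * norm (Y x)) \<partial>N) \<le> ennreal (a * b)"
  using pq
proof (cases rule: conjugate_cases)
  case 1
  have "AE x in N. norm (Y x) \<le> b" using Y ab by (simp add: 1 Lp_norm_top_le_iff)
  then have "(\<integral>\<^sup>+ x. ennreal (norm (X x) * norm (Y x)) \<partial>N) \<le> (\<integral>\<^sup>+ x. ennreal b * ennreal (norm (X x)) \<partial>N)"
    using ab by (intro nn_integral_mono_AE)
      (auto elim!: eventually_mono simp: ennreal_mult'[symmetric] mult.commute[of b] intro!: ennreal_leI mult_left_mono)
  also have "\<dots> = ennreal b * (\<integral>\<^sup>+ x. ennreal (norm (X x)) \<partial>N)"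
    by (simp add: nn_integral_cmult)
  also have "\<dots> \<le> ennreal b * ennreal a"
    using X ab 1 Lp_norm_finite_le_iff[of 1 a N X] by (intro mult_left_mono) auto
  finally show ?thesis using ab by (simp add: ennreal_mult'[symmetric] mult.commute)
next
  case 2
  have "AE x in N. norm (X x) \<le> a" using X ab by (simp add: 2 Lp_norm_top_le_iff)
  then have "(\<integral>\<^sup>+ x. ennreal (norm (X x) * norm (Y x)) \<partial>N) \<le> (\<integral>\<^sup>+ x. ennreal a * ennreal (norm (Y x)) \<partial>N)"
    using ab by (intro nn_integral_mono_AE)
      (auto elim!: eventually_mono simp: ennreal_mult'[symmetric] intro!: ennreal_leI mult_right_mono)
  also have "\<dots> = ennreal a * (\<integral>\<^sup>+ x. ennreal (norm (Y x)) \<partial>N)"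
    by (simp add: nn_integral_cmult)
  also have "\<dots> \<le> ennreal a * ennreal b"
    using Y ab 2 Lp_norm_finite_le_iff[of 1 b N Y] by (intro mult_left_mono) auto
  finally show ?thesis using ab by (simp add: ennreal_mult'[symmetric])
next
  case (3 r s)
  have pos: "(\<integral>\<^sup>+ x. ennreal (norm (X x) * norm (Y x)) \<partial>N) \<le> ennreal (a' * b')"
    if ab': "0 < a'" "0 < b'" "a \<le> a'" "b \<le> b'" for a' b'
  proof -
    have "Lp_norm N p X \<le> ennreal a'" "Lp_norm N q Y \<le> ennreal b'"
      using order_trans[OF X ennreal_leI] order_trans[OF Y ennreal_leI] ab' by blast+
    then have IX: "(\<integral>\<^sup>+ x. ennreal (norm (X x) powr r) \<partial>N) \<le> ennreal (a' powr r)"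
      and IY: "(\<integral>\<^sup>+ x. ennreal (norm (Y x) powr s) \<partial>N) \<le> ennreal (b' powr s)"
      using 3 ab' by (simp_all add: Lp_norm_finite_le_iff)
    define A where "A = a' * b' / (r * a' powr r)"
    define B where "B = a' * b' / (s * b' powr s)"
    have nn: "0 \<le> A" "0 \<le> B" using ab' 3 by (auto simp: A_def B_def)
    have pt: "norm (X x) * norm (Y x) \<le> A * norm (X x) powr r + B * norm (Y x) powr s" for x
    proof -
      have "norm (X x) * norm (Y x) = a' * b' * ((norm (X x) / a') * (norm (Y x) / b'))"
        using ab' by simp
      also have "\<dots> \<le> a' * b' * ((norm (X x) / a') powr r / r + (norm (Y x) / b') powr s / s)"
        using ab' 3 by (intro mult_left_mono Youngs_inequality) auto
      also have "\<dots> = A * norm (X x) powr r + B * norm (Y x) powr s"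
        using ab' by (simp add: powr_divide algebra_simps A_def B_def)
      finally show ?thesis .
    qed
    have "(\<integral>\<^sup>+ x. ennreal (norm (X x) * norm (Y x)) \<partial>N) \<le>
       (\<integral>\<^sup>+ x. ennreal A * ennreal (norm (X x) powr r) + ennreal B * ennreal (norm (Y x) powr s) \<partial>N)"
      using pt nn by (intro nn_integral_mono)
        (simp add: ennreal_mult'[symmetric] ennreal_plus[symmetric] del: ennreal_plus)
    also have "\<dots> = ennreal A * (\<integral>\<^sup>+ x. ennreal (norm (X x) powr r) \<partial>N)
        + ennreal B * (\<integral>\<^sup>+ x. ennreal (norm (Y x) powr s) \<partial>N)"
      by (simp add: nn_integral_add nn_integral_cmult)
    also have "\<dots> \<le> ennreal A * ennreal (a' powr r) + ennreal B * ennreal (b' powr s)"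
      by (intro add_mono mult_left_mono IX IY) auto
    also have "\<dots> = ennreal (A * a' powr r + B * b' powr s)"
      using nn by (simp add: ennreal_mult'[symmetric] ennreal_plus[symmetric] del: ennreal_plus)
    also have "A * a' powr r + B * b' powr s = a' * b' * (1 / r + 1 / s)"
    proof -
      have "A * a' powr r = a' * b' / r" "B * b' powr s = a' * b' / s"
        using ab' by (simp_all add: A_def B_def)
      then show ?thesis by (simp add: distrib_left)
    qed
    finally show ?thesis using 3 by simp
  qed
  have "(\<lambda>n. ennreal ((a + inverse (real (Suc n))) * (b + inverse (real (Suc n)))))
      \<longlonglongrightarrow> ennreal ((a + 0) * (b + 0))"
    by (intro tendsto_ennrealI tendsto_mult tendsto_add tendsto_const LIMSEQ_inverse_real_of_nat)
  then have "(\<integral>\<^sup>+ x. ennreal (norm (X x) * norm (Y x)) \<partial>N) \<le> ennreal ((a + 0) * (b + 0))"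
  proof (rule LIMSEQ_le_const, intro exI allI impI)
    fix n :: nat
    show "(\<integral>\<^sup>+ x. ennreal (norm (X x) * norm (Y x)) \<partial>N)
        \<le> ennreal ((a + inverse (real (Suc n))) * (b + inverse (real (Suc n))))"
      using ab by (intro pos) (simp_all add: add_nonneg_pos)
  qed
  then show ?thesis by simp
qed

lemma Hoelder_integrable:
  fixes X :: "'a \<Rightarrow> 'b::{banach, second_countable_topology}" and k :: "'a \<Rightarrow> real"
  assumes pq: "conjugate p q"
    and [measurable]: "X \<in> borel_measurable N" "k \<in> borel_measurable N"
    and X: "Lp_norm N p X < \<infinity>" and k: "Lp_norm N q k < \<infinity>"
  shows "integrable N (\<lambda>w. k w *\<^sub>R X w)"
proof (rule integrableI_bounded)
  obtain B where B: "Lp_norm N p X = ennreal B" "0 \<le> B"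
    using X by (cases "Lp_norm N p X") auto
  obtain C where C: "Lp_norm N q k = ennreal C" "0 \<le> C"
    using k by (cases "Lp_norm N q k") auto
  have "(\<integral>\<^sup>+ w. ennreal (norm (k w) * norm (X w)) \<partial>N) \<le> ennreal (C * B)"
    using B C by (intro Hoelder[OF conjugate_sym[OF pq]]) auto
  then show "(\<integral>\<^sup>+ w. ennreal (norm (k w *\<^sub>R X w)) \<partial>N) < \<infinity>"
    using le_less_trans[OF _ ennreal_less_top] by simp
qed measurable

text \<open>
  For \<open>\<phi> \<ge> 0\<close>, finite \<open>p\<close> and the conjugate exponent \<open>q\<close>, the function \<open>\<phi>\<^sup>p\<^sup>-\<^sup>1 / \<parallel>\<phi>\<parallel>\<^sub>p\<^sup>p\<^sup>-\<^sup>1\<close> lies in the unit ball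
  of \<open>L\<^sup>q\<close> and integrates \<open>\<phi>\<close> to \<open>\<parallel>\<phi>\<parallel>\<^sub>p\<close>. For \<open>p = 1\<close> it is the indicator of \<open>\<phi> > 0\<close>, because
  \<open>0 powr 0 = 0\<close>; if \<open>\<parallel>\<phi>\<parallel>\<^sub>p\<close> is \<open>0\<close> or infinite, it is \<open>0\<close>, because division by \<open>0\<close> gives \<open>0\<close>. For \<open>p = \<infinity>\<close> the norm is in general not attained, and averaging over the level
  set \<open>\<phi> > t\<close> gives at least \<open>t\<close> for every \<open>t < \<parallel>\<phi>\<parallel>\<^sub>\<infinity>\<close>.
\<close>

definition dual_fn :: "ennreal \<Rightarrow> 'a measure \<Rightarrow> ('a \<Rightarrow> real) \<Rightarrow> real \<Rightarrow> 'a \<Rightarrow> real" where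
  "dual_fn p N \<phi> t x =
     (if p = \<infinity> then indicator {y. t < \<phi> y} x / measure N {y\<in>space N. t < \<phi> y}
      else (\<phi> x / enn2real (Lp_norm N p \<phi>)) powr (enn2real p - 1))"

lemma dual_fn_nonneg: "0 \<le> dual_fn p N \<phi> t x"
  by (simp add: dual_fn_def)

lemma dual_fn_measurable [measurable]:
  assumes [measurable]: "\<phi> \<in> borel_measurable G"
  shows "dual_fn p N \<phi> t \<in> borel_measurable G"
  unfolding dual_fn_def[abs_def] by measurable

lemma dual_fn_eq_0: "0 \<le> t \<Longrightarrow> \<phi> x = 0 \<Longrightarrow> dual_fn p N \<phi> t x = 0"
  by (simp add: dual_fn_def)

lemma dual_fn_bounded:
  assumes "1 \<le> p" "\<And>x. 0 \<le> \<phi> x" "\<And>x. \<phi> x \<le> C"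
  obtains B where "\<And>x. dual_fn p N \<phi> t x \<le> B"
  using assms(1)
proof (cases rule: exponent_cases)
  case 1
  show ?thesis
    by (rule that[of "1 / measure N {y\<in>space N. t < \<phi> y}"])
      (auto simp: 1 dual_fn_def indicator_def)
next
  case (2 r)
  show ?thesis
    using 2 assms by (intro that[of "(C / enn2real (Lp_norm N p \<phi>)) powr (r - 1)"])
      (auto simp: dual_fn_def intro!: powr_mono2 divide_right_mono)
qed

text \<open>
  For \<open>1 < p < \<infinity>\<close> the reason is the identity \<open>(p - 1) q = p\<close>.
\<close>

lemma dual_fn_norm_le_1:
  assumes pq: "conjugate p q" and "finite_measure N"
    and [measurable]: "\<phi> \<in> borel_measurable N" and nn: "\<And>x. 0 \<le> \<phi> x"
  shows "Lp_norm N q (dual_fn p N \<phi> t) \<le> 1"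
proof -
  interpret finite_measure N by fact
  show ?thesis
    using pq
  proof (cases rule: conjugate_cases)
    case 1
    have "AE x in N. norm (dual_fn p N \<phi> t x) \<le> 1"
      by (auto simp: 1 dual_fn_def powr_def)
    then show ?thesis by (simp add: 1 Lp_norm_top_le_iff)
  next
    case 2
    define m where "m = measure N {y\<in>space N. t < \<phi> y}"
    have "(\<integral>\<^sup>+ x. ennreal (dual_fn p N \<phi> t x) \<partial>N)
        = (\<integral>\<^sup>+ x. ennreal (1 / m) * indicator {y\<in>space N. t < \<phi> y} x \<partial>N)"
      by (intro nn_integral_cong) (auto simp: dual_fn_def 2 m_def indicator_def)
    also have "\<dots> = ennreal (1 / m) * ennreal m"
      by (simp add: nn_integral_cmult_indicator m_def emeasure_eq_measure)
    also have "\<dots> \<le> 1"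
      by (simp add: ennreal_mult'[symmetric] m_def)
    finally show ?thesis
      using 2 Lp_norm_finite_le_iff[of 1 1 N "dual_fn p N \<phi> t"] by (simp add: dual_fn_nonneg)
  next
    case (3 r s)
    have rs: "(r - 1) * s = r" using 3 by (simp add: field_simps)
    define L where "L = enn2real (Lp_norm N p \<phi>)"
    show ?thesis
    proof (cases "L = 0")
      case True
      then have "dual_fn p N \<phi> t x = 0" for x using 3 by (simp add: dual_fn_def L_def)
      then show ?thesis
        using 3 Lp_norm_finite_le_iff[of s 1 N "dual_fn p N \<phi> t"] by simp
    next
      case False
      then have L: "0 < L" "Lp_norm N p \<phi> = ennreal L"
        by (cases "Lp_norm N p \<phi>"; simp add: L_def)+
      then have I: "(\<integral>\<^sup>+ x. ennreal (\<phi> x powr r) \<partial>N) \<le> ennreal (L powr r)"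
        using 3 nn Lp_norm_finite_le_iff[of r L N \<phi>] by simp
      have "(\<integral>\<^sup>+ x. ennreal (dual_fn p N \<phi> t x powr s) \<partial>N)
          = (\<integral>\<^sup>+ x. ennreal (1 / L powr r) * ennreal (\<phi> x powr r) \<partial>N)"
        using 3 L nn
        by (intro nn_integral_cong)
          (simp add: dual_fn_def L_def[symmetric] powr_powr rs powr_divide ennreal_mult'[symmetric])
      also have "\<dots> = ennreal (1 / L powr r) * (\<integral>\<^sup>+ x. ennreal (\<phi> x powr r) \<partial>N)"
        by (simp add: nn_integral_cmult)
      also have "\<dots> \<le> ennreal (1 / L powr r) * ennreal (L powr r)"
        by (intro mult_left_mono I) simp
      also have "\<dots> = 1" using L by (simp add: ennreal_mult'[symmetric])
      finally show ?thesis
        using 3 Lp_norm_finite_le_iff[of s 1 N "dual_fn p N \<phi> t"] by (simp add: dual_fn_nonneg)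
    qed
  qed
qed

text \<open>
  For finite \<open>p\<close> the integral equals the norm of \<open>\<phi>\<close>; a lower bound by every \<open>t\<close> below the norm is
  what also holds for \<open>p = \<infinity>\<close>.
\<close>

lemma dual_fn_attains:
  assumes p: "1 \<le> p" and "finite_measure N"
    and [measurable]: "\<phi> \<in> borel_measurable N" and nn: "\<And>x. 0 \<le> \<phi> x"
    and fin: "Lp_norm N p \<phi> < \<infinity>" and t: "0 \<le> t" "ennreal t < Lp_norm N p \<phi>"
  shows "ennreal t \<le> (\<integral>\<^sup>+ x. ennreal (dual_fn p N \<phi> t x * \<phi> x) \<partial>N)"
proof -
  interpret finite_measure N by fact
  show ?thesis
    using p
  proof (cases rule: exponent_cases)
    case 1
    define m where "m = measure N {y\<in>space N. t < \<phi> y}"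
    have "\<not> (AE x in N. \<phi> x \<le> t)"
      using t nn Lp_norm_top_le_iff[of \<phi> N "ennreal t"] by (auto simp: 1)
    then have "m \<noteq> 0"
      by (auto simp: m_def AE_iff_measurable[OF _ refl] not_le emeasure_eq_measure)
    then have "ennreal t = ennreal (t / m) * ennreal m"
      using t by (simp add: ennreal_mult'[symmetric] m_def)
    also have "\<dots> = (\<integral>\<^sup>+ x. ennreal (t / m) * indicator {y\<in>space N. t < \<phi> y} x \<partial>N)"
      by (simp add: nn_integral_cmult_indicator m_def emeasure_eq_measure)
    also have "\<dots> \<le> (\<integral>\<^sup>+ x. ennreal (dual_fn p N \<phi> t x * \<phi> x) \<partial>N)"
      by (intro nn_integral_mono)
        (auto simp: dual_fn_def 1 m_def indicator_def divide_right_mono intro!: ennreal_leI)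
    finally show ?thesis .
  next
    case (2 r)
    define L where "L = enn2real (Lp_norm N p \<phi>)"
    have L: "Lp_norm N p \<phi> = ennreal L" using fin by (simp add: L_def)
    then have tL: "t < L" using t by (simp add: ennreal_less_iff)
    have I0: "ennreal (t powr r) \<le> (\<integral>\<^sup>+ x. ennreal (\<phi> x powr r) \<partial>N)"
      if "t < L" "0 < t" for t
      using Lp_norm_finite_le_iff[of r t N \<phi>] that 2 nn L by (auto simp: not_le less_imp_le)
    \<comment> \<open>Let \<open>t\<close> tend to \<open>L\<close> from below.\<close>
    have "(\<lambda>n. 1 - inverse (real (Suc (Suc n)))) \<longlonglongrightarrow> 1 - 0"
      by (intro tendsto_intros LIMSEQ_Suc[OF LIMSEQ_inverse_real_of_nat])
    then have "(\<lambda>n. ennreal ((L * (1 - inverse (real (Suc (Suc n))))) powr r)) \<longlonglongrightarrow> ennreal ((L * 1) powr r)"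
      using tL t by (intro tendsto_ennrealI tendsto_powr tendsto_intros) auto
    then have "ennreal ((L * 1) powr r) \<le> (\<integral>\<^sup>+ x. ennreal (\<phi> x powr r) \<partial>N)"
    proof (rule LIMSEQ_le_const2, intro exI allI impI)
      fix n :: nat
      have "0 < 1 - inverse (real (Suc (Suc n)))" "1 - inverse (real (Suc (Suc n))) < 1"
        by (simp_all add: field_simps)
      then show "ennreal ((L * (1 - inverse (real (Suc (Suc n))))) powr r) \<le> (\<integral>\<^sup>+ x. ennreal (\<phi> x powr r) \<partial>N)"
        using tL t by (intro I0) simp_all
    qed
    then have I: "ennreal (L powr r) \<le> (\<integral>\<^sup>+ x. ennreal (\<phi> x powr r) \<partial>N)"
      by simp
    have "ennreal t \<le> ennreal L" using tL by (simp add: ennreal_leI)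
    also have "ennreal L = ennreal (1 / L powr (r - 1)) * ennreal (L powr r)"
      using tL t by (simp add: ennreal_mult'[symmetric] powr_diff)
    also have "\<dots> \<le> ennreal (1 / L powr (r - 1)) * (\<integral>\<^sup>+ x. ennreal (\<phi> x powr r) \<partial>N)"
      by (intro mult_left_mono I) simp
    also have "\<dots> = (\<integral>\<^sup>+ x. ennreal (1 / L powr (r - 1)) * ennreal (\<phi> x powr r) \<partial>N)"
      by (simp add: nn_integral_cmult)
    also have "\<dots> = (\<integral>\<^sup>+ x. ennreal (dual_fn p N \<phi> t x * \<phi> x) \<partial>N)"
    proof (intro nn_integral_cong)
      fix x
      have "\<phi> x powr r = \<phi> x powr (r - 1) * \<phi> x"
        using nn[of x] by (cases "\<phi> x = 0") (auto simp: powr_diff)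
      then show "ennreal (1 / L powr (r - 1)) * ennreal (\<phi> x powr r) = ennreal (dual_fn p N \<phi> t x * \<phi> x)"
        using 2 nn[of x] tL t unfolding dual_fn_def L_def[symmetric]
        by (simp add: powr_divide ennreal_mult'[symmetric])
    qed
    finally show ?thesis .
  qed
qed

section \<open>Supports of Borel measures\<close>

lemma closed_support_subset:
  fixes N :: "'b::topological_space measure"
  assumes N: "sets N = sets borel" and C: "closed C" and ae: "AE x in N. x \<in> C"
  shows "closed_support N \<subseteq> C"
proof (rule subsetI, rule ccontr)
  fix x assume x: "x \<in> closed_support N" "x \<notin> C"
  have "- C \<in> sets N" using C N by (simp add: borel_open)
  moreover have "AE x in N. x \<notin> - C" using ae by simp
  ultimately have "emeasure N (- C) = 0"
    using sets_eq_imp_space_eq[OF N] AE_iff_measurable[of "- C" N "\<lambda>x. x \<in> C"] by auto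
  moreover have "0 < emeasure N (- C)"
    using x C by (auto simp: closed_support_def open_Compl)
  ultimately show False by simp
qed

text \<open>
  The complement of the support is covered by the null sets of a countable basis.
\<close>

lemma AE_closed_support:
  fixes N :: "'b::second_countable_topology measure"
  assumes N: "sets N = sets borel"
  shows "AE x in N. x \<in> closed_support N"
proof -
  obtain B :: "'b set set" where B: "countable B" "topological_basis B"
    using ex_countable_basis by blast
  define Z where "Z = {U \<in> B. emeasure N U = 0}"
  have "\<Union>Z \<in> null_sets N"
  proof (rule null_sets_UN'[of Z "\<lambda>U. U", simplified])
    show "countable Z" using B by (simp add: Z_def)
    fix U assume "U \<in> Z"
    then show "U \<in> null_sets N"
      using B N by (auto simp: Z_def null_sets_def topological_basis_open borel_open)
  qed
  then show ?thesis
  proof (rule AE_I', safe)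
    fix x assume "x \<notin> closed_support N"
    then obtain U where U: "open U" "x \<in> U" "emeasure N U = 0"
      by (auto simp: closed_support_def)
    then obtain V where V: "V \<in> B" "x \<in> V" "V \<subseteq> U"
      using B(2) topological_basisE by blast
    have "emeasure N V \<le> emeasure N U"
      using U V N by (intro emeasure_mono) (auto simp: borel_open)
    then show "x \<in> \<Union>Z" using U V by (auto simp: Z_def)
  qed
qed

section \<open>The one-sided gauge of a law with moments\<close>

text \<open>
  The real number behind \<open>psi\<close>, written as the \<open>L\<^sup>p\<close>-norm of \<open>(h \<bullet> x)\<^sup>-\<close> for all \<open>p\<close> alike. For
  \<open>p = \<infinity>\<close> this is the positive part of the support function \<open>s(-h|supp N)\<close>, and the two coincide when
  \<open>0\<close> is in the convex hull of the support.
\<close>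

definition lower_gauge :: "ennreal \<Rightarrow> 'b::real_inner measure \<Rightarrow> 'b \<Rightarrow> real" where
  "lower_gauge p N h = enn2real (Lp_norm N p (\<lambda>x. neg_part (h \<bullet> x)))"

lemma lower_gauge_nonneg: "0 \<le> lower_gauge p N h"
  by (simp add: lower_gauge_def)

lemma neg_part_nonneg: "0 \<le> neg_part t"
  by (simp add: neg_part_def)

lemma neg_part_measurable [measurable]: "neg_part \<in> borel_measurable borel"
  unfolding neg_part_def[abs_def] by measurable

lemma abs_neg_part_inner_le: "\<bar>neg_part (h \<bullet> x)\<bar> \<le> norm h * norm x"
  using Cauchy_Schwarz_ineq2[of h x] by (auto simp: neg_part_def)

locale moment_law =
  fixes N :: "'b::euclidean_space measure" and p q :: ennreal
  assumes prob: "prob_space N"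
    and sets_N [measurable_cong]: "sets N = sets borel"
    and conj: "conjugate p q"
    and fin: "Lp_norm N p (\<lambda>x. x) < \<infinity>"
begin

sublocale prob_space N by (rule prob)

lemma exponents: "1 \<le> p" "1 \<le> q"
  using conj conjugate_ge_1 by auto

definition moment :: real where
  "moment = enn2real (Lp_norm N p (\<lambda>x. x))"

lemma moment: "Lp_norm N p (\<lambda>x. x) = ennreal moment" "0 \<le> moment"
  using fin by (auto simp: moment_def)

lemma neg_part_inner_norm_le:
  "Lp_norm N p (\<lambda>x. neg_part (h \<bullet> x)) \<le> ennreal (norm h * moment)"
proof -
  have "Lp_norm N p (\<lambda>x. neg_part (h \<bullet> x)) \<le> Lp_norm N p (\<lambda>x. norm h *\<^sub>R x)"
    using abs_neg_part_inner_le by (intro Lp_norm_mono exponents AE_I2) auto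
  also have "\<dots> \<le> ennreal (norm h * moment)"
    using Lp_norm_scaleR_le[of "\<lambda>x. x" N p moment "norm h"] moment exponents by simp
  finally show ?thesis .
qed

lemma lower_gauge: "Lp_norm N p (\<lambda>x. neg_part (h \<bullet> x)) = ennreal (lower_gauge p N h)"
  using neg_part_inner_norm_le[of h] ennreal_less_top le_less_trans
  by (fastforce simp: lower_gauge_def)

lemma lower_gauge_le_norm: "lower_gauge p N h \<le> norm h * moment"
  using neg_part_inner_norm_le[of h] moment by (simp add: lower_gauge)

lemma lower_gauge_mono_AE:
  assumes "AE x in N. neg_part (h \<bullet> x) \<le> neg_part (h' \<bullet> x)"
  shows "lower_gauge p N h \<le> lower_gauge p N h'"
proof -
  have "Lp_norm N p (\<lambda>x. neg_part (h \<bullet> x)) \<le> Lp_norm N p (\<lambda>x. neg_part (h' \<bullet> x))"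
    using assms exponents by (intro Lp_norm_mono) (auto simp: neg_part_nonneg)
  then show ?thesis by (simp add: lower_gauge lower_gauge_nonneg)
qed

lemma lower_gauge_scale_le:
  assumes "0 \<le> t"
  shows "lower_gauge p N (t *\<^sub>R h) \<le> t * lower_gauge p N h"
proof -
  have "(\<lambda>x. neg_part ((t *\<^sub>R h) \<bullet> x)) = (\<lambda>x. t *\<^sub>R neg_part (h \<bullet> x))"
    using assms by (auto simp: neg_part_def max_def mult_le_0_iff zero_le_mult_iff fun_eq_iff)
  then have "ennreal (lower_gauge p N (t *\<^sub>R h)) \<le> ennreal (\<bar>t\<bar> * lower_gauge p N h)"
    using Lp_norm_scaleR_le[of "\<lambda>x. neg_part (h \<bullet> x)" N p "lower_gauge p N h" t] exponents assms
    by (simp add: lower_gauge lower_gauge_nonneg flip: lower_gauge)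
  then show ?thesis using assms lower_gauge_nonneg[of p N h] by (simp add: ennreal_le_iff)
qed

lemma lower_gauge_scale:
  assumes "0 \<le> t"
  shows "lower_gauge p N (t *\<^sub>R h) = t * lower_gauge p N h"
proof (cases "t = 0")
  case True
  then show ?thesis using lower_gauge_scale_le[of 0 h] lower_gauge_nonneg[of p N "0 *\<^sub>R h"] by simp
next
  case False
  then have "lower_gauge p N h \<le> (1 / t) * lower_gauge p N (t *\<^sub>R h)"
    using lower_gauge_scale_le[of "1 / t" "t *\<^sub>R h"] assms by simp
  then have "t * lower_gauge p N h \<le> lower_gauge p N (t *\<^sub>R h)"
    using False assms by (simp add: field_simps)
  then show ?thesis using lower_gauge_scale_le[OF assms, of h] by simp
qed

lemma lower_gauge_add_le: "lower_gauge p N (h + h') \<le> lower_gauge p N h + lower_gauge p N h'"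
proof -
  have "Lp_norm N p (\<lambda>x. neg_part ((h + h') \<bullet> x))
      \<le> Lp_norm N p (\<lambda>x. neg_part (h \<bullet> x) + neg_part (h' \<bullet> x))"
    using exponents by (intro Lp_norm_mono AE_I2) (auto simp: neg_part_def inner_add_left)
  also have "\<dots> \<le> ennreal (lower_gauge p N h + lower_gauge p N h')"
    using exponents by (intro Lp_norm_add_le) (auto simp: lower_gauge lower_gauge_nonneg)
  finally show ?thesis by (simp add: lower_gauge lower_gauge_nonneg del: ennreal_plus)
qed

lemma lower_gauge_lipschitz: "lower_gauge p N h \<le> lower_gauge p N h' + norm (h - h') * moment"
  using lower_gauge_add_le[of h' "h - h'"] lower_gauge_le_norm[of "h - h'"] by simp

lemma continuous_on_lower_gauge: "continuous_on S (lower_gauge p N)"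
proof -
  have "dist (lower_gauge p N h) (lower_gauge p N h') \<le> moment * dist h h'" for h h'
    using lower_gauge_lipschitz[of h h'] lower_gauge_lipschitz[of h' h]
    by (auto simp: dist_norm norm_minus_commute mult.commute abs_le_iff)
  then have "moment-lipschitz_on S (lower_gauge p N)"
    using moment by (intro lipschitz_onI) auto
  then show ?thesis by (rule lipschitz_on_continuous_on)
qed

lemma AE_orthogonal:
  assumes "\<And>x. x \<in> D_span N \<Longrightarrow> u \<bullet> x = 0"
  shows "AE x in N. u \<bullet> x = 0"
  using AE_closed_support[OF sets_N] by eventually_elim (auto intro: assms simp: D_span_def span_base)

lemma lower_gauge_add_orthogonal:
  assumes "\<And>x. x \<in> D_span N \<Longrightarrow> u \<bullet> x = 0"
  shows "lower_gauge p N (h + u) = lower_gauge p N h"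
proof (rule antisym)
  show "lower_gauge p N (h + u) \<le> lower_gauge p N h"
    using AE_orthogonal[OF assms] by (intro lower_gauge_mono_AE) (auto elim!: eventually_mono simp: inner_add_left)
  show "lower_gauge p N h \<le> lower_gauge p N (h + u)"
    using AE_orthogonal[OF assms] by (intro lower_gauge_mono_AE) (auto elim!: eventually_mono simp: inner_add_left)
qed

lemma D_decomposition:
  obtains y u where "y \<in> D_span N" "\<And>x. x \<in> D_span N \<Longrightarrow> u \<bullet> x = 0" "h = y + u"
  using orthogonal_subspace_decomp_exists[of "closed_support N" h]
  unfolding D_span_def orthogonal_def by metis

lemma mem_D_iff: "y \<in> D_span N \<longleftrightarrow> (\<forall>u. (\<forall>x\<in>D_span N. u \<bullet> x = 0) \<longrightarrow> u \<bullet> y = 0)"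
proof safe
  assume *: "\<forall>u. (\<forall>x\<in>D_span N. u \<bullet> x = 0) \<longrightarrow> u \<bullet> y = 0"
  obtain z u where zu: "z \<in> D_span N" "\<And>x. x \<in> D_span N \<Longrightarrow> u \<bullet> x = 0" "y = z + u"
    using D_decomposition by blast
  then have "u \<bullet> y = 0" "u \<bullet> z = 0" using * by auto
  then have "u = 0" using zu by (simp add: inner_add_right)
  then show "y \<in> D_span N" using zu by simp
qed auto

lemma integrable_weight:
  assumes [measurable]: "k \<in> borel_measurable N" and k: "Lp_norm N q k \<le> ennreal c" and "0 \<le> c"
  shows "integrable N (\<lambda>x. k x *\<^sub>R x)" "norm (\<integral>x. k x *\<^sub>R x \<partial>N) \<le> c * moment"
proof -
  have I: "(\<integral>\<^sup>+ x. ennreal (norm (k x *\<^sub>R x)) \<partial>N) \<le> ennreal (c * moment)"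
    using Hoelder[OF conjugate_sym[OF conj], of k N "\<lambda>x. x" c moment] assms moment by simp
  then show int: "integrable N (\<lambda>x. k x *\<^sub>R x)"
    using le_less_trans[OF I ennreal_less_top] by (intro integrableI_bounded) auto
  have "ennreal (norm (\<integral>x. k x *\<^sub>R x \<partial>N)) \<le> (\<integral>\<^sup>+ x. ennreal (norm (k x *\<^sub>R x)) \<partial>N)"
    using integral_norm_bound_ennreal[OF int] .
  also note I
  finally show "norm (\<integral>x. k x *\<^sub>R x \<partial>N) \<le> c * moment"
    using assms moment by simp
qed

text \<open>
  A vector orthogonal to \<open>D\<close> is orthogonal to \<open>N\<close>-almost every \<open>x\<close>, hence to every weighted mean.
\<close>

lemma weighted_mean_in_D:
  assumes int: "integrable N (\<lambda>x. k x *\<^sub>R x)"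
  shows "(\<integral>x. k x *\<^sub>R x \<partial>N) \<in> D_span N"
  unfolding mem_D_iff
proof safe
  fix u assume "\<forall>x\<in>D_span N. u \<bullet> x = 0"
  then have "AE x in N. u \<bullet> x = 0" by (intro AE_orthogonal) auto
  then have "(\<integral>x. u \<bullet> (k x *\<^sub>R x) \<partial>N) = 0"
    by (intro integral_eq_zero_AE) (auto elim!: eventually_mono)
  then show "u \<bullet> (\<integral>x. k x *\<^sub>R x \<partial>N) = 0"
    using integral_inner_right[of u N "\<lambda>x. k x *\<^sub>R x"] int by argo
qed

end

section \<open>A countable family of weights\<close>

definition dense_seq :: "nat \<Rightarrow> 'b::second_countable_topology" where
  "dense_seq = (SOME e. \<forall>U. open U \<longrightarrow> U \<noteq> {} \<longrightarrow> (\<exists>j. e j \<in> U))"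

lemma dense_seq:
  assumes "open U" "U \<noteq> {}"
  obtains j where "(dense_seq j :: 'b::second_countable_topology) \<in> U"
proof -
  obtain D :: "'b set" where D: "countable D" "\<And>X. open X \<Longrightarrow> X \<noteq> {} \<Longrightarrow> \<exists>d\<in>D. d \<in> X"
    using countable_dense_exists by blast
  then have ne: "D \<noteq> {}" using D(2)[of UNIV] by auto
  have "\<exists>e :: nat \<Rightarrow> 'b. \<forall>U. open U \<longrightarrow> U \<noteq> {} \<longrightarrow> (\<exists>j. e j \<in> U)"
  proof (intro exI[of _ "from_nat_into D"] allI impI)
    fix U :: "'b set" assume "open U" "U \<noteq> {}"
    then obtain d where "d \<in> D" "d \<in> U" using D by blast
    then show "\<exists>j. from_nat_into D j \<in> U" using D(1) from_nat_into_surj by metis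
  qed
  from someI_ex[OF this] assms that show thesis
    unfolding dense_seq_def[symmetric] by blast
qed

text \<open>
  The base weights are the norm-attaining functions of \<open>x \<mapsto> (h \<bullet> x)\<^sup>-\<close> for \<open>h\<close> in a countable dense
  set. Closing the family under midpoints makes the closure of the set of its weighted means convex
  and keeps the family countable.
\<close>

datatype weight_index = Base nat rat | Mid weight_index weight_index

instance weight_index :: countable
  by countable_datatype

text \<open>
  The absolute value keeps the level of the norm-attaining function non-negative, so that the weight
  vanishes wherever \<open>(h \<bullet> x)\<^sup>-\<close> does.
\<close>

primrec weight :: "ennreal \<Rightarrow> 'b::euclidean_space measure \<Rightarrow> weight_index \<Rightarrow> 'b \<Rightarrow> real" where
  "weight p N (Base j t) =
     dual_fn p N (\<lambda>x. neg_part (dense_seq j \<bullet> x)) (real_of_rat \<bar>t\<bar>)"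
| "weight p N (Mid i j) = (\<lambda>x. (weight p N i x + weight p N j x) / 2)"

definition mean :: "ennreal \<Rightarrow> 'b::euclidean_space measure \<Rightarrow> weight_index \<Rightarrow> 'b" where
  "mean p N i = (\<integral>x. weight p N i x *\<^sub>R x \<partial>N)"

lemma weight_nonneg: "0 \<le> weight p N i x"
  by (induction i) (auto simp: dual_fn_nonneg)

lemma weight_measurable [measurable]: "weight p N i \<in> borel_measurable borel"
  by (induction i) auto

lemma weight_norm_le_1:
  assumes pq: "conjugate p q" and N: "finite_measure N" and [measurable_cong]: "sets N = sets borel"
  shows "Lp_norm N q (weight p N i) \<le> ennreal 1"
proof (induction i)
  case (Base j t)
  have "Lp_norm N q (dual_fn p N (\<lambda>x. neg_part (dense_seq j \<bullet> x)) (real_of_rat \<bar>t\<bar>)) \<le> 1"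
    by (intro dual_fn_norm_le_1 pq N) (auto simp: neg_part_nonneg)
  then show ?case by simp
next
  case (Mid i j)
  have m: "weight p N i \<in> borel_measurable N" for i by measurable
  have "Lp_norm N q (\<lambda>x. weight p N i x + weight p N j x) \<le> ennreal (1 + 1)"
    using Mid conjugate_ge_1[OF pq] by (intro Lp_norm_add_le m) auto
  then have "Lp_norm N q (\<lambda>x. (1 / 2) *\<^sub>R (weight p N i x + weight p N j x)) \<le> ennreal (\<bar>1 / 2\<bar> * (1 + 1))"
    using conjugate_ge_1[OF pq] m by (intro Lp_norm_scaleR_le) auto
  then show ?case by simp
qed

context moment_law
begin

lemma weight_N_measurable: "weight p N i \<in> borel_measurable N"
  by measurable

lemma integrable_weight_scaleR: "integrable N (\<lambda>x. weight p N i x *\<^sub>R x)"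
  using integrable_weight(1)[OF weight_N_measurable weight_norm_le_1[OF conj _ sets_N]] finite_measure_axioms
  by simp

lemma norm_mean_le: "norm (mean p N i) \<le> moment"
  using integrable_weight(2)[OF weight_N_measurable weight_norm_le_1[OF conj _ sets_N]] finite_measure_axioms
  by (simp add: mean_def)

lemma mean_in_D: "mean p N i \<in> D_span N"
  unfolding mean_def by (intro weighted_mean_in_D integrable_weight_scaleR)

lemma mean_Mid: "mean p N (Mid i j) = (1 / 2) *\<^sub>R (mean p N i + mean p N j)"
proof -
  have "mean p N (Mid i j)
      = (\<integral>x. (1 / 2) *\<^sub>R (weight p N i x *\<^sub>R x + weight p N j x *\<^sub>R x) \<partial>N)"
    by (simp add: mean_def scaleR_left_distrib[symmetric])
  also have "\<dots> = (1 / 2) *\<^sub>R (mean p N i + mean p N j)"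
    unfolding mean_def
    by (subst integral_scaleR_right) (simp add: integrable_weight_scaleR)
  finally show ?thesis .
qed

lemma mean_Base_attains:
  assumes "0 < e"
  shows "\<exists>t. lower_gauge p N (dense_seq j) - e \<le> - (dense_seq j \<bullet> mean p N (Base j t))"
proof -
  define h :: 'b where "h = dense_seq j"
  define \<phi> where "\<phi> x = neg_part (h \<bullet> x)" for x
  have [measurable]: "\<phi> \<in> borel_measurable N" unfolding \<phi>_def by measurable
  have w: "weight p N (Base j t) x * \<phi> x = - (h \<bullet> (weight p N (Base j t) x *\<^sub>R x))" for t x
    using dual_fn_eq_0[of "real_of_rat \<bar>t\<bar>" "\<lambda>x. neg_part (dense_seq j \<bullet> x)" x p N]
    by (cases "h \<bullet> x \<le> 0") (auto simp: \<phi>_def neg_part_def h_def max_def)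
  have int: "(\<integral>x. weight p N (Base j t) x * \<phi> x \<partial>N) = - (h \<bullet> mean p N (Base j t))" for t
    unfolding mean_def w
    by (subst integral_inner_right[symmetric]) (auto simp: integrable_weight_scaleR simp del: weight.simps inner_scaleR_right)
  have nn: "0 \<le> weight p N (Base j t) x * \<phi> x" for t x
    unfolding \<phi>_def by (intro mult_nonneg_nonneg weight_nonneg neg_part_nonneg)
  have nnint: "0 \<le> - (h \<bullet> mean p N (Base j t))" for t
    unfolding int[symmetric] by (intro integral_nonneg_AE AE_I2 nn)
  show ?thesis
  proof (cases "lower_gauge p N h - e \<le> 0")
    case True
    show ?thesis using nnint[of 0] True unfolding h_def by (intro exI[of _ 0]) simp
  next
    case False
    obtain t where t: "lower_gauge p N h - e < real_of_rat t" "real_of_rat t < lower_gauge p N h"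
      using of_rat_dense[of "lower_gauge p N h - e" "lower_gauge p N h"] assms by auto
    then have t0: "0 \<le> real_of_rat t" using False by linarith
    then have abs: "\<bar>t\<bar> = t" by (simp add: zero_le_of_rat_iff)
    have "integrable N (\<lambda>x. weight p N (Base j t) x * \<phi> x)"
      unfolding w by (intro integrable_minus integrable_inner_right impI integrable_weight_scaleR)
    then have "ennreal (\<integral>x. weight p N (Base j t) x * \<phi> x \<partial>N) = (\<integral>\<^sup>+x. ennreal (weight p N (Base j t) x * \<phi> x) \<partial>N)"
      by (intro nn_integral_eq_integral[symmetric] AE_I2 nn)
    also have "\<dots> \<ge> ennreal (real_of_rat t)"
      using dual_fn_attains[of p N \<phi> "real_of_rat t"] t t0 abs exponents finite_measure_axioms lower_gauge[of h]
      by (simp add: \<phi>_def[abs_def] h_def neg_part_nonneg ennreal_less_iff)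
    finally have "real_of_rat t \<le> - (h \<bullet> mean p N (Base j t))"
      using nnint[of t] by (simp add: int ennreal_le_iff del: weight.simps)
    then show ?thesis using t unfolding h_def by (intro exI[of _ t]) simp
  qed
qed

text \<open>
  The dense set of directions suffices because the gauge is Lipschitz continuous in \<open>h\<close> and the means
  are bounded.
\<close>

lemma mean_attains:
  assumes "0 < e"
  shows "\<exists>i. lower_gauge p N h - e \<le> - (h \<bullet> mean p N i)"
proof -
  define d where "d = e / (3 * (moment + 1))"
  have d: "0 < d" "d * moment \<le> e / 3"
    using assms moment by (auto simp: d_def field_simps)
  obtain j where j: "(dense_seq j :: 'b) \<in> ball h d"
    using dense_seq[of "ball h d"] d by auto
  define h' :: 'b where "h' = dense_seq j"
  have hh: "norm (h - h') \<le> d" using j by (simp add: h'_def dist_norm)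
  obtain t where t: "lower_gauge p N h' - e / 3 \<le> - (h' \<bullet> mean p N (Base j t))"
    using mean_Base_attains[of "e / 3" j] assms unfolding h'_def by auto
  have "\<bar>(h - h') \<bullet> mean p N (Base j t)\<bar> \<le> norm (h - h') * norm (mean p N (Base j t))"
    by (rule Cauchy_Schwarz_ineq2)
  also have "\<dots> \<le> d * moment"
    using hh norm_mean_le by (intro mult_mono) (auto simp: d less_imp_le)
  finally have "- (h' \<bullet> mean p N (Base j t)) \<le> - (h \<bullet> mean p N (Base j t)) + e / 3"
    using d by (simp add: inner_diff_left)
  moreover have "lower_gauge p N h \<le> lower_gauge p N h' + d * moment"
    using lower_gauge_lipschitz[of h h'] hh moment by (meson add_left_mono mult_right_mono order_trans)
  ultimately show ?thesis using t d by (intro exI[of _ "Base j t"]) linarith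
qed

text \<open>
  The separation argument. If \<open>y\<close> is not a limit of means, let \<open>z\<close> be the point of the closure that
  is closest to \<open>y\<close>. As the means are closed under midpoints, \<open>h = z - y\<close> separates \<open>y\<close> from
  all of them; this contradicts the fact that the means come arbitrarily close to the gauge of \<open>h\<close>.
\<close>

lemma mem_closure_means:
  assumes dom: "\<And>h. - (h \<bullet> y) \<le> lower_gauge p N h"
  shows "y \<in> closure (range (mean p N))"
proof -
  define C where "C = closure (range (mean p N))"
  have "closed C" "C \<noteq> {}" by (auto simp: C_def)
  then obtain z where z: "z \<in> C" "\<And>w. w \<in> C \<Longrightarrow> dist y z \<le> dist y w"
    using distance_attains_inf by blast
  have mid: "(1 / 2) *\<^sub>R (v + w) \<in> C" if vw: "v \<in> C" "w \<in> C" for v w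
  proof -
    obtain f g where fg: "\<And>n. f n \<in> range (mean p N)" "f \<longlonglongrightarrow> v" "\<And>n. g n \<in> range (mean p N)" "g \<longlonglongrightarrow> w"
      using vw unfolding C_def closure_sequential by blast
    have "(1 / 2) *\<^sub>R (f n + g n) \<in> range (mean p N)" for n
    proof -
      obtain i j where ij: "f n = mean p N i" "g n = mean p N j"
        using fg(1)[of n] fg(3)[of n] by blast
      show ?thesis unfolding ij mean_Mid[symmetric] by (rule rangeI)
    qed
    moreover have "(\<lambda>n. (1 / 2) *\<^sub>R (f n + g n)) \<longlonglongrightarrow> (1 / 2) *\<^sub>R (v + w)"
      by (intro tendsto_scaleR tendsto_add tendsto_const fg(2,4))
    ultimately show ?thesis
      unfolding C_def closure_sequential by (intro exI[of _ "\<lambda>n. (1 / 2) *\<^sub>R (f n + g n)"] conjI allI)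
  qed
  have obtuse: "(y - z) \<bullet> (w - z) \<le> 0" if w: "w \<in> C" for w
  proof -
    have "z + (1 / 2 ^ n) *\<^sub>R (w - z) \<in> C" for n
    proof (induction n)
      case (Suc n)
      have "(1 / 2) *\<^sub>R (z + (z + v)) = z + (1 / 2) *\<^sub>R v" for v
        by (simp only: add.assoc[symmetric] scaleR_add_right[of _ "z + z"] scaleR_half_double)
      then have "z + (1 / 2 ^ Suc n) *\<^sub>R (w - z) = (1 / 2) *\<^sub>R (z + (z + (1 / 2 ^ n) *\<^sub>R (w - z)))"
        by simp
      then show ?case using mid[OF z(1) Suc.IH] by simp
    qed (use w in simp)
    then have "dist y z \<le> dist y (z + (1 / 2 ^ n) *\<^sub>R (w - z))" for n
      using z by blast
    then have sq: "(norm (y - z))\<^sup>2 \<le> (norm ((y - z) - (1 / 2 ^ n) *\<^sub>R (w - z)))\<^sup>2" for n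
      by (intro power_mono) (simp_all add: dist_norm diff_diff_eq)
    have le: "2 * ((y - z) \<bullet> (w - z)) \<le> (1 / 2 ^ n) * (norm (w - z))\<^sup>2" for n
    proof -
      define t :: real where "t = 1 / 2 ^ n"
      have t: "0 < t" by (simp add: t_def)
      have "t * (2 * ((y - z) \<bullet> (w - z))) \<le> t * (t * (norm (w - z))\<^sup>2)"
      proof -
        have "(norm (t *\<^sub>R (w - z)))\<^sup>2 = t * (t * (norm (w - z))\<^sup>2)"
          by (simp add: power_mult_distrib power2_eq_square)
        moreover have "(y - z) \<bullet> (t *\<^sub>R (w - z)) = t * ((y - z) \<bullet> (w - z))" by simp
        ultimately show ?thesis
          using sq[of n] dot_norm_neg[of "y - z" "t *\<^sub>R (w - z)"] unfolding t_def[symmetric] by argo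
      qed
      then show ?thesis using t unfolding t_def[symmetric] by simp
    qed
    have "(\<lambda>n. (1 / 2 ^ n) * (norm (w - z))\<^sup>2) \<longlonglongrightarrow> 0 * (norm (w - z))\<^sup>2"
      by (intro tendsto_mult tendsto_const LIMSEQ_divide_realpow_zero) auto
    then have "2 * ((y - z) \<bullet> (w - z)) \<le> 0 * (norm (w - z))\<^sup>2"
      using le by (intro LIMSEQ_le_const) auto
    then show ?thesis by simp
  qed
  have "y = z"
  proof (rule ccontr)
    assume "y \<noteq> z"
    define h where "h = z - y"
    define e where "e = (norm h)\<^sup>2 / 2"
    have "0 < e" using \<open>y \<noteq> z\<close> by (simp add: e_def h_def)
    then obtain i where i: "lower_gauge p N h - e \<le> - (h \<bullet> mean p N i)"
      using mean_attains by blast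
    have "mean p N i \<in> C" unfolding C_def by (intro closure_subset[THEN subsetD]) simp
    then have "h \<bullet> (mean p N i - z) \<ge> 0"
      using obtuse[of "mean p N i"] by (simp add: h_def inner_diff_left)
    moreover have "h \<bullet> z = h \<bullet> y + (norm h)\<^sup>2"
      by (simp add: power2_norm_eq_inner inner_diff_right[symmetric]) (simp add: h_def inner_diff_right)
    ultimately have "lower_gauge p N h - e \<le> - (h \<bullet> y) - (norm h)\<^sup>2"
      using i by (simp add: inner_diff_right)
    then have "(norm h)\<^sup>2 \<le> e" using dom[of h] by simp
    then show False using \<open>0 < e\<close> by (simp add: e_def)
  qed
  then show ?thesis using z by (simp add: C_def)
qed

lemma mean_approximates:
  assumes dom: "\<And>h. h \<bullet> r \<le> c * lower_gauge p N h" and "0 < c" "0 < d"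
  shows "\<exists>i. norm (r + c *\<^sub>R mean p N i) < d"
proof -
  have "- (h \<bullet> (- (1 / c) *\<^sub>R r)) \<le> lower_gauge p N h" for h
    using dom[of h] \<open>0 < c\<close> by (simp add: field_simps)
  then have "- (1 / c) *\<^sub>R r \<in> closure (range (mean p N))"
    by (rule mem_closure_means)
  then obtain i where i: "dist (mean p N i) (- (1 / c) *\<^sub>R r) < d / c"
    using \<open>0 < c\<close> \<open>0 < d\<close> unfolding closure_approachable by (metis divide_pos_pos rangeE)
  have "r + c *\<^sub>R mean p N i = c *\<^sub>R (mean p N i - (- (1 / c) *\<^sub>R r))"
    using \<open>0 < c\<close> by (simp add: scaleR_right_distrib algebra_simps)
  then have "norm (r + c *\<^sub>R mean p N i) = c * dist (mean p N i) (- (1 / c) *\<^sub>R r)"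
    using \<open>0 < c\<close> by (simp only: norm_scaleR dist_norm abs_of_pos)
  also have "\<dots> < c * (d / c)" using i \<open>0 < c\<close> by (intro mult_strict_left_mono)
  finally show ?thesis using \<open>0 < c\<close> by (intro exI[of _ i]) simp
qed

end

section \<open>Laws whose support surrounds the origin\<close>

text \<open>
  If \<open>x\<close> is the increment of a price, the condition says that no portfolio \<open>h\<close> has \<open>h \<bullet> x \<ge> 0\<close> almost
  surely without \<open>h \<bullet> x = 0\<close> almost surely.
\<close>

locale arbitrage_free_law = moment_law +
  assumes ri: "0 \<in> rel_interior (convex hull (closed_support N))"
begin

text \<open>
  If \<open>h \<bullet> x \<ge> 0\<close> on the support, then also on its convex hull. From each point of the support the
  segment through \<open>0\<close> can be prolonged within the hull, which forces \<open>h \<bullet> x = 0\<close>.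
\<close>

lemma lower_gauge_eq_0D:
  assumes h: "h \<in> D_span N" and 0: "lower_gauge p N h = 0"
  shows "h = 0"
proof -
  let ?C = "convex hull (closed_support N)"
  have "AE x in N. neg_part (h \<bullet> x) = 0"
    using lower_gauge[of h] 0 exponents by (intro Lp_norm_eq_0D) auto
  then have "AE x in N. x \<in> {x. 0 \<le> h \<bullet> x}"
    by eventually_elim (auto simp: neg_part_def max_def split: if_splits)
  then have "closed_support N \<subseteq> {x. 0 \<le> h \<bullet> x}"
    using closed_halfspace_ge[of 0 h] by (intro closed_support_subset sets_N) auto
  then have C: "?C \<subseteq> {x. 0 \<le> h \<bullet> x}"
    using convex_halfspace_ge[of 0 h] by (intro hull_minimal) auto
  have "h \<bullet> x = 0" if x: "x \<in> closed_support N" for x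
  proof -
    have "x \<in> ?C" using x by (simp add: hull_inc)
    moreover from this obtain e where "e > 1" "(1 - e) *\<^sub>R x + e *\<^sub>R 0 \<in> ?C"
      using ri convex_rel_interior_iff[of ?C 0] by (metis convex_convex_hull empty_iff)
    ultimately have "0 \<le> h \<bullet> x" "0 \<le> (1 - e) * (h \<bullet> x)" "e > 1" using C by auto
    then show ?thesis by (smt (verit) mult_neg_pos)
  qed
  then have "orthogonal h x" if "x \<in> D_span N" for x
    using that orthogonal_to_span[of x "closed_support N" h] unfolding D_span_def
    by (auto simp: orthogonal_def)
  then show "h = 0" using h orthogonal_self by blast
qed

text \<open>
  By homogeneity it is enough to minimise the gauge over the compact unit sphere of \<open>D\<close>.
\<close>

lemma lower_gauge_coercive: "\<exists>c>0. \<forall>h\<in>D_span N. c * norm h \<le> lower_gauge p N h"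
proof (cases "sphere 0 1 \<inter> D_span N = {}")
  case True
  have "D_span N \<subseteq> {0}"
  proof
    fix h assume h: "h \<in> D_span N"
    have "(1 / norm h) *\<^sub>R h \<in> D_span N" using h by (simp add: D_span_def span_scale)
    then show "h \<in> {0}" using True by (cases "h = 0") (auto simp: disjoint_iff)
  qed
  then show ?thesis using lower_gauge_nonneg by (intro exI[of _ 1]) (auto dest!: subsetD)
next
  case False
  have "compact (sphere 0 1 \<inter> D_span N)"
    by (intro compact_Int_closed) (auto simp: D_span_def closed_span)
  then obtain h0 where h0: "h0 \<in> sphere 0 1 \<inter> D_span N"
    "\<And>h. h \<in> sphere 0 1 \<inter> D_span N \<Longrightarrow> lower_gauge p N h0 \<le> lower_gauge p N h"
    using continuous_attains_inf[OF _ False continuous_on_lower_gauge] by blast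
  have "lower_gauge p N h0 \<noteq> 0" using lower_gauge_eq_0D[of h0] h0(1) by auto
  then have pos: "0 < lower_gauge p N h0" using lower_gauge_nonneg[of p N h0] by simp
  have "lower_gauge p N h0 * norm h \<le> lower_gauge p N h" if h: "h \<in> D_span N" for h
  proof (cases "h = 0")
    case True
    then show ?thesis using lower_gauge_nonneg by simp
  next
    case False
    have "(1 / norm h) *\<^sub>R h \<in> sphere 0 1 \<inter> D_span N"
      using h False by (simp add: D_span_def span_scale)
    then have "lower_gauge p N h0 \<le> (1 / norm h) * lower_gauge p N h"
      using h0(2) lower_gauge_scale[of "1 / norm h" h] by (metis divide_nonneg_nonneg norm_ge_zero zero_le_one)
    then show ?thesis using False by (simp add: field_simps)
  qed
  then show ?thesis using pos by blast
qed

text \<open>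
  The assumption on the support enters the approximation procedure here: by coercivity a residual that
  is small in norm has a small support function on \<open>T\<close>.
\<close>

lemma small_dominated:
  assumes "0 < e"
  shows "\<exists>d>0. \<forall>r\<in>D_span N. norm r < d \<longrightarrow> (\<forall>h. h \<bullet> r \<le> e * lower_gauge p N h)"
proof -
  obtain c where c: "0 < c" "\<And>h. h \<in> D_span N \<Longrightarrow> c * norm h \<le> lower_gauge p N h"
    using lower_gauge_coercive by blast
  show ?thesis
  proof (intro exI[of _ "e * c"] conjI ballI allI impI)
    fix r h assume r: "r \<in> D_span N" "norm r < e * c"
    obtain y u where yu: "y \<in> D_span N" "\<And>x. x \<in> D_span N \<Longrightarrow> u \<bullet> x = 0" "h = y + u"
      using D_decomposition by blast
    have "h \<bullet> r = y \<bullet> r" using yu r by (simp add: inner_add_left)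
    also have "\<dots> \<le> norm y * norm r" by (rule norm_cauchy_schwarz)
    also have "\<dots> \<le> norm y * (e * c)" using r by (intro mult_left_mono) auto
    also have "\<dots> = e * (c * norm y)" by simp
    also have "\<dots> \<le> e * lower_gauge p N y" using c yu assms by (intro mult_left_mono) auto
    also have "lower_gauge p N y = lower_gauge p N h" using lower_gauge_add_orthogonal[of u y] yu by simp
    finally show "h \<bullet> r \<le> e * lower_gauge p N h" .
  qed (use assms c in simp)
qed

text \<open>
  One step of the successive approximation: at the cost of a weight of norm \<open>c\<close>, the residual \<open>r\<close> is
  replaced by one whose domination constant \<open>e\<close> is as small as desired.
\<close>

lemma mean_reduces:
  assumes r: "r \<in> D_span N" and dom: "\<And>h. h \<bullet> r \<le> c * lower_gauge p N h" and "0 < c" "0 < e"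
  shows "\<exists>i. \<forall>h. h \<bullet> (r + c *\<^sub>R mean p N i) \<le> e * lower_gauge p N h"
proof -
  obtain d where d: "0 < d" "\<And>r h. r \<in> D_span N \<Longrightarrow> norm r < d \<Longrightarrow> h \<bullet> r \<le> e * lower_gauge p N h"
    using small_dominated[OF \<open>0 < e\<close>] by blast
  obtain i where "norm (r + c *\<^sub>R mean p N i) < d"
    using mean_approximates[OF dom \<open>0 < c\<close> d(1)] by blast
  moreover have "r + c *\<^sub>R mean p N i \<in> D_span N"
    using r mean_in_D[of i] by (simp add: D_span_def span_add span_scale)
  ultimately show ?thesis using d by blast
qed

text \<open>
  Every \<open>r \<in> D\<close> is dominated by a multiple of the gauge, so \<open>mean_approximates\<close> applies to \<open>- r\<close>. The
  point of this dense set is that its elements depend measurably on the law.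
\<close>

lemma multiples_of_means_dense:
  assumes r: "r \<in> D_span N" and "0 < d"
  shows "\<exists>m i. norm (r - real m *\<^sub>R mean p N i) < d"
proof -
  obtain d' where d': "0 < d'" "\<And>r h. r \<in> D_span N \<Longrightarrow> norm r < d' \<Longrightarrow> h \<bullet> r \<le> 1 * lower_gauge p N h"
    using small_dominated[of 1] by auto
  obtain m where m: "norm r / d' < real m" using reals_Archimedean2 by blast
  then have m0: "0 < real m" using d' by (smt (verit) divide_nonneg_pos norm_ge_zero)
  have "h \<bullet> (- r) \<le> real m * lower_gauge p N h" for h
  proof -
    have "(- 1 / real m) *\<^sub>R r \<in> D_span N" using r unfolding D_span_def by (intro span_scale)
    moreover have "norm ((- 1 / real m) *\<^sub>R r) < d'" using m m0 d' by (simp add: field_simps)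
    ultimately have "h \<bullet> ((- 1 / real m) *\<^sub>R r) \<le> 1 * lower_gauge p N h" by (rule d')
    then show ?thesis using m0 by (simp add: field_simps)
  qed
  then obtain i where "norm (- r + real m *\<^sub>R mean p N i) < d"
    using mean_approximates[OF _ m0 \<open>0 < d\<close>] by blast
  then have "norm (r - real m *\<^sub>R mean p N i) < d"
    by (metis minus_diff_eq norm_minus_cancel uminus_add_conv_diff)
  then show ?thesis by blast
qed

text \<open>
  For \<open>p = \<infinity>\<close>: a support function bounded by \<open>c\<close> is bounded by \<open>c\<close> on the convex hull as well, and
  \<open>0\<close> in the hull gives \<open>c \<ge> 0\<close>; hence the negative part in the gauge does not change the value.
\<close>

lemma psi_eq_lower_gauge: "psi p N h = ereal (lower_gauge p N h)"
proof (cases "p = \<infinity>")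
  case False
  then show ?thesis by (simp add: psi_def lower_gauge enn2ereal_ennreal[OF lower_gauge_nonneg])
next
  case True
  have ae: "AE x in N. neg_part (h \<bullet> x) \<le> lower_gauge p N h"
    using lower_gauge[of h] Lp_norm_top_le_iff[of "\<lambda>x. neg_part (h \<bullet> x)" N "ennreal (lower_gauge p N h)"] True
    by (simp add: lower_gauge_nonneg neg_part_nonneg)
  show ?thesis unfolding psi_def support_fun_def if_P[OF True]
  proof (rule antisym)
    have "AE x in N. x \<in> {x. (- h) \<bullet> x \<le> lower_gauge p N h}"
      using ae by eventually_elim (auto simp: neg_part_def)
    then have "closed_support N \<subseteq> {x. (- h) \<bullet> x \<le> lower_gauge p N h}"
      by (intro closed_support_subset sets_N closed_halfspace_le)
    then show "(SUP y\<in>closed_support N. ereal (- h \<bullet> y)) \<le> ereal (lower_gauge p N h)"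
      by (intro SUP_least) auto
    show "ereal (lower_gauge p N h) \<le> (SUP y\<in>closed_support N. ereal (- h \<bullet> y))"
    proof (rule ereal_le_real)
      fix c assume "(SUP y\<in>closed_support N. ereal (- h \<bullet> y)) \<le> ereal c"
      then have sub: "closed_support N \<subseteq> {x. (- h) \<bullet> x \<le> c}" by (auto simp: SUP_le_iff)
      then have "convex hull (closed_support N) \<subseteq> {x. (- h) \<bullet> x \<le> c}"
        by (intro hull_minimal convex_halfspace_le)
      then have c: "0 \<le> c" using ri rel_interior_subset by force
      have "AE x in N. norm (neg_part (h \<bullet> x)) \<le> c"
        using AE_closed_support[OF sets_N] by eventually_elim (use sub c in \<open>auto simp: neg_part_def\<close>)
      then have "Lp_norm N p (\<lambda>x. neg_part (h \<bullet> x)) \<le> ennreal c"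
        using True c by (simp add: Lp_norm_top_le_iff)
      then show "ereal (lower_gauge p N h) \<le> ereal c" using c by (simp add: lower_gauge)
    qed
  qed
qed

lemma mem_T_set_iff: "h \<in> T_set p N \<longleftrightarrow> h \<in> D_span N \<and> lower_gauge p N h \<le> 1"
  by (simp add: T_set_def psi_eq_lower_gauge one_ereal_def)

lemma support_fun_T_finite: "\<exists>C\<ge>0. support_fun a (T_set p N) = ereal C"
proof -
  obtain c where c: "0 < c" "\<And>h. h \<in> D_span N \<Longrightarrow> c * norm h \<le> lower_gauge p N h"
    using lower_gauge_coercive by blast
  have "a \<bullet> h \<le> norm a * (1 / c)" if h: "h \<in> T_set p N" for h
  proof -
    have "c * norm h \<le> 1" using c(2)[of h] h by (auto simp: mem_T_set_iff)
    then have "norm h \<le> 1 / c" using c by (simp add: field_simps)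
    then have "norm a * norm h \<le> norm a * (1 / c)" by (intro mult_left_mono) auto
    then show ?thesis using norm_cauchy_schwarz[of a h] by linarith
  qed
  then have up: "support_fun a (T_set p N) \<le> ereal (norm a * (1 / c))"
    unfolding support_fun_def by (intro SUP_least) simp
  have "0 \<in> T_set p N"
    using lower_gauge_scale[of 0 0] by (simp add: mem_T_set_iff D_span_def span_zero)
  then have "ereal (a \<bullet> 0) \<le> support_fun a (T_set p N)"
    unfolding support_fun_def by (rule SUP_upper)
  then have lo: "0 \<le> support_fun a (T_set p N)" by (simp add: zero_ereal_def)
  show ?thesis using up lo by (cases "support_fun a (T_set p N)") auto
qed

text \<open>
  By homogeneity, bounding \<open>a \<bullet> h\<close> on \<open>T\<close> by \<open>c\<close> is the same as dominating it by \<open>c\<close> times the gauge on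
  \<open>D\<close>. As \<open>a \<in> D\<close>, neither side sees the component of \<open>h\<close> orthogonal to \<open>D\<close>.
\<close>

lemma support_fun_T_dominates:
  assumes a: "a \<in> D_span N" and s: "support_fun a (T_set p N) \<le> ereal c"
  shows "h \<bullet> a \<le> c * lower_gauge p N h"
proof -
  obtain y u where yu: "y \<in> D_span N" "\<And>x. x \<in> D_span N \<Longrightarrow> u \<bullet> x = 0" "h = y + u"
    using D_decomposition by blast
  have "u \<bullet> a = 0" using yu(2) a by blast
  then have ha: "h \<bullet> a = a \<bullet> y" using yu(3) by (simp add: inner_add_left inner_commute[of y a])
  have g: "lower_gauge p N h = lower_gauge p N y" using lower_gauge_add_orthogonal[of u y] yu by simp
  show ?thesis
  proof (cases "y = 0")
    case True
    then show ?thesis using ha g lower_gauge_scale[of 0 0] by simp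
  next
    case False
    then have pos: "0 < lower_gauge p N y"
      using lower_gauge_eq_0D[OF yu(1)] lower_gauge_nonneg[of p N y] by linarith
    have "(1 / lower_gauge p N y) *\<^sub>R y \<in> T_set p N"
      using yu pos lower_gauge_scale[of "1 / lower_gauge p N y" y] by (simp add: mem_T_set_iff D_span_def span_scale)
    then have "ereal (a \<bullet> ((1 / lower_gauge p N y) *\<^sub>R y)) \<le> ereal c"
      using s unfolding support_fun_def SUP_le_iff by blast
    then have "(a \<bullet> y) / lower_gauge p N y \<le> c" by simp
    then show ?thesis using pos ha g by (simp add: field_simps)
  qed
qed

text \<open>
  Division of \<open>h\<close> by \<open>max 1 (lower_gauge h)\<close> retracts \<open>D\<close> onto \<open>T\<close>, so the supremum over \<open>T\<close> can be taken over
  the retractions of a countable dense subset of \<open>D\<close>.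
\<close>

lemma support_fun_T_countable:
  "support_fun a (T_set p N) =
    (SUP (m, i)\<in>UNIV. ereal (a \<bullet> (real m *\<^sub>R mean p N i) / max 1 (lower_gauge p N (real m *\<^sub>R mean p N i))))"
    (is "_ = (SUP (m, i)\<in>_. ?s m i)")
proof (rule antisym)
  show "(SUP (m, i)\<in>UNIV. ?s m i) \<le> support_fun a (T_set p N)"
  proof (rule SUP_least, clarify)
    fix m i
    define d where "d = real m *\<^sub>R mean p N i"
    have "d \<in> D_span N" using mean_in_D[of i] by (simp add: d_def D_span_def span_scale)
    then have "(1 / max 1 (lower_gauge p N d)) *\<^sub>R d \<in> T_set p N"
      using lower_gauge_scale[of "1 / max 1 (lower_gauge p N d)" d]
      by (simp add: mem_T_set_iff D_span_def span_scale)
    then have "ereal (a \<bullet> ((1 / max 1 (lower_gauge p N d)) *\<^sub>R d)) \<le> support_fun a (T_set p N)"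
      unfolding support_fun_def by (rule SUP_upper)
    then show "?s m i \<le> support_fun a (T_set p N)" by (simp add: d_def)
  qed
  show "support_fun a (T_set p N) \<le> (SUP (m, i)\<in>UNIV. ?s m i)"
    unfolding support_fun_def
  proof (rule SUP_least)
    fix h assume h: "h \<in> T_set p N"
    have "\<exists>m i. norm (h - real m *\<^sub>R mean p N i) < inverse (real (Suc n))" for n
      using h by (intro multiples_of_means_dense) (auto simp: mem_T_set_iff)
    then obtain m i where mi: "\<And>n. norm (h - real (m n) *\<^sub>R mean p N (i n)) < inverse (real (Suc n))"
      by metis
    define d where "d n = real (m n) *\<^sub>R mean p N (i n)" for n
    have "\<forall>\<^sub>F n in sequentially. norm (d n - h) \<le> inverse (real (Suc n))"
      using mi by (intro always_eventually allI) (metis d_def less_imp_le norm_minus_commute)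
    then have "(\<lambda>n. d n - h) \<longlonglongrightarrow> 0"
      by (rule Lim_null_comparison[OF _ LIMSEQ_inverse_real_of_nat])
    then have lim: "d \<longlonglongrightarrow> h" by (rule LIM_zero_cancel)
    have "isCont (lower_gauge p N) h" using continuous_on_lower_gauge[of UNIV] by (simp add: continuous_on_eq_continuous_at)
    then have "(\<lambda>n. lower_gauge p N (d n)) \<longlonglongrightarrow> lower_gauge p N h" using lim by (rule isCont_tendsto_compose)
    then have "(\<lambda>n. a \<bullet> d n / max 1 (lower_gauge p N (d n))) \<longlonglongrightarrow> a \<bullet> h / max 1 (lower_gauge p N h)"
      using lim by (intro tendsto_intros) auto
    then have lim': "(\<lambda>n. ereal (a \<bullet> d n / max 1 (lower_gauge p N (d n)))) \<longlonglongrightarrow> ereal (a \<bullet> h)"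
      using h by (simp add: mem_T_set_iff max_absorb1)
    show "ereal (a \<bullet> h) \<le> (SUP (m, i)\<in>UNIV. ?s m i)"
    proof (rule LIMSEQ_le_const2[OF lim'], intro exI allI impI)
      fix n :: nat
      show "ereal (a \<bullet> d n / max 1 (lower_gauge p N (d n))) \<le> (SUP (m, i)\<in>UNIV. ?s m i)"
        unfolding d_def by (rule SUP_upper2[of "(m n, i n)"]) auto
    qed
  qed
qed

section \<open>Densities with a prescribed mean\<close>

text \<open>
  Domination by the gauge is a countable condition, hence a measurable one when the law varies.
\<close>

lemma dominated_dense:
  assumes "\<And>j. dense_seq j \<bullet> r \<le> c * lower_gauge p N (dense_seq j)"
  shows "h \<bullet> r \<le> c * lower_gauge p N h"
proof (rule ccontr)
  assume neg: "\<not> ?thesis"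
  define S where "S = {h. c * lower_gauge p N h < h \<bullet> r}"
  have "open S"
    unfolding S_def
    by (intro open_Collect_less continuous_on_mult continuous_on_const continuous_on_lower_gauge
        continuous_on_inner continuous_on_id)
  moreover have "S \<noteq> {}" using neg by (auto simp: S_def not_le)
  ultimately obtain j where "dense_seq j \<in> S" by (rule dense_seq)
  then show False using assms[of j] by (simp add: S_def)
qed

text \<open>
  Test the domination with \<open>h = r\<close>.
\<close>

lemma norm_le_of_dominated:
  assumes "\<And>h. h \<bullet> r \<le> c * lower_gauge p N h" and "0 \<le> c"
  shows "norm r \<le> c * moment"
proof (cases "r = 0")
  case True
  then show ?thesis using assms moment by simp
next
  case False
  have "norm r * norm r \<le> c * lower_gauge p N r"
    using assms(1)[of r] by (simp add: dot_square_norm power2_eq_square)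
  also have "\<dots> \<le> c * (norm r * moment)" using assms lower_gauge_le_norm by (intro mult_left_mono)
  finally have "norm r * norm r \<le> norm r * (c * moment)" by (simp add: ac_simps)
  then show ?thesis using False by simp
qed

text \<open>
  The pointwise construction: the residuals \<open>r n\<close> of the successive approximation tend to \<open>0\<close>, so
  the density \<open>\<Sum>n. c n * weight (i n)\<close> has mean \<open>- r 0\<close>, and its norm is at most \<open>\<Sum>n. c n\<close>.
\<close>

lemma density_of_residuals:
  assumes c0: "\<And>n. 0 \<le> c n" and c: "c sums C"
    and r: "\<And>n. r (Suc n) = r n + c n *\<^sub>R mean p N (i n)"
    and dom: "\<And>n h. h \<bullet> r n \<le> c n * lower_gauge p N h"
  defines "k \<equiv> \<lambda>x. enn2real (\<Sum>n. ennreal (c n * weight p N (i n) x))"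
  shows "Lp_norm N q k \<le> ennreal C" "integrable N (\<lambda>x. k x *\<^sub>R x)" "(\<integral>x. k x *\<^sub>R x \<partial>N) = - r 0"
proof -
  define S where "S n x = (\<Sum>j<n. c j * weight p N (i j) x)" for n x
  have wm [measurable]: "weight p N j \<in> borel_measurable N" for j by (rule weight_N_measurable)
  have km [measurable]: "k \<in> borel_measurable N" unfolding k_def by measurable
  have Sm [measurable]: "S n \<in> borel_measurable N" for n unfolding S_def[abs_def] by measurable
  have w1: "Lp_norm N q (weight p N j) \<le> ennreal 1" for j
    by (rule weight_norm_le_1[OF conj finite_measure_axioms sets_N])
  have C0: "(\<Sum>j<n. c j) \<le> C" for n using sum_le_suminf[OF sums_summable[OF c], of "{..<n}"] c0 sums_unique[OF c] by simp
  have C: "0 \<le> C" using C0[of 0] by simp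
  have S_norm: "Lp_norm N q (S n) \<le> ennreal (\<Sum>j<n. c j)" for n
  proof (induction n)
    case 0
    have "Lp_norm N q (\<lambda>x. 0 :: real) \<le> ennreal (\<bar>0\<bar> * 0)"
      using Lp_norm_scaleR_le[of "weight p N (i 0)" N q 1 0] w1 exponents by simp
    then show ?case by (simp add: S_def[abs_def])
  next
    case (Suc n)
    have "Lp_norm N q (\<lambda>x. c n *\<^sub>R weight p N (i n) x) \<le> ennreal (\<bar>c n\<bar> * 1)"
      using exponents w1 by (intro Lp_norm_scaleR_le) auto
    then have "Lp_norm N q (\<lambda>x. S n x + c n *\<^sub>R weight p N (i n) x) \<le> ennreal ((\<Sum>j<n. c j) + c n)"
      using exponents Suc c0 by (intro Lp_norm_add_le) (auto simp: sum_nonneg)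
    then show ?case by (simp add: S_def[abs_def])
  qed
  have one: "Lp_norm N p (\<lambda>x. 1 :: real) \<le> ennreal 1"
    using exponents
  proof (cases rule: exponent_cases[OF exponents(1)])
    case (2 s)
    then show ?thesis
      using Lp_norm_finite_le_iff[of s 1 N "\<lambda>x. 1 :: real"] by (simp add: emeasure_space_1)
  qed (simp add: Lp_norm_top_le_iff)
  have wint: "(\<integral>\<^sup>+x. ennreal (c n * weight p N (i n) x) \<partial>N) \<le> ennreal (c n)" for n
  proof -
    have "(\<integral>\<^sup>+x. ennreal (weight p N (i n) x) \<partial>N) \<le> ennreal 1"
      using Hoelder[OF conj _ wm, of "\<lambda>x. 1::real" 1 1 "i n"] one w1 by (simp add: abs_of_nonneg[OF weight_nonneg])
    then have "ennreal (c n) * (\<integral>\<^sup>+x. ennreal (weight p N (i n) x) \<partial>N) \<le> ennreal (c n) * 1"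
      by (intro mult_left_mono) auto
    then show ?thesis using c0 by (simp add: ennreal_mult' nn_integral_cmult)
  qed
  have sums: "AE x in N. (\<lambda>n. c n * weight p N (i n) x) sums k x"
  proof -
    have "(\<integral>\<^sup>+x. (\<Sum>n. ennreal (c n * weight p N (i n) x)) \<partial>N) = (\<Sum>n. \<integral>\<^sup>+x. ennreal (c n * weight p N (i n) x) \<partial>N)"
      by (rule nn_integral_suminf) measurable
    also have "\<dots> \<le> (\<Sum>n. ennreal (c n))" by (intro suminf_le wint) auto
    also have "\<dots> = ennreal C" using suminf_ennreal_eq[OF c0 c] .
    finally have "(\<integral>\<^sup>+x. (\<Sum>n. ennreal (c n * weight p N (i n) x)) \<partial>N) \<noteq> \<infinity>" by (auto simp: top_unique)
    then have "AE x in N. (\<Sum>n. ennreal (c n * weight p N (i n) x)) \<noteq> \<infinity>"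
      by (intro nn_integral_PInf_AE) measurable
    then show ?thesis
    proof eventually_elim
      case (elim x)
      have nn: "0 \<le> c n * weight p N (i n) x" for n by (intro mult_nonneg_nonneg c0 weight_nonneg)
      have sm: "summable (\<lambda>n. c n * weight p N (i n) x)"
        using elim nn by (intro summable_suminf_not_top) auto
      then have "k x = (\<Sum>n. c n * weight p N (i n) x)"
        using suminf_ennreal_eq[OF nn summable_sums[OF sm]] nn by (simp add: k_def suminf_nonneg)
      then show ?case using sm by (simp add: summable_sums)
    qed
  qed
  then have lim: "AE x in N. (\<lambda>n. S n x) \<longlonglongrightarrow> k x"
    by eventually_elim (simp add: sums_def S_def)
  show k_norm: "Lp_norm N q k \<le> ennreal C"
  proof (rule Lp_norm_limit_le[where X=S])
    show "Lp_norm N q (S n) \<le> ennreal C" for n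
      using S_norm[of n] C0[of n] by (rule order_trans[OF _ ennreal_leI])
  qed (use lim exponents C in auto)
  show int: "integrable N (\<lambda>x. k x *\<^sub>R x)" by (rule integrable_weight(1)[OF km k_norm C])
  have Sint: "(\<integral>x. S n x *\<^sub>R x \<partial>N) = r n - r 0" for n
  proof (induction n)
    case (Suc n)
    have iw: "integrable N (\<lambda>x. weight p N (i n) x *\<^sub>R x)" by (rule integrable_weight_scaleR)
    have iS: "integrable N (\<lambda>x. S n x *\<^sub>R x)"
      using S_norm[of n] c0 by (intro integrable_weight(1)[OF Sm]) (auto simp: sum_nonneg)
    have "(\<integral>x. S (Suc n) x *\<^sub>R x \<partial>N) = (\<integral>x. S n x *\<^sub>R x + c n *\<^sub>R (weight p N (i n) x *\<^sub>R x) \<partial>N)"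
      by (simp add: S_def scaleR_left_distrib)
    also have "\<dots> = (\<integral>x. S n x *\<^sub>R x \<partial>N) + c n *\<^sub>R mean p N (i n)"
      using iw iS by (simp add: mean_def del: scaleR_scaleR)
    finally show ?case using Suc r[of n] by simp
  qed (simp add: S_def)
  have "(\<lambda>n. \<integral>x. S n x *\<^sub>R x \<partial>N) \<longlonglongrightarrow> (\<integral>x. k x *\<^sub>R x \<partial>N)"
  proof (rule integral_dominated_convergence[where w="\<lambda>x. norm (k x *\<^sub>R x)"])
    show "integrable N (\<lambda>x. norm (k x *\<^sub>R x))" using int by (rule integrable_norm)
    show "AE x in N. (\<lambda>n. S n x *\<^sub>R x) \<longlonglongrightarrow> k x *\<^sub>R x"
      using lim by eventually_elim (intro tendsto_scaleR tendsto_const)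
    show "AE x in N. norm (S n x *\<^sub>R x) \<le> norm (k x *\<^sub>R x)" for n
      using sums
    proof eventually_elim
      case (elim x)
      have nn: "0 \<le> c n * weight p N (i n) x" for n by (intro mult_nonneg_nonneg c0 weight_nonneg)
      have "S n x \<le> k x"
        using sum_le_suminf[OF sums_summable[OF elim], of "{..<n}"] sums_unique[OF elim] nn by (simp add: S_def)
      moreover have "0 \<le> S n x" unfolding S_def by (intro sum_nonneg nn)
      ultimately show ?case by (simp add: mult_right_mono)
    qed
  qed measurable
  moreover have "(\<lambda>n. \<integral>x. S n x *\<^sub>R x \<partial>N) \<longlonglongrightarrow> 0 - r 0"
  proof -
    have "c \<longlonglongrightarrow> 0" by (rule summable_LIMSEQ_zero[OF sums_summable[OF c]])
    then have "(\<lambda>n. c n * moment) \<longlonglongrightarrow> 0 * moment" by (intro tendsto_mult tendsto_const)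
    then have cm: "(\<lambda>n. c n * moment) \<longlonglongrightarrow> 0" by simp
    have "\<forall>\<^sub>F n in sequentially. norm (r n) \<le> c n * moment"
      using norm_le_of_dominated[OF dom c0] by (rule always_eventually[OF allI])
    then have "r \<longlonglongrightarrow> 0" using cm by (rule Lim_null_comparison)
    then show ?thesis unfolding Sint by (intro tendsto_diff tendsto_const)
  qed
  ultimately have "(\<integral>x. k x *\<^sub>R x \<partial>N) = 0 - r 0" by (rule LIMSEQ_unique)
  then show "(\<integral>x. k x *\<^sub>R x \<partial>N) = - r 0" by simp
qed

end

section \<open>Disintegration along a regular conditional distribution\<close>

lemma integral_measurable_kernel:
  fixes f :: "'a \<Rightarrow> 'c \<Rightarrow> 'b::{banach, second_countable_topology}"
  assumes [measurable]: "(\<lambda>(x, y). f x y) \<in> borel_measurable (G \<Otimes>\<^sub>M N)"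
    and [measurable]: "L \<in> measurable G (subprob_algebra N)"
  shows "(\<lambda>x. integral\<^sup>L (L x) (f x)) \<in> borel_measurable G"
proof -
  note integral_measurable_subprob_algebra[measurable] measurable_distr2[measurable]
  have "(\<lambda>x. integral\<^sup>L (distr (L x) (G \<Otimes>\<^sub>M N) (\<lambda>y. (x, y))) (\<lambda>(x, y). f x y)) \<in> borel_measurable G"
    by measurable
  then show ?thesis
    by (rule measurable_cong[THEN iffD1, rotated]) (simp add: integral_distr)
qed

text \<open>
  Measurable selection from countably many alternatives: take the first one that works.
\<close>

definition first_index :: "('i::countable \<Rightarrow> 'a \<Rightarrow> bool) \<Rightarrow> 'a \<Rightarrow> 'i" where
  "first_index P w = from_nat (LEAST n. P (from_nat n) w)"

lemma first_index_measurable [measurable]: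
  assumes [measurable]: "\<And>i. Measurable.pred G (P i)"
  shows "first_index P \<in> measurable G (count_space UNIV)"
proof -
  have [measurable]: "(\<lambda>w. LEAST n. P (from_nat n) w) \<in> measurable G (count_space UNIV)"
    by measurable
  show ?thesis unfolding first_index_def[abs_def] by measurable
qed

lemma first_index:
  assumes "P i w"
  shows "P (first_index P w) w"
proof -
  have "P (from_nat (to_nat i)) w" using assms by simp
  then show ?thesis unfolding first_index_def by (rule LeastI)
qed

locale conditional_law = prob_space M for M :: "'a measure" +
  fixes H :: "'a measure" and \<xi> :: "'a \<Rightarrow> 'b::euclidean_space" and K :: "'a \<Rightarrow> 'b measure"
  assumes subalg: "subalgebra M H"
    and \<xi>_measurable [measurable]: "\<xi> \<in> borel_measurable M"
    and reg: "regular_cond_distr M H \<xi> K"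
begin

sublocale finite_measure_subalgebra M H
  by unfold_locales (rule subalg)

lemma space_H: "space H = space M"
  using subalg by (simp add: subalgebra_def)

lemma H_measurable_M: "f \<in> measurable H N \<Longrightarrow> f \<in> measurable M N"
  using measurable_from_subalg[OF subalg] .

lemma id_measurable_M_H [measurable]: "(\<lambda>w. w) \<in> measurable M H"
  using subalg by (auto simp: subalgebra_def measurable_def)

lemma kernel_prob [measurable]: "K \<in> measurable H (prob_algebra borel)"
  using reg by (simp add: regular_cond_distr_def)

lemma kernel [measurable]: "K \<in> measurable H (subprob_algebra borel)"
  by (intro measurable_prob_algebraD kernel_prob)

lemma kernelD:
  assumes "w \<in> space M"
  shows "prob_space (K w)" "sets (K w) = sets borel"
  using measurable_space[OF kernel_prob, of w] assms by (auto simp: space_H space_prob_algebra)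

definition joint :: "('a \<times> 'b) measure" where
  "joint = distr M (H \<Otimes>\<^sub>M borel) (\<lambda>w. (w, \<xi> w))"

lemma pair_measurable [measurable]: "(\<lambda>w. (w, \<xi> w)) \<in> measurable M (H \<Otimes>\<^sub>M borel)"
  by measurable

text \<open>
  The defining property of the kernel says that the joint law of \<open>(\<omega>, \<xi> \<omega>)\<close> and the measure
  \<open>P(d\<omega>) K(\<omega>, dx)\<close> agree on rectangles; hence they are equal.
\<close>

lemma joint_eq_bind:
  "joint = restr_to_subalg M H \<bind> (\<lambda>w. distr (K w) (H \<Otimes>\<^sub>M borel) (Pair w))"
proof -
  let ?H = "restr_to_subalg M H"
  define L where "L w = distr (K w) (H \<Otimes>\<^sub>M borel) (Pair w)" for w
  have L: "L \<in> measurable H (subprob_algebra (H \<Otimes>\<^sub>M borel))"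
    unfolding L_def[abs_def] by (rule measurable_distr2[OF _ kernel]) measurable
  then have L': "L \<in> measurable ?H (subprob_algebra (H \<Otimes>\<^sub>M borel))"
    by (simp add: measurable_cong_sets[OF sets_restr_to_subalg[OF subalg] refl])
  have sp: "space ?H = space M" "space ?H \<noteq> {}"
    using space_restr_to_subalg[of M H] not_empty by simp_all
  have sets_bind_L: "sets (?H \<bind> L) = sets (H \<Otimes>\<^sub>M borel)"
    using sets_bind[OF sets_kernel[OF L'] sp(2)] by simp
  have "joint = ?H \<bind> L"
  proof (rule measure_eqI_generator_eq[OF Int_stable_pair_measure_generator[of H borel]])
    show "{A \<times> B |A B. A \<in> sets H \<and> B \<in> sets borel} \<subseteq> Pow (space H \<times> space borel)"
      using sets.sets_into_space by auto
    show "sets joint = sigma_sets (space H \<times> space borel) {A \<times> B |A B. A \<in> sets H \<and> B \<in> sets borel}"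
      by (simp add: joint_def sets_pair_measure)
    show "sets (?H \<bind> L) = sigma_sets (space H \<times> space borel) {A \<times> B |A B. A \<in> sets H \<and> B \<in> sets borel}"
      by (simp add: sets_bind_L sets_pair_measure)
    show "range (\<lambda>i::nat. space H \<times> space (borel::'b measure)) \<subseteq> {A \<times> B |A B. A \<in> sets H \<and> B \<in> sets borel}"
      by (auto intro!: exI[of _ "space H"] exI[of _ "UNIV :: 'b set"])
    show "(\<Union>i::nat. space H \<times> space (borel::'b measure)) = space H \<times> space borel" by simp
    show "emeasure joint (space H \<times> space borel) \<noteq> \<infinity>"
    proof -
      have "prob_space joint" unfolding joint_def by (rule prob_space_distr) measurable
      then interpret j: prob_space joint .
      show ?thesis by (simp add: j.emeasure_eq_measure)
    qed
    fix X assume "X \<in> {A \<times> B |A B. A \<in> sets H \<and> B \<in> sets (borel :: 'b measure)}"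
    then obtain A B where X: "X = A \<times> B" and A [measurable]: "A \<in> sets H" and B [measurable]: "B \<in> sets (borel :: 'b measure)"
      by blast
    have ae: "AE w in M. measure (K w) B = real_cond_exp M H (\<lambda>v. indicator B (\<xi> v)) w"
      using reg B unfolding regular_cond_distr_def by blast
    have AM [measurable]: "A \<in> sets M" using A subalg by (auto simp: subalgebra_def)
    have "emeasure (?H \<bind> L) X = (\<integral>\<^sup>+w. emeasure (L w) X \<partial>?H)"
      using X by (intro emeasure_bind[OF sp(2) L']) simp
    also have "\<dots> = (\<integral>\<^sup>+w. emeasure (L w) X \<partial>M)"
      using X by (intro nn_integral_subalgebra2[OF subalg] measurable_emeasure_kernel[OF L]) simp
    also have "\<dots> = (\<integral>\<^sup>+w. ennreal (indicator A w * measure (K w) B) \<partial>M)"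
    proof (rule nn_integral_cong)
      fix w assume w: "w \<in> space M"
      interpret kw: prob_space "K w" by (rule kernelD[OF w])
      note [measurable_cong] = kernelD(2)[OF w]
      have w': "w \<in> space H" using w by (simp add: space_H)
      have "emeasure (L w) X = emeasure (K w) (Pair w -` X \<inter> space (K w))"
        unfolding L_def using X w' by (intro emeasure_distr) auto
      also have "Pair w -` X \<inter> space (K w) = (if w \<in> A then B else {})"
        using X sets_eq_imp_space_eq[OF kernelD(2)[OF w]] by auto
      finally show "emeasure (L w) X = ennreal (indicator A w * measure (K w) B)"
        by (auto simp: kw.emeasure_eq_measure)
    qed
    also have "\<dots> = (\<integral>\<^sup>+w. ennreal (indicator A w * real_cond_exp M H (\<lambda>v. indicator B (\<xi> v)) w) \<partial>M)"
      using ae by (intro nn_integral_cong_AE) (auto elim!: eventually_mono)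
    also have "\<dots> = ennreal (\<integral>w. indicator A w * real_cond_exp M H (\<lambda>v. indicator B (\<xi> v)) w \<partial>M)"
    proof (rule nn_integral_eq_integral)
      show "integrable M (\<lambda>w. indicator A w * real_cond_exp M H (\<lambda>v. indicator B (\<xi> v)) w)"
        by (intro real_cond_exp_intg(1)) (auto intro!: integrable_const_bound[of _ 1] simp: indicator_def)
      show "AE w in M. 0 \<le> indicator A w * real_cond_exp M H (\<lambda>v. indicator B (\<xi> v)) w"
        using ae by eventually_elim (metis measure_nonneg mult_nonneg_nonneg indicator_pos_le)
    qed
    also have "(\<integral>w. indicator A w * real_cond_exp M H (\<lambda>v. indicator B (\<xi> v)) w \<partial>M)
        = (\<integral>w. indicator A w * indicator B (\<xi> w) \<partial>M)"
      by (intro real_cond_exp_intg(2)) (auto intro!: integrable_const_bound[of _ 1] simp: indicator_def)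
    also have "\<dots> = (\<integral>w. indicator {w\<in>space M. w \<in> A \<and> \<xi> w \<in> B} w \<partial>M)"
      by (intro Bochner_Integration.integral_cong) (auto simp: indicator_def)
    also have "ennreal \<dots> = emeasure M {w\<in>space M. w \<in> A \<and> \<xi> w \<in> B}"
      by (simp add: emeasure_eq_measure)
    also have "\<dots> = emeasure joint X"
      unfolding joint_def using X
      by (subst emeasure_distr) (auto intro!: arg_cong[where f="emeasure M"])
    finally show "emeasure joint X = emeasure (?H \<bind> L) X" by simp
  qed
  then show ?thesis by (simp add: L_def[abs_def])
qed

lemma nn_integral_disintegrate:
  assumes [measurable]: "(\<lambda>(w, x). \<phi> w x) \<in> borel_measurable (H \<Otimes>\<^sub>M borel)"
  shows "(\<integral>\<^sup>+w. \<phi> w (\<xi> w) \<partial>M) = (\<integral>\<^sup>+w. \<integral>\<^sup>+x. \<phi> w x \<partial>K w \<partial>M)"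
proof -
  let ?H = "restr_to_subalg M H"
  have L: "(\<lambda>w. distr (K w) (H \<Otimes>\<^sub>M borel) (Pair w)) \<in> measurable H (subprob_algebra (H \<Otimes>\<^sub>M borel))"
    by (rule measurable_distr2[OF _ kernel]) measurable
  have "(\<integral>\<^sup>+w. \<phi> w (\<xi> w) \<partial>M) = (\<integral>\<^sup>+z. (case z of (w, x) \<Rightarrow> \<phi> w x) \<partial>joint)"
    unfolding joint_def by (subst nn_integral_distr) auto
  also have "\<dots> = (\<integral>\<^sup>+w. (\<integral>\<^sup>+z. (case z of (w, x) \<Rightarrow> \<phi> w x) \<partial>distr (K w) (H \<Otimes>\<^sub>M borel) (Pair w)) \<partial>?H)"
    unfolding joint_eq_bind using L
    by (intro nn_integral_bind[where B="H \<Otimes>\<^sub>M borel"] assms)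
      (simp add: measurable_cong_sets[OF sets_restr_to_subalg[OF subalg] refl])
  also have "\<dots> = (\<integral>\<^sup>+w. (\<integral>\<^sup>+z. (case z of (w, x) \<Rightarrow> \<phi> w x) \<partial>distr (K w) (H \<Otimes>\<^sub>M borel) (Pair w)) \<partial>M)"
    by (intro nn_integral_subalgebra2[OF subalg] measurable_compose[OF L nn_integral_measurable_subprob_algebra] assms)
  also have "\<dots> = (\<integral>\<^sup>+w. \<integral>\<^sup>+x. \<phi> w x \<partial>K w \<partial>M)"
  proof (rule nn_integral_cong)
    fix w assume w: "w \<in> space M"
    note [measurable_cong] = kernelD(2)[OF w]
    have w': "w \<in> space H" using w by (simp add: space_H)
    show "(\<integral>\<^sup>+z. (case z of (w, x) \<Rightarrow> \<phi> w x) \<partial>distr (K w) (H \<Otimes>\<^sub>M borel) (Pair w)) = (\<integral>\<^sup>+x. \<phi> w x \<partial>K w)"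
      using w' by (subst nn_integral_distr) auto
  qed
  finally show ?thesis .
qed

lemma nn_integral_kernel_measurable:
  assumes "(\<lambda>(w, x). \<phi> w x) \<in> borel_measurable (H \<Otimes>\<^sub>M borel)"
  shows "(\<lambda>w. \<integral>\<^sup>+x. \<phi> w x \<partial>K w) \<in> borel_measurable H"
  by (rule nn_integral_measurable_subprob_algebra2[OF assms kernel])

lemma section_measurable:
  assumes [measurable]: "(\<lambda>(w, x). \<phi> w x) \<in> measurable (H \<Otimes>\<^sub>M borel) N" and w: "w \<in> space M"
  shows "\<phi> w \<in> measurable (K w) N"
proof -
  have "w \<in> space H" using w by (simp add: space_H)
  then have "(\<lambda>x. (\<lambda>(w, x). \<phi> w x) (w, x)) \<in> measurable borel N"
    by (rule measurable_compose[OF measurable_Pair1' assms(1)])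
  then show ?thesis
    unfolding measurable_cong_sets[OF kernelD(2)[OF w] refl] by (simp only: prod.case)
qed

lemma joint_compose:
  assumes "(\<lambda>(w, x). \<phi> w x) \<in> measurable (H \<Otimes>\<^sub>M borel) N" "F \<in> measurable N L"
  shows "(\<lambda>(w, x). F (\<phi> w x)) \<in> measurable (H \<Otimes>\<^sub>M borel) L"
  using measurable_compose[OF assms] by (simp add: case_prod_beta')

lemma graph_measurable:
  assumes [measurable]: "(\<lambda>(w, x). \<phi> w x) \<in> measurable (H \<Otimes>\<^sub>M borel) N"
  shows "(\<lambda>w. \<phi> w (\<xi> w)) \<in> measurable M N"
  using measurable_compose[OF pair_measurable assms] by (simp only: prod.case)

lemma AE_disintegrate:
  assumes P [measurable]: "Measurable.pred (H \<Otimes>\<^sub>M borel) (\<lambda>(w, x). P w x)"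
  shows "(AE w in M. P w (\<xi> w)) \<longleftrightarrow> (AE w in M. AE x in K w. P w x)"
proof -
  define I :: "'a \<Rightarrow> 'b \<Rightarrow> ennreal" where "I w x = (if P w x then 0 else 1)" for w x
  have I: "I w x = 0 \<longleftrightarrow> P w x" for w x by (simp add: I_def)
  have "(\<lambda>z. if (\<lambda>(w, x). P w x) z then 0 else 1 :: ennreal) \<in> borel_measurable (H \<Otimes>\<^sub>M borel)"
    by measurable
  then have m: "(\<lambda>(w, x). I w x) \<in> borel_measurable (H \<Otimes>\<^sub>M borel)"
    by (simp add: I_def case_prod_beta')
  have "(AE w in M. P w (\<xi> w)) \<longleftrightarrow> (\<integral>\<^sup>+w. I w (\<xi> w) \<partial>M) = 0"
    unfolding nn_integral_0_iff_AE[OF graph_measurable[OF m]] I ..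
  also have "\<dots> \<longleftrightarrow> (\<integral>\<^sup>+w. \<integral>\<^sup>+x. I w x \<partial>K w \<partial>M) = 0"
    unfolding nn_integral_disintegrate[OF m] ..
  also have "\<dots> \<longleftrightarrow> (AE w in M. (\<integral>\<^sup>+x. I w x \<partial>K w) = 0)"
    by (intro nn_integral_0_iff_AE H_measurable_M nn_integral_kernel_measurable m)
  also have "\<dots> \<longleftrightarrow> (AE w in M. AE x in K w. P w x)"
  proof (rule AE_cong)
    fix w assume w: "w \<in> space M"
    show "(\<integral>\<^sup>+x. I w x \<partial>K w) = 0 \<longleftrightarrow> (AE x in K w. P w x)"
      unfolding nn_integral_0_iff_AE[OF section_measurable[OF m w]] I ..
  qed
  finally show ?thesis .
qed

lemma integral_disintegrate:
  fixes \<phi> :: "'a \<Rightarrow> 'b \<Rightarrow> real"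
  assumes m: "(\<lambda>(w, x). \<phi> w x) \<in> borel_measurable (H \<Otimes>\<^sub>M borel)"
    and int: "integrable M (\<lambda>w. \<phi> w (\<xi> w))"
  shows "(\<integral>w. \<phi> w (\<xi> w) \<partial>M) = (\<integral>w. \<integral>x. \<phi> w x \<partial>K w \<partial>M)"
proof -
  have m1: "(\<lambda>(w, x). ennreal (\<phi> w x)) \<in> borel_measurable (H \<Otimes>\<^sub>M borel)"
    and m2: "(\<lambda>(w, x). ennreal (- \<phi> w x)) \<in> borel_measurable (H \<Otimes>\<^sub>M borel)"
    by (rule joint_compose[OF m]; measurable)+
  define P where "P w = (\<integral>\<^sup>+x. ennreal (\<phi> w x) \<partial>K w)" for w
  define Q where "Q w = (\<integral>\<^sup>+x. ennreal (- \<phi> w x) \<partial>K w)" for w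
  have P: "(\<integral>\<^sup>+w. ennreal (\<phi> w (\<xi> w)) \<partial>M) = (\<integral>\<^sup>+w. P w \<partial>M)"
    and Q: "(\<integral>\<^sup>+w. ennreal (- \<phi> w (\<xi> w)) \<partial>M) = (\<integral>\<^sup>+w. Q w \<partial>M)"
    unfolding P_def Q_def by (rule nn_integral_disintegrate[OF m1] nn_integral_disintegrate[OF m2])+
  have PQm [measurable]: "P \<in> borel_measurable M" "Q \<in> borel_measurable M"
    unfolding P_def[abs_def] Q_def[abs_def]
    by (intro H_measurable_M nn_integral_kernel_measurable m1 m2)+
  have finP: "(\<integral>\<^sup>+w. P w \<partial>M) \<noteq> \<infinity>" and finQ: "(\<integral>\<^sup>+w. Q w \<partial>M) \<noteq> \<infinity>"
    using int by (simp_all add: real_integrable_def flip: P Q)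
  have aeP: "AE w in M. P w \<noteq> \<infinity>" and aeQ: "AE w in M. Q w \<noteq> \<infinity>"
    using nn_integral_PInf_AE[OF PQm(1) finP] nn_integral_PInf_AE[OF PQm(2) finQ] by auto
  have eq: "AE w in M. (\<integral>x. \<phi> w x \<partial>K w) = enn2real (P w) - enn2real (Q w)"
    using aeP aeQ AE_space
  proof eventually_elim
    case (elim w)
    then have "integrable (K w) (\<phi> w)"
      using section_measurable[OF m elim(3)] by (simp add: real_integrable_def P_def Q_def)
    then show ?case by (simp add: real_lebesgue_integral_def P_def Q_def)
  qed
  have intP: "integrable M (\<lambda>w. enn2real (P w))" and intQ: "integrable M (\<lambda>w. enn2real (Q w))"
    and eP: "(\<integral>w. enn2real (P w) \<partial>M) = enn2real (\<integral>\<^sup>+w. P w \<partial>M)"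
    and eQ: "(\<integral>w. enn2real (Q w) \<partial>M) = enn2real (\<integral>\<^sup>+w. Q w \<partial>M)"
  proof -
    have *: "(\<integral>\<^sup>+w. ennreal (enn2real (R w)) \<partial>M) = (\<integral>\<^sup>+w. R w \<partial>M)" if "AE w in M. R w \<noteq> \<infinity>" for R
      using that by (intro nn_integral_cong_AE) (auto elim!: eventually_mono simp: ennreal_enn2real_if)
    show "integrable M (\<lambda>w. enn2real (P w))" "integrable M (\<lambda>w. enn2real (Q w))"
      using finP finQ *[OF aeP] *[OF aeQ] by (simp_all add: integrableI_nonneg less_top[symmetric])
    show "(\<integral>w. enn2real (P w) \<partial>M) = enn2real (\<integral>\<^sup>+w. P w \<partial>M)"
      "(\<integral>w. enn2real (Q w) \<partial>M) = enn2real (\<integral>\<^sup>+w. Q w \<partial>M)"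
      using *[OF aeP] *[OF aeQ] by (simp_all add: integral_eq_nn_integral)
  qed
  have "(\<integral>w. \<phi> w (\<xi> w) \<partial>M) = enn2real (\<integral>\<^sup>+w. P w \<partial>M) - enn2real (\<integral>\<^sup>+w. Q w \<partial>M)"
    using int by (simp add: real_lebesgue_integral_def P Q)
  also have "\<dots> = (\<integral>w. enn2real (P w) - enn2real (Q w) \<partial>M)"
    using intP intQ by (simp add: eP eQ)
  also have "\<dots> = (\<integral>w. \<integral>x. \<phi> w x \<partial>K w \<partial>M)"
    using eq H_measurable_M[OF integral_measurable_kernel[OF m kernel]]
    by (intro integral_cong_AE) (auto elim!: eventually_mono)
  finally show ?thesis .
qed

lemma Lp_norm_kernel_measurable:
  fixes \<phi> :: "'a \<Rightarrow> 'b \<Rightarrow> real"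
  assumes m: "(\<lambda>(w, x). \<phi> w x) \<in> borel_measurable (H \<Otimes>\<^sub>M borel)" and p: "1 \<le> p"
  shows "(\<lambda>w. Lp_norm (K w) p (\<phi> w)) \<in> borel_measurable H"
  using p
proof (cases rule: exponent_cases)
  case 1
  show ?thesis
  proof (rule borel_measurableI_le)
    fix y :: ennreal
    define I :: "'a \<Rightarrow> 'b \<Rightarrow> ennreal" where "I w x = (if ennreal (norm (\<phi> w x)) \<le> y then 0 else 1)" for w x
    have I: "I w x = 0 \<longleftrightarrow> ennreal (norm (\<phi> w x)) \<le> y" for w x by (simp add: I_def)
    have mi: "(\<lambda>(w, x). I w x) \<in> borel_measurable (H \<Otimes>\<^sub>M borel)"
      unfolding I_def by (rule joint_compose[OF m]) measurable
    have "{w \<in> space H. Lp_norm (K w) p (\<phi> w) \<le> y} = {w \<in> space H. (\<integral>\<^sup>+x. I w x \<partial>K w) = 0}"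
    proof (intro Collect_cong conj_cong refl)
      fix w assume "w \<in> space H"
      then have w: "w \<in> space M" by (simp add: space_H)
      show "Lp_norm (K w) p (\<phi> w) \<le> y \<longleftrightarrow> (\<integral>\<^sup>+x. I w x \<partial>K w) = 0"
        unfolding nn_integral_0_iff_AE[OF section_measurable[OF mi w]] I
        using Lp_norm_top_le_iff[OF section_measurable[OF m w], of y] 1 by simp
    qed
    also have "\<dots> \<in> sets H"
      using nn_integral_kernel_measurable[OF mi] by measurable
    finally show "{w \<in> space H. Lp_norm (K w) p (\<phi> w) \<le> y} \<in> sets H" .
  qed
next
  case (2 r)
  have mr: "(\<lambda>(w, x). ennreal (norm (\<phi> w x) powr r)) \<in> borel_measurable (H \<Otimes>\<^sub>M borel)"
    by (rule joint_compose[OF m]) measurable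
  define I where "I w = (\<integral>\<^sup>+x. ennreal (norm (\<phi> w x) powr r) \<partial>K w)" for w
  have [measurable]: "I \<in> borel_measurable H"
    unfolding I_def[abs_def] by (rule nn_integral_kernel_measurable[OF mr])
  have "Lp_norm (K w) p (\<phi> w) = (if I w = \<infinity> then \<infinity> else ennreal (enn2real (I w) powr (1 / r)))" for w
    using 2 by (simp add: Lp_norm_def Let_def I_def)
  then show ?thesis by simp
qed

text \<open>
  Conditional norms control the global norm: integrate the conditional \<open>p\<close>-th moment for finite \<open>p\<close>, and
  disintegrate the almost sure bound for \<open>p = \<infinity>\<close>.
\<close>

lemma Lp_norm_disintegrate_le:
  fixes \<phi> :: "'a \<Rightarrow> 'b \<Rightarrow> real"
  assumes m: "(\<lambda>(w, x). \<phi> w x) \<in> borel_measurable (H \<Otimes>\<^sub>M borel)" and p: "1 \<le> p"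
    and c [measurable]: "c \<in> borel_measurable M" and c0: "AE w in M. 0 \<le> c w"
    and le: "AE w in M. Lp_norm (K w) p (\<phi> w) \<le> ennreal (c w)"
  shows "Lp_norm M p (\<lambda>w. \<phi> w (\<xi> w)) \<le> Lp_norm M p c"
  using p
proof (cases rule: exponent_cases)
  case 1
  define C where "C = Lp_norm M p c"
  have "AE w in M. ennreal (norm (c w)) \<le> C"
    using 1 Lp_norm_top_le_iff[of c M C] by (simp add: C_def)
  then have "AE w in M. AE x in K w. ennreal (norm (\<phi> w x)) \<le> C"
    using le c0 AE_space
  proof eventually_elim
    case (elim w)
    then have "Lp_norm (K w) \<top> (\<phi> w) \<le> C" using 1 by auto
    then show ?case using Lp_norm_top_le_iff section_measurable[OF m elim(4)] by blast
  qed
  then have "AE w in M. ennreal (norm (\<phi> w (\<xi> w))) \<le> C"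
    using AE_disintegrate[OF joint_compose[OF m, where F="\<lambda>y. ennreal (norm y) \<le> C"]] by simp
  then show ?thesis
    using 1 Lp_norm_top_le_iff[OF graph_measurable[OF m], of C] by (simp add: C_def)
next
  case (2 r)
  have mr: "(\<lambda>(w, x). ennreal (norm (\<phi> w x) powr r)) \<in> borel_measurable (H \<Otimes>\<^sub>M borel)"
    by (rule joint_compose[OF m]) measurable
  show ?thesis
  proof (cases "Lp_norm M p c")
    case (real C)
    have "(\<integral>\<^sup>+w. ennreal (norm (\<phi> w (\<xi> w)) powr r) \<partial>M) = (\<integral>\<^sup>+w. \<integral>\<^sup>+x. ennreal (norm (\<phi> w x) powr r) \<partial>K w \<partial>M)"
      by (rule nn_integral_disintegrate[OF mr])
    also have "\<dots> \<le> (\<integral>\<^sup>+w. ennreal (norm (c w) powr r) \<partial>M)"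
      using le c0 2 by (intro nn_integral_mono_AE) (auto elim!: eventually_elim2 simp: Lp_norm_finite_le_iff)
    also have "\<dots> \<le> ennreal (C powr r)"
      using real 2 Lp_norm_finite_le_iff[of r C M c] by simp
    finally show ?thesis using real 2 by (simp add: Lp_norm_finite_le_iff)
  qed simp
qed

lemma Lp_norm_disintegrate_finite:
  fixes \<phi> :: "'a \<Rightarrow> 'b \<Rightarrow> real"
  assumes m: "(\<lambda>(w, x). \<phi> w x) \<in> borel_measurable (H \<Otimes>\<^sub>M borel)" and p: "1 \<le> p"
    and fin: "Lp_norm M p (\<lambda>w. \<phi> w (\<xi> w)) < \<infinity>"
  shows "AE w in M. Lp_norm (K w) p (\<phi> w) < \<infinity>"
proof -
  obtain C where C: "Lp_norm M p (\<lambda>w. \<phi> w (\<xi> w)) = ennreal C" "0 \<le> C"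
    using fin by (cases "Lp_norm M p (\<lambda>w. \<phi> w (\<xi> w))") auto
  show ?thesis
    using p
  proof (cases rule: exponent_cases)
    case 1
    have "AE w in M. ennreal (norm (\<phi> w (\<xi> w))) \<le> ennreal C"
      using 1 C graph_measurable[OF m] Lp_norm_top_le_iff[of "\<lambda>w. \<phi> w (\<xi> w)" M "ennreal C"] by simp
    then have "AE w in M. AE x in K w. ennreal (norm (\<phi> w x)) \<le> ennreal C"
      using AE_disintegrate[OF joint_compose[OF m, where F="\<lambda>y. ennreal (norm y) \<le> ennreal C"]] by simp
    then show ?thesis
      using AE_space
    proof eventually_elim
      case (elim w)
      then have "Lp_norm (K w) p (\<phi> w) \<le> ennreal C"
        using Lp_norm_top_le_iff[OF section_measurable[OF m elim(2)], of "ennreal C"] 1 by simp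
      then show ?case by (rule le_less_trans) simp
    qed
  next
    case (2 r)
  have mr: "(\<lambda>(w, x). ennreal (norm (\<phi> w x) powr r)) \<in> borel_measurable (H \<Otimes>\<^sub>M borel)"
    by (rule joint_compose[OF m]) measurable
    have "(\<integral>\<^sup>+w. \<integral>\<^sup>+x. ennreal (norm (\<phi> w x) powr r) \<partial>K w \<partial>M) = (\<integral>\<^sup>+w. ennreal (norm (\<phi> w (\<xi> w)) powr r) \<partial>M)"
      by (rule nn_integral_disintegrate[OF mr, symmetric])
    also have "\<dots> \<le> ennreal (C powr r)"
      using C 2 Lp_norm_finite_le_iff[of r C M "\<lambda>w. \<phi> w (\<xi> w)"] by simp
    finally have "(\<integral>\<^sup>+w. \<integral>\<^sup>+x. ennreal (norm (\<phi> w x) powr r) \<partial>K w \<partial>M) \<noteq> \<infinity>"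
      by (auto simp: top_unique)
    moreover have "(\<lambda>w. \<integral>\<^sup>+x. ennreal (norm (\<phi> w x) powr r) \<partial>K w) \<in> borel_measurable M"
      by (intro H_measurable_M nn_integral_kernel_measurable mr)
    ultimately have "AE w in M. (\<integral>\<^sup>+x. ennreal (norm (\<phi> w x) powr r) \<partial>K w) \<noteq> \<infinity>"
      by (intro nn_integral_PInf_AE)
    then show ?thesis
      by eventually_elim (use 2 in \<open>simp add: Lp_norm_def Let_def\<close>)
  qed
qed

section \<open>Measurability of gauges, weights and means\<close>

lemma lower_gauge_measurable:
  assumes p: "1 \<le> p" and [measurable]: "h \<in> borel_measurable H"
  shows "(\<lambda>w. lower_gauge p (K w) (h w)) \<in> borel_measurable H"
  unfolding lower_gauge_def
  by (intro borel_measurable_enn2real Lp_norm_kernel_measurable p) measurable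

lemma weight_joint_measurable:
  assumes p: "1 \<le> p"
  shows "(\<lambda>(w, x). weight p (K w) i x) \<in> borel_measurable (H \<Otimes>\<^sub>M borel)"
proof (induction i)
  case (Base j t)
  show ?case
    using p
  proof (cases rule: exponent_cases)
    case 1
    define E where "E = {y :: 'b. real_of_rat \<bar>t\<bar> < neg_part (dense_seq j \<bullet> y)}"
    have [measurable]: "E \<in> sets borel" unfolding E_def by measurable
    have [measurable]: "(\<lambda>w. measure (K w) E) \<in> borel_measurable H"
      by (rule measurable_compose[OF kernel measurable_measure_subprob_algebra]) simp
    have "(\<lambda>(w, x). indicator E x / measure (K w) E) \<in> borel_measurable (H \<Otimes>\<^sub>M borel)"
      by measurable
    then show ?thesis
    proof (rule measurable_cong[THEN iffD1, rotated], clarify)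
      fix w x assume "(w, x) \<in> space (H \<Otimes>\<^sub>M (borel :: 'b measure))"
      then have "w \<in> space M" by (simp add: space_pair_measure space_H)
      then have "space (K w) = UNIV" using sets_eq_imp_space_eq[OF kernelD(2)] by simp
      then show "indicator E x / measure (K w) E = weight p (K w) (Base j t) x"
        using 1 by (simp add: dual_fn_def E_def)
    qed
  next
    case (2 r)
    have [measurable]: "(\<lambda>w. lower_gauge p (K w) (dense_seq j)) \<in> borel_measurable H"
      by (intro lower_gauge_measurable p) simp
    have "(\<lambda>(w, x). (neg_part (dense_seq j \<bullet> x) / lower_gauge p (K w) (dense_seq j)) powr (enn2real p - 1))
        \<in> borel_measurable (H \<Otimes>\<^sub>M borel)"
      by measurable
    then show ?thesis using 2 by (simp add: dual_fn_def lower_gauge_def)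
  qed
next
  case (Mid i j)
  note [measurable] = Mid
  have "(\<lambda>z. ((\<lambda>(w, x). weight p (K w) i x) z + (\<lambda>(w, x). weight p (K w) j x) z) / 2) \<in> borel_measurable (H \<Otimes>\<^sub>M borel)"
    by measurable
  then show ?case by (simp add: case_prod_beta)
qed

lemma mean_measurable:
  assumes p: "1 \<le> p"
  shows "(\<lambda>w. mean p (K w) i) \<in> borel_measurable H"
proof -
  note [measurable] = weight_joint_measurable[OF p, of i]
  have "(\<lambda>z. (\<lambda>(w, x). weight p (K w) i x) z *\<^sub>R snd z) \<in> borel_measurable (H \<Otimes>\<^sub>M borel)"
    by measurable
  then have "(\<lambda>(w, x). weight p (K w) i x *\<^sub>R x) \<in> borel_measurable (H \<Otimes>\<^sub>M borel)"
    by (simp add: case_prod_beta)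
  then show ?thesis unfolding mean_def by (rule integral_measurable_kernel[OF _ kernel])
qed

end

lemma (in prob_space) Lp_norm_bounded_le:
  fixes X :: "'a \<Rightarrow> 'b::{real_normed_vector, second_countable_topology}"
  assumes [measurable]: "X \<in> borel_measurable M" and p: "1 \<le> p" and "0 \<le> C" and X: "AE w in M. norm (X w) \<le> C"
  shows "Lp_norm M p X \<le> ennreal C"
  using p
proof (cases rule: exponent_cases)
  case 1
  then show ?thesis using X \<open>0 \<le> C\<close> by (simp add: Lp_norm_top_le_iff)
next
  case (2 r)
  have "(\<integral>\<^sup>+ w. ennreal (norm (X w) powr r) \<partial>M) \<le> (\<integral>\<^sup>+ w. ennreal (C powr r) \<partial>M)"
    using X 2 by (intro nn_integral_mono_AE) (auto elim!: eventually_mono intro!: ennreal_leI powr_mono2)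
  also have "\<dots> = ennreal (C powr r)" by (simp add: emeasure_space_1)
  finally show ?thesis using 2 \<open>0 \<le> C\<close> by (simp add: Lp_norm_finite_le_iff)
qed

lemma pred_le:
  fixes X Y :: "'a \<Rightarrow> real"
  assumes "X \<in> borel_measurable G" "Y \<in> borel_measurable G"
  shows "Measurable.pred G (\<lambda>w. X w \<le> Y w)"
  using borel_measurable_le[OF assms] by (simp add: pred_def)

section \<open>The conditional mean of \<open>f \<xi>\<close> lies in the span\<close>

text \<open>
  Here \<open>a\<close> stands for \<open>E(f \<xi> | H)\<close>, described by the way it integrates bounded \<open>H\<close>-measurable
  test functions.
\<close>

locale duality_setting = conditional_law M H \<xi> K
  for M H :: "'a measure" and \<xi> :: "'a \<Rightarrow> 'b::euclidean_space" and K :: "'a \<Rightarrow> 'b measure" +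
  fixes p q :: ennreal and f :: "'a \<Rightarrow> real" and a :: "'a \<Rightarrow> 'b"
  assumes conj: "conjugate p q"
    and \<xi>_norm: "Lp_norm M p \<xi> < \<infinity>"
    and f_measurable [measurable]: "f \<in> borel_measurable M"
    and f_norm: "Lp_norm M q f < \<infinity>"
    and ri: "AE w in M. 0 \<in> rel_interior (convex hull (closed_support (K w)))"
    and a_measurable [measurable]: "a \<in> borel_measurable H"
    and a_integrable: "integrable M a"
    and a_test: "\<And>\<gamma> B. \<gamma> \<in> borel_measurable H \<Longrightarrow> (\<And>w. norm (\<gamma> w) \<le> B) \<Longrightarrow>
      (\<integral>w. f w * (\<gamma> w \<bullet> \<xi> w) \<partial>M) = (\<integral>w. a w \<bullet> \<gamma> w \<partial>M)"
begin

lemma exponents: "1 \<le> p" "1 \<le> q"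
  using conj conjugate_ge_1 by auto

definition good :: "'a \<Rightarrow> bool" where
  "good w \<longleftrightarrow> w \<in> space M \<and> arbitrage_free_law (K w) p q"

lemma good_space: "good w \<Longrightarrow> w \<in> space M"
  by (simp add: good_def)

lemma good_law: "good w \<Longrightarrow> arbitrage_free_law (K w) p q"
  by (simp add: good_def)

lemma AE_good: "AE w in M. good w"
proof -
  have "Lp_norm M p (\<lambda>w. norm (\<xi> w)) < \<infinity>"
    using \<xi>_norm by (simp add: Lp_norm_norm)
  then have "AE w in M. Lp_norm (K w) p norm < \<infinity>"
    by (intro Lp_norm_disintegrate_finite[where \<phi>="\<lambda>_. norm"] exponents) measurable
  then show ?thesis
    using ri AE_space
  proof eventually_elim
    case (elim w)
    have "Lp_norm (K w) p (\<lambda>x. x) < \<infinity>"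
      using elim(1) Lp_norm_norm[of "K w" p "\<lambda>x. x"] by simp
    then show ?case
      unfolding good_def arbitrage_free_law_def arbitrage_free_law_axioms_def moment_law_def
      using elim(2,3) kernelD[OF elim(3)] conj by blast
  qed
qed

lemma integrable_scaleR_\<xi>:
  fixes k :: "'a \<Rightarrow> real"
  assumes "k \<in> borel_measurable M" "Lp_norm M q k < \<infinity>"
  shows "integrable M (\<lambda>w. k w *\<^sub>R \<xi> w)"
  by (rule Hoelder_integrable[OF conj \<xi>_measurable assms(1) \<xi>_norm assms(2)])

lemma integrable_test:
  fixes k :: "'a \<Rightarrow> real"
  assumes k: "k \<in> borel_measurable M" "Lp_norm M q k < \<infinity>"
    and \<gamma>: "\<gamma> \<in> borel_measurable H" "\<And>w. norm (\<gamma> w) \<le> B"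
  shows "integrable M (\<lambda>w. k w * (\<gamma> w \<bullet> \<xi> w))"
proof (rule Bochner_Integration.integrable_bound)
  show "integrable M (\<lambda>w. B * norm (k w *\<^sub>R \<xi> w))"
    by (intro integrable_mult_right integrable_norm integrable_scaleR_\<xi> k)
  note [measurable] = k(1) H_measurable_M[OF \<gamma>(1)]
  show "(\<lambda>w. k w * (\<gamma> w \<bullet> \<xi> w)) \<in> borel_measurable M" by measurable
  show "AE w in M. norm (k w * (\<gamma> w \<bullet> \<xi> w)) \<le> norm (B * norm (k w *\<^sub>R \<xi> w))"
  proof (rule AE_I2)
    fix w
    have "0 \<le> B" using \<gamma>(2)[of w] norm_ge_zero[of "\<gamma> w"] by linarith
    have "\<bar>\<gamma> w \<bullet> \<xi> w\<bar> \<le> norm (\<gamma> w) * norm (\<xi> w)" by (rule Cauchy_Schwarz_ineq2)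
    also have "\<dots> \<le> B * norm (\<xi> w)" by (intro mult_right_mono \<gamma>) simp
    finally have "\<bar>k w\<bar> * \<bar>\<gamma> w \<bullet> \<xi> w\<bar> \<le> \<bar>k w\<bar> * (B * norm (\<xi> w))" by (intro mult_left_mono) auto
    then show "norm (k w * (\<gamma> w \<bullet> \<xi> w)) \<le> norm (B * norm (k w *\<^sub>R \<xi> w))"
      using \<open>0 \<le> B\<close> by (simp add: abs_mult ac_simps)
  qed
qed

lemma integrable_a_inner:
  assumes \<gamma>: "\<gamma> \<in> borel_measurable H" "\<And>w. norm (\<gamma> w) \<le> B"
  shows "integrable M (\<lambda>w. a w \<bullet> \<gamma> w)"
proof (rule Bochner_Integration.integrable_bound)
  show "integrable M (\<lambda>w. B * norm (a w))"
    by (intro integrable_mult_right integrable_norm a_integrable)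
  note [measurable] = H_measurable_M[OF a_measurable] H_measurable_M[OF \<gamma>(1)]
  show "(\<lambda>w. a w \<bullet> \<gamma> w) \<in> borel_measurable M" by measurable
  show "AE w in M. norm (a w \<bullet> \<gamma> w) \<le> norm (B * norm (a w))"
  proof (rule AE_I2)
    fix w
    have "0 \<le> B" using \<gamma>(2)[of w] norm_ge_zero[of "\<gamma> w"] by linarith
    have "\<bar>a w \<bullet> \<gamma> w\<bar> \<le> norm (a w) * norm (\<gamma> w)" by (rule Cauchy_Schwarz_ineq2)
    also have "\<dots> \<le> norm (a w) * B" by (intro mult_left_mono \<gamma>) simp
    finally show "norm (a w \<bullet> \<gamma> w) \<le> norm (B * norm (a w))"
      using \<open>0 \<le> B\<close> by (simp add: mult.commute)
  qed
qed

text \<open>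
  Countably many \<open>H\<close>-measurable selections of \<open>D\<close> that are dense in \<open>D\<close> at almost every point.
\<close>

definition D_vec :: "nat \<times> weight_index \<Rightarrow> 'a \<Rightarrow> 'b" where
  "D_vec z w = real (fst z) *\<^sub>R mean p (K w) (snd z)"

lemma D_vec_measurable [measurable]: "D_vec z \<in> borel_measurable H"
  using mean_measurable[OF exponents(1), of "snd z"] unfolding D_vec_def[abs_def] by measurable

lemma D_vec_in_D:
  assumes "good w"
  shows "D_vec z w \<in> D_span (K w)"
proof -
  interpret L: arbitrage_free_law "K w" p q by (rule good_law[OF assms])
  show ?thesis using L.mean_in_D[of "snd z"] by (simp add: D_vec_def D_span_def span_scale)
qed

lemma D_vec_dense:
  assumes "good w" "y \<in> D_span (K w)" "0 < d"
  shows "\<exists>z. norm (y - D_vec z w) < d"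
proof -
  interpret L: arbitrage_free_law "K w" p q by (rule good_law[OF assms(1)])
  show ?thesis using L.multiples_of_means_dense[OF assms(2,3)] by (auto simp: D_vec_def)
qed

lemma D_vec_index_measurable:
  assumes "I \<in> measurable H (count_space UNIV)"
  shows "(\<lambda>w. D_vec (I w) w) \<in> borel_measurable H"
  by (rule measurable_compose_countable[OF D_vec_measurable assms])

text \<open>
  If \<open>d\<close> is nearly the closest point of \<open>D\<close> to \<open>a\<close>, then \<open>a - d\<close> is nearly orthogonal to \<open>D\<close>, hence
  to \<open>\<xi>\<close>. Testing with \<open>\<gamma> = a - d\<close> on the set \<open>|a| \<le> R\<close> shows that the distance of \<open>a\<close> to \<open>D\<close>
  vanishes. The approximate closest points serve as a measurable substitute for the orthogonal
  projection.
\<close>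

lemma AE_a_in_D: "AE w in M. a w \<in> D_span (K w)"
proof -
  define \<epsilon> where "\<epsilon> n = inverse (real (Suc n))" for n
  have \<epsilon>: "0 < \<epsilon> n" "\<epsilon> n \<le> 1" for n
    by (simp_all add: \<epsilon>_def inverse_le_1_iff)
  have \<epsilon>2: "(\<epsilon> n)\<^sup>2 \<le> \<epsilon> n" for n
    using \<epsilon>[of n] mult_left_le[of "\<epsilon> n" "\<epsilon> n"] by (simp add: power2_eq_square)
  define P where "P n z w \<longleftrightarrow> (\<forall>z'. (norm (a w - D_vec z w))\<^sup>2 \<le> (norm (a w - D_vec z' w))\<^sup>2 + (\<epsilon> n)\<^sup>2)" for n z w
  have [measurable]: "Measurable.pred H (P n z)" for n z
    unfolding P_def by (rule pred_intros_countable(1), rule pred_le; measurable)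
  define U where "U n w = a w - D_vec (first_index (P n) w) w" for n w
  have UH [measurable]: "U n \<in> borel_measurable H" for n
  proof -
    have [measurable]: "(\<lambda>w. D_vec (first_index (P n) w) w) \<in> borel_measurable H"
      by (intro D_vec_index_measurable first_index_measurable) measurable
    show ?thesis unfolding U_def[abs_def] by measurable
  qed
  have key: "\<exists>y u. a w = y + u \<and> y \<in> D_span (K w) \<and> (\<forall>x\<in>D_span (K w). u \<bullet> x = 0)
      \<and> (\<forall>n. norm (U n w - u) \<le> \<epsilon> n \<and> U n w - u \<in> D_span (K w))" if w: "good w" for w
  proof -
    interpret L: arbitrage_free_law "K w" p q by (rule good_law[OF w])
    obtain y u where yu: "y \<in> D_span (K w)" "\<And>x. x \<in> D_span (K w) \<Longrightarrow> u \<bullet> x = 0" "a w = y + u"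
      using L.D_decomposition by blast
    have diff: "y - D_vec z w \<in> D_span (K w)" for z
      using yu(1) D_vec_in_D[OF w, of z] unfolding D_span_def by (rule span_diff)
    have pyth: "(norm (a w - D_vec z w))\<^sup>2 = (norm u)\<^sup>2 + (norm (y - D_vec z w))\<^sup>2" for z
    proof -
      have eq: "a w - D_vec z w = u + (y - D_vec z w)" using yu(3) by simp
      have "orthogonal u (y - D_vec z w)" using yu(2)[OF diff] by (simp add: orthogonal_def)
      then show ?thesis unfolding eq by (rule norm_add_Pythagorean)
    qed
    have near: "norm (U n w - u) \<le> \<epsilon> n \<and> U n w - u \<in> D_span (K w)" for n
    proof -
      obtain z0 where z0: "norm (y - D_vec z0 w) < \<epsilon> n" using D_vec_dense[OF w yu(1) \<epsilon>(1)] by blast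
      have "P n z0 w"
        unfolding P_def
      proof
        fix z'
        have "(norm (y - D_vec z0 w))\<^sup>2 \<le> (\<epsilon> n)\<^sup>2" using z0 by (intro power_mono) auto
        then show "(norm (a w - D_vec z0 w))\<^sup>2 \<le> (norm (a w - D_vec z' w))\<^sup>2 + (\<epsilon> n)\<^sup>2"
          unfolding pyth using zero_le_power2[of "norm (y - D_vec z' w)"] by linarith
      qed
      define I where "I = first_index (P n) w"
      have PI: "P n I w" unfolding I_def using \<open>P n z0 w\<close> by (rule first_index[of "P n"])
      define v where "v = y - D_vec I w"
      have v: "(norm v)\<^sup>2 \<le> (norm (y - D_vec z' w))\<^sup>2 + (\<epsilon> n)\<^sup>2" for z'
      proof -
        have "(norm (a w - D_vec I w))\<^sup>2 \<le> (norm (a w - D_vec z' w))\<^sup>2 + (\<epsilon> n)\<^sup>2"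
          using PI unfolding P_def by blast
        then show ?thesis unfolding pyth v_def by linarith
      qed
      have "(norm v)\<^sup>2 \<le> (\<epsilon> n)\<^sup>2"
      proof (rule field_le_epsilon)
        fix e :: real assume "0 < e"
        then obtain z' where "norm (y - D_vec z' w) < sqrt e" using D_vec_dense[OF w yu(1), of "sqrt e"] by auto
        then have "(norm (y - D_vec z' w))\<^sup>2 < (sqrt e)\<^sup>2" by (intro power_strict_mono) auto
        then show "(norm v)\<^sup>2 \<le> (\<epsilon> n)\<^sup>2 + e" using v[of z'] \<open>0 < e\<close> by simp
      qed
      then have "norm v \<le> \<epsilon> n" using \<epsilon>(1)[of n] by (simp add: power2_le_iff_abs_le less_imp_le)
      moreover have "U n w - u = v" using yu(3) by (simp add: U_def v_def I_def)
      ultimately show ?thesis using diff by (simp add: v_def)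
    qed
    show ?thesis using yu near by blast
  qed
  have small: "AE w in M. \<bar>U n w \<bullet> \<xi> w\<bar> \<le> \<epsilon> n * norm (\<xi> w)" for n
  proof -
    have "AE w in M. AE x in K w. \<bar>U n w \<bullet> x\<bar> \<le> \<epsilon> n * norm x"
      using AE_good
    proof eventually_elim
      case (elim w)
      obtain y u where yu: "a w = y + u" "\<forall>x\<in>D_span (K w). u \<bullet> x = 0" "norm (U n w - u) \<le> \<epsilon> n"
        using key[OF elim] by blast
      show ?case
        using AE_closed_support[OF kernelD(2)[OF good_space[OF elim]]]
      proof eventually_elim
        case (elim x)
        then have "u \<bullet> x = 0" using yu(2) by (simp add: D_span_def span_base)
        then have "\<bar>U n w \<bullet> x\<bar> = \<bar>(U n w - u) \<bullet> x\<bar>" by (simp add: inner_diff_left)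
        also have "\<dots> \<le> norm (U n w - u) * norm x" by (rule Cauchy_Schwarz_ineq2)
        also have "\<dots> \<le> \<epsilon> n * norm x" using yu(3) by (intro mult_right_mono) auto
        finally show ?case .
      qed
    qed
    then show ?thesis by (subst AE_disintegrate) measurable
  qed
  define C where "C = (\<integral>w. norm (f w *\<^sub>R \<xi> w) \<partial>M)"
  define V where "V w = (INF n. ennreal ((norm (U n w))\<^sup>2))" for w
  have [measurable]: "V \<in> borel_measurable H" unfolding V_def[abs_def] by measurable
  have zero: "AE w in M. norm (a w) \<le> real R \<longrightarrow> V w = 0" for R :: nat
  proof -
    define A where "A n = {w\<in>space H. norm (a w) \<le> real R \<and> norm (U n w) \<le> real R + 1}" for n
    have [measurable]: "A n \<in> sets H" for n unfolding A_def by measurable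
    have AM [measurable]: "A n \<in> sets M" for n using \<open>A n \<in> sets H\<close> subalg by (auto simp: subalgebra_def)
    define \<gamma> where "\<gamma> n w = indicator (A n) w *\<^sub>R U n w" for n w
    have \<gamma>: "\<gamma> n \<in> borel_measurable H" "norm (\<gamma> n w) \<le> real R + 1" for n w
      unfolding \<gamma>_def[abs_def] by (auto simp: A_def indicator_def)
    note [measurable] = H_measurable_M[OF UH] H_measurable_M[OF a_measurable] H_measurable_M[OF \<open>V \<in> borel_measurable H\<close>]
    have le: "(\<integral>\<^sup>+w. ennreal (indicator (A n) w * (norm (U n w))\<^sup>2) \<partial>M) \<le> ennreal (\<epsilon> n * (C + (real R + 1)))" for n
    proof -
      have int1: "integrable M (\<lambda>w. indicator (A n) w * (norm (U n w))\<^sup>2)"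
        by (rule integrable_const_bound[of _ "(real R + 1)\<^sup>2"])
          (auto simp: A_def indicator_def intro!: power_mono)
      have int2: "integrable M (\<lambda>w. a w \<bullet> \<gamma> n w)"
        by (rule integrable_a_inner[OF \<gamma>])
      have "(\<integral>w. indicator (A n) w * (norm (U n w))\<^sup>2 \<partial>M) \<le> (\<integral>w. a w \<bullet> \<gamma> n w + \<epsilon> n * (real R + 1) \<partial>M)"
      proof (rule integral_mono_AE[OF int1])
        show "integrable M (\<lambda>w. a w \<bullet> \<gamma> n w + \<epsilon> n * (real R + 1))" using int2 by simp
        show "AE w in M. indicator (A n) w * (norm (U n w))\<^sup>2 \<le> a w \<bullet> \<gamma> n w + \<epsilon> n * (real R + 1)"
          using AE_good
        proof eventually_elim
          case (elim w)
          obtain y u where yu: "a w = y + u" "y \<in> D_span (K w)" "\<forall>x\<in>D_span (K w). u \<bullet> x = 0"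
            "norm (U n w - u) \<le> \<epsilon> n" "U n w - u \<in> D_span (K w)"
            using key[OF elim] by blast
          show ?case
          proof (cases "w \<in> A n")
            case True
            \<comment> \<open>With \<open>U = u + v\<close> and \<open>v \<in> D\<close>: \<open>|U|\<^sup>2 - a \<bullet> U = v \<bullet> v - y \<bullet> v\<close>.\<close>
            define v where "v = U n w - u"
            have U: "U n w = u + v" by (simp add: v_def)
            have o: "u \<bullet> v = 0" "u \<bullet> y = 0" using yu unfolding v_def by blast+
            have e1: "(norm (U n w))\<^sup>2 - a w \<bullet> U n w = v \<bullet> v - y \<bullet> v"
              using o unfolding power2_norm_eq_inner U yu(1)
              by (simp add: inner_add_left inner_add_right inner_commute)
            have e2: "v \<bullet> v \<le> \<epsilon> n"
              using yu(4) \<epsilon>2[of n] power_mono[of "norm v" "\<epsilon> n" 2] by (simp add: v_def power2_norm_eq_inner)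
            have e3: "- (y \<bullet> v) \<le> real R * \<epsilon> n"
            proof -
              have "(norm y)\<^sup>2 \<le> (norm (a w))\<^sup>2"
                using norm_add_Pythagorean[of y u] o yu(1) by (simp add: orthogonal_def inner_commute)
              then have "norm y \<le> real R" using True power2_le_imp_le[of "norm y" "norm (a w)"] by (auto simp: A_def)
              then have "norm y * norm v \<le> real R * \<epsilon> n"
                using yu(4) by (intro mult_mono) (auto simp: v_def)
              then show ?thesis using Cauchy_Schwarz_ineq2[of y v] by linarith
            qed
            have "(norm (U n w))\<^sup>2 \<le> a w \<bullet> U n w + \<epsilon> n * (real R + 1)"
              using e1 e2 e3 by (simp add: algebra_simps)
            then show ?thesis using True by (simp add: \<gamma>_def)
          next
            case False
            then show ?thesis using \<epsilon>(1)[of n] by (simp add: \<gamma>_def)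
          qed
        qed
      qed
      also have "\<dots> = (\<integral>w. f w * (\<gamma> n w \<bullet> \<xi> w) \<partial>M) + \<epsilon> n * (real R + 1)"
        using int2 a_test[OF \<gamma>] by (simp add: prob_space)
      also have "(\<integral>w. f w * (\<gamma> n w \<bullet> \<xi> w) \<partial>M) \<le> (\<integral>w. \<epsilon> n * norm (f w *\<^sub>R \<xi> w) \<partial>M)"
      proof (rule integral_mono_AE)
        show "integrable M (\<lambda>w. f w * (\<gamma> n w \<bullet> \<xi> w))"
          using integrable_test[OF f_measurable f_norm \<gamma>] .
        show "integrable M (\<lambda>w. \<epsilon> n * norm (f w *\<^sub>R \<xi> w))"
          by (intro integrable_mult_right integrable_norm integrable_scaleR_\<xi> f_measurable f_norm)
        show "AE w in M. f w * (\<gamma> n w \<bullet> \<xi> w) \<le> \<epsilon> n * norm (f w *\<^sub>R \<xi> w)"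
          using small[of n]
        proof eventually_elim
          case (elim w)
          have "\<bar>\<gamma> n w \<bullet> \<xi> w\<bar> \<le> \<epsilon> n * norm (\<xi> w)"
            using elim \<epsilon>(1)[of n] by (auto simp: \<gamma>_def indicator_def)
          then have "\<bar>f w\<bar> * \<bar>\<gamma> n w \<bullet> \<xi> w\<bar> \<le> \<bar>f w\<bar> * (\<epsilon> n * norm (\<xi> w))" by (intro mult_left_mono) auto
          moreover have "f w * (\<gamma> n w \<bullet> \<xi> w) \<le> \<bar>f w\<bar> * \<bar>\<gamma> n w \<bullet> \<xi> w\<bar>" by (simp flip: abs_mult)
          ultimately show ?case by (simp add: ac_simps)
        qed
      qed
      also have "\<dots> = \<epsilon> n * C" by (simp add: C_def)
      finally have "(\<integral>w. indicator (A n) w * (norm (U n w))\<^sup>2 \<partial>M) \<le> \<epsilon> n * (C + (real R + 1))"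
        by (simp add: algebra_simps)
      then show ?thesis
        using nn_integral_eq_integral[OF int1] by (simp add: ennreal_leI)
    qed
    have bound: "(\<integral>\<^sup>+w. indicator {w\<in>space M. norm (a w) \<le> real R} w * V w \<partial>M) \<le> ennreal (\<epsilon> n * (C + (real R + 1)))" for n
    proof (rule order_trans[OF nn_integral_mono_AE le])
      show "AE w in M. indicator {w\<in>space M. norm (a w) \<le> real R} w * V w \<le> ennreal (indicator (A n) w * (norm (U n w))\<^sup>2)"
        using AE_good
      proof eventually_elim
        case (elim w)
        obtain y u where yu: "a w = y + u" "y \<in> D_span (K w)" "\<forall>x\<in>D_span (K w). u \<bullet> x = 0"
          "norm (U n w - u) \<le> \<epsilon> n"
          using key[OF elim] by blast
        have "(norm u)\<^sup>2 \<le> (norm (a w))\<^sup>2"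
          using norm_add_Pythagorean[of y u] yu by (simp add: orthogonal_def inner_commute)
        then have u: "norm u \<le> norm (a w)" by (rule power2_le_imp_le) simp
        have "norm (U n w) \<le> norm u + \<epsilon> n"
          using norm_triangle_sub[of "U n w" u] yu(4) by linarith
        then have "w \<in> A n" if "norm (a w) \<le> real R"
          using that u \<epsilon>(2)[of n] good_space[OF elim] by (simp add: A_def space_H)
        moreover have "V w \<le> ennreal ((norm (U n w))\<^sup>2)" unfolding V_def by (rule INF_lower) simp
        ultimately show ?case by (auto simp: indicator_def)
      qed
    qed
    have "(\<integral>\<^sup>+w. indicator {w\<in>space M. norm (a w) \<le> real R} w * V w \<partial>M) \<le> ennreal (0 * (C + (real R + 1)))"
    proof (rule LIMSEQ_le_const)
      show "(\<lambda>n. ennreal (\<epsilon> n * (C + (real R + 1)))) \<longlonglongrightarrow> ennreal (0 * (C + (real R + 1)))"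
        unfolding \<epsilon>_def by (intro tendsto_ennrealI tendsto_mult tendsto_const LIMSEQ_inverse_real_of_nat)
    qed (use bound in blast)
    then have "AE w in M. indicator {w\<in>space M. norm (a w) \<le> real R} w * V w = 0"
      by (subst nn_integral_0_iff_AE[symmetric]) auto
    then show ?thesis using AE_space by eventually_elim (auto simp: indicator_def)
  qed
  have "AE w in M. \<forall>R. norm (a w) \<le> real R \<longrightarrow> V w = 0"
    unfolding AE_all_countable using zero by blast
  then show ?thesis
    using AE_good
  proof eventually_elim
    case (elim w)
    obtain y u where yu: "a w = y + u" "y \<in> D_span (K w)" "\<forall>x\<in>D_span (K w). u \<bullet> x = 0"
      "\<And>n. norm (U n w - u) \<le> \<epsilon> n" "\<And>n. U n w - u \<in> D_span (K w)"
      using key[OF elim(2)] by blast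
    have "ennreal ((norm u)\<^sup>2) \<le> V w"
      unfolding V_def
    proof (rule INF_greatest)
      fix n
      have "(norm (U n w))\<^sup>2 = (norm u)\<^sup>2 + (norm (U n w - u))\<^sup>2"
        using norm_add_Pythagorean[of u "U n w - u"] yu(3,5) by (simp add: orthogonal_def)
      then show "ennreal ((norm u)\<^sup>2) \<le> ennreal ((norm (U n w))\<^sup>2)" by (intro ennreal_leI) simp
    qed
    moreover obtain R :: nat where "norm (a w) \<le> real R" using real_arch_simple by blast
    ultimately have "u = 0" using elim(1) by auto
    then show ?case using yu by simp
  qed
qed

end

section \<open>Bounded expectations and integrability of the support function\<close>

context duality_setting
begin

text \<open>
  Since \<open>g \<ge> f\<close>, replacing \<open>X\<close> by \<open>- X\<^sup>-\<close> can only increase \<open>(f - g) X\<close>; then Hoelder's inequality applies.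
\<close>

lemma bounded_of_dominating_variable:
  assumes g [measurable]: "g \<in> borel_measurable M" and g_norm: "Lp_norm M q g < \<infinity>" and fg: "AE w in M. f w \<le> g w"
    and ortho: "\<And>\<gamma> B. \<gamma> \<in> borel_measurable H \<Longrightarrow> (\<And>w. norm (\<gamma> w) \<le> B) \<Longrightarrow>
      (\<integral>w. g w * (\<gamma> w \<bullet> \<xi> w) \<partial>M) = 0"
  shows "\<exists>V. \<forall>\<gamma>\<in>borel_measurable H. (\<exists>B. \<forall>w. norm (\<gamma> w) \<le> B) \<longrightarrow>
      Lp_norm M p (\<lambda>w. neg_part (\<gamma> w \<bullet> \<xi> w)) \<le> 1 \<longrightarrow> (\<integral>w. f w * (\<gamma> w \<bullet> \<xi> w) \<partial>M) \<le> V"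
proof -
  obtain F G where FG: "Lp_norm M q f = ennreal F" "0 \<le> F" "Lp_norm M q g = ennreal G" "0 \<le> G"
    using f_norm g_norm by (cases "Lp_norm M q f"; cases "Lp_norm M q g") auto
  define k where "k w = g w + (- 1) *\<^sub>R f w" for w
  have k [measurable]: "k \<in> borel_measurable M" unfolding k_def[abs_def] by measurable
  have "Lp_norm M q (\<lambda>w. (- 1) *\<^sub>R f w) \<le> ennreal (\<bar>- 1\<bar> * F)"
    using FG exponents by (intro Lp_norm_scaleR_le) auto
  then have k_norm: "Lp_norm M q k \<le> ennreal (G + F)"
    unfolding k_def[abs_def] using FG exponents by (intro Lp_norm_add_le) auto
  show ?thesis
  proof (intro exI ballI impI, elim exE)
    fix \<gamma> B assume \<gamma>1: "\<gamma> \<in> borel_measurable H" and \<gamma>2: "\<forall>w. norm (\<gamma> w) \<le> B"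
      and X: "Lp_norm M p (\<lambda>w. neg_part (\<gamma> w \<bullet> \<xi> w)) \<le> 1"
    note \<gamma> = \<gamma>1 \<gamma>2[rule_format]
    note [measurable] = H_measurable_M[OF \<gamma>(1)]
    have I: "(\<integral>\<^sup>+ w. ennreal (norm (k w) * norm (neg_part (\<gamma> w \<bullet> \<xi> w))) \<partial>M) \<le> ennreal ((G + F) * 1)"
      using FG X k_norm by (intro Hoelder[OF conjugate_sym[OF conj]]) auto
    have int: "integrable M (\<lambda>w. k w * neg_part (\<gamma> w \<bullet> \<xi> w))"
      using le_less_trans[OF I ennreal_less_top] by (intro integrableI_bounded) (auto simp: abs_mult)
    have "(\<integral>w. f w * (\<gamma> w \<bullet> \<xi> w) \<partial>M) = (\<integral>w. f w * (\<gamma> w \<bullet> \<xi> w) \<partial>M) - (\<integral>w. g w * (\<gamma> w \<bullet> \<xi> w) \<partial>M)"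
      using ortho[OF \<gamma>] by simp
    also have "\<dots> = (\<integral>w. f w * (\<gamma> w \<bullet> \<xi> w) - g w * (\<gamma> w \<bullet> \<xi> w) \<partial>M)"
      using integrable_test[OF f_measurable f_norm \<gamma>] integrable_test[OF g g_norm \<gamma>] by simp
    also have "\<dots> \<le> (\<integral>w. k w * neg_part (\<gamma> w \<bullet> \<xi> w) \<partial>M)"
    proof (rule integral_mono_AE)
      show "integrable M (\<lambda>w. f w * (\<gamma> w \<bullet> \<xi> w) - g w * (\<gamma> w \<bullet> \<xi> w))"
        using integrable_test[OF f_measurable f_norm \<gamma>] integrable_test[OF g g_norm \<gamma>] by simp
      show "AE w in M. f w * (\<gamma> w \<bullet> \<xi> w) - g w * (\<gamma> w \<bullet> \<xi> w) \<le> k w * neg_part (\<gamma> w \<bullet> \<xi> w)"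
        using fg
      proof eventually_elim
        case (elim w)
        have "k w * (- (\<gamma> w \<bullet> \<xi> w)) \<le> k w * neg_part (\<gamma> w \<bullet> \<xi> w)"
          using elim by (intro mult_left_mono) (auto simp: k_def neg_part_def)
        then show ?case by (simp add: k_def algebra_simps)
      qed
    qed (rule int)
    also have "\<dots> \<le> G + F"
    proof -
      have "ennreal (norm (\<integral>w. k w * neg_part (\<gamma> w \<bullet> \<xi> w) \<partial>M)) \<le> (\<integral>\<^sup>+ w. ennreal (norm (k w * neg_part (\<gamma> w \<bullet> \<xi> w))) \<partial>M)"
        by (rule integral_norm_bound_ennreal[OF int])
      also have "\<dots> \<le> ennreal (G + F)" using I by (simp add: abs_mult del: ennreal_plus)
      finally show ?thesis using FG by (simp add: del: ennreal_plus)
    qed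
    finally show "(\<integral>w. f w * (\<gamma> w \<bullet> \<xi> w) \<partial>M) \<le> G + F" .
  qed
qed

text \<open>
  The converse of Hoelder's inequality. If the norm of \<open>s(a|T) / 2\<close> exceeded the bound \<open>V\<close>, already a
  truncation \<open>Z\<close> would have norm above some \<open>t > V\<close>. A norm-attaining function \<open>W\<close> of \<open>Z\<close> times a
  selection \<open>\<gamma>\<close> of \<open>T\<close> that is nearly optimal for \<open>a\<close> is then an admissible strategy whose expectation
  is at least \<open>t\<close>.
\<close>

lemma support_fun_in_Lp:
  assumes "0 \<le> V"
    and bound: "\<And>\<gamma> B. \<gamma> \<in> borel_measurable H \<Longrightarrow> (\<And>w. norm (\<gamma> w) \<le> B) \<Longrightarrow>
      (AE w in M. \<gamma> w \<in> D_span (K w)) \<Longrightarrow>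
      Lp_norm M p (\<lambda>w. neg_part (\<gamma> w \<bullet> \<xi> w)) \<le> 1 \<Longrightarrow> (\<integral>w. f w * (\<gamma> w \<bullet> \<xi> w) \<partial>M) \<le> V"
  shows "in_Lp_mod M H q (\<lambda>w. support_fun (a w) (T_set p (K w)))"
proof -
  define nrm where "nrm z w = max 1 (lower_gauge p (K w) (D_vec z w))" for z w
  have nrmH [measurable]: "nrm z \<in> borel_measurable H" for z
    using lower_gauge_measurable[OF exponents(1) D_vec_measurable] unfolding nrm_def[abs_def] by measurable
  have nrm1: "1 \<le> nrm z w" for z w by (simp add: nrm_def)
  define s where "s w = (SUP z. ereal (a w \<bullet> D_vec z w / nrm z w))" for w
  have [measurable]: "s \<in> borel_measurable H"
    unfolding s_def[abs_def] by (intro borel_measurable_SUP borel_measurable_ereal) measurable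
  define Y where "Y w = real_of_ereal (s w)" for w
  have YH [measurable]: "Y \<in> borel_measurable H" unfolding Y_def[abs_def] by measurable
  have Y: "support_fun (a w) (T_set p (K w)) = ereal (Y w)" "s w = ereal (Y w)" "0 \<le> Y w" if w: "good w" for w
  proof -
    interpret L: arbitrage_free_law "K w" p q by (rule good_law[OF w])
    obtain C where C: "0 \<le> C" "support_fun (a w) (T_set p (K w)) = ereal C"
      using L.support_fun_T_finite by blast
    have "s w = support_fun (a w) (T_set p (K w))"
      unfolding L.support_fun_T_countable s_def by (simp add: D_vec_def nrm_def case_prod_beta)
    then show "support_fun (a w) (T_set p (K w)) = ereal (Y w)" "s w = ereal (Y w)" "0 \<le> Y w"
      using C by (auto simp: Y_def)
  qed
  \<comment> \<open>A measurable choice of an element of \<open>T\<close> that is optimal up to the factor 2.\<close>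
  define P where "P z w \<longleftrightarrow> Y w / 2 \<le> a w \<bullet> D_vec z w / nrm z w" for z w
  have [measurable]: "Measurable.pred H (P z)" for z
    unfolding P_def by (rule pred_le; measurable)
  define I where "I = first_index P"
  have I [measurable]: "I \<in> measurable H (count_space UNIV)"
    unfolding I_def by (rule first_index_measurable) measurable
  define \<gamma>0 where "\<gamma>0 w = (1 / nrm (I w) w) *\<^sub>R D_vec (I w) w" for w
  have \<gamma>0H [measurable]: "\<gamma>0 \<in> borel_measurable H"
    unfolding \<gamma>0_def by (rule measurable_compose_countable[OF _ I]) measurable
  have \<gamma>0: "\<gamma>0 w \<in> D_span (K w)" "lower_gauge p (K w) (\<gamma>0 w) \<le> 1" "Y w / 2 \<le> a w \<bullet> \<gamma>0 w" if w: "good w" for w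
  proof -
    interpret L: arbitrage_free_law "K w" p q by (rule good_law[OF w])
    show "\<gamma>0 w \<in> D_span (K w)"
      using D_vec_in_D[OF w, of "I w"] by (simp add: \<gamma>0_def D_span_def span_scale)
    show "lower_gauge p (K w) (\<gamma>0 w) \<le> 1"
      unfolding \<gamma>0_def using nrm1[of "I w" w] by (subst L.lower_gauge_scale) (auto simp: nrm_def)
    have "\<exists>z. P z w"
    proof (cases "Y w = 0")
      case True
      then show ?thesis by (intro exI[of _ "(0, undefined)"]) (simp add: P_def D_vec_def)
    next
      case False
      then have "ereal (Y w / 2) < s w" using Y(2,3)[OF w] by simp
      then obtain z where "ereal (Y w / 2) < ereal (a w \<bullet> D_vec z w / nrm z w)"
        unfolding s_def less_SUP_iff by blast
      then show ?thesis by (intro exI[of _ z]) (simp add: P_def)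
    qed
    then obtain z where "P z w" ..
    then have "P (I w) w" unfolding I_def by (rule first_index[of P])
    then show "Y w / 2 \<le> a w \<bullet> \<gamma>0 w" by (simp add: P_def \<gamma>0_def)
  qed
  define A where "A n w \<longleftrightarrow> norm (\<gamma>0 w) \<le> real n \<and> \<bar>Y w\<bar> \<le> real n" for n w
  have AH [measurable]: "Measurable.pred H (A n)" for n unfolding A_def[abs_def] by measurable
  define Z where "Z n w = (if A n w then \<bar>Y w\<bar> / 2 else 0)" for n w
  have ZH [measurable]: "Z n \<in> borel_measurable H" for n unfolding Z_def[abs_def] by measurable
  have Z0: "0 \<le> Z n w" "Z n w \<le> real n" for n w by (auto simp: Z_def A_def)
  have ZM [measurable]: "Z n \<in> borel_measurable M" for n by (rule H_measurable_M[OF ZH])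
  have le: "Lp_norm M q (Z n) \<le> ennreal V" for n
  proof (rule ccontr)
    assume "\<not> ?thesis"
    then obtain u where u: "ennreal V < u" "u < Lp_norm M q (Z n)" using dense not_le by metis
    then obtain t where t: "u = ennreal t" "0 \<le> t" by (cases u) auto
    have Vt: "V < t" using u t \<open>0 \<le> V\<close> by (simp add: ennreal_less_iff)
    define W where "W = dual_fn q M (Z n) t"
    obtain B where B: "\<And>w. W w \<le> B"
      unfolding W_def by (rule dual_fn_bounded[OF exponents(2), where \<phi>="Z n" and N=M and t=t]) (use Z0 in blast)+
    have W0: "0 \<le> W w" for w unfolding W_def by (rule dual_fn_nonneg)
    have WH [measurable]: "W \<in> borel_measurable H" unfolding W_def by measurable
    have WM [measurable]: "W \<in> borel_measurable M" by (rule H_measurable_M[OF WH])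
    have W1: "Lp_norm M p W \<le> 1"
      unfolding W_def by (rule dual_fn_norm_le_1[OF conjugate_sym[OF conj] finite_measure_axioms ZM Z0(1)])
    define \<gamma> where "\<gamma> w = (if A n w then W w *\<^sub>R \<gamma>0 w else 0)" for w
    have \<gamma>: "\<gamma> \<in> borel_measurable H" unfolding \<gamma>_def[abs_def] by measurable
    have B0: "0 \<le> B" using W0 B order_trans by blast
    have \<gamma>b: "norm (\<gamma> w) \<le> B * real n" for w
      using W0[of w] B[of w] B0 by (auto simp: \<gamma>_def A_def intro!: mult_mono)
    have \<gamma>D: "AE w in M. \<gamma> w \<in> D_span (K w)"
      using AE_good by eventually_elim (use \<gamma>0(1) in \<open>auto simp: \<gamma>_def D_span_def span_scale span_zero\<close>)
    have "Lp_norm M p (\<lambda>w. neg_part (\<gamma> w \<bullet> \<xi> w)) \<le> Lp_norm M p W"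
    proof (rule Lp_norm_disintegrate_le[where \<phi>="\<lambda>w x. neg_part (\<gamma> w \<bullet> x)"])
      show "(\<lambda>(w, x). neg_part (\<gamma> w \<bullet> x)) \<in> borel_measurable (H \<Otimes>\<^sub>M borel)"
        using \<gamma> by measurable
      show "AE w in M. Lp_norm (K w) p (\<lambda>x. neg_part (\<gamma> w \<bullet> x)) \<le> ennreal (W w)"
        using AE_good
      proof eventually_elim
        case (elim w)
        interpret L: arbitrage_free_law "K w" p q by (rule good_law[OF elim])
        have "lower_gauge p (K w) (\<gamma> w) \<le> W w"
        proof (cases "A n w")
          case True
          then have "lower_gauge p (K w) (\<gamma> w) = W w * lower_gauge p (K w) (\<gamma>0 w)"
            using L.lower_gauge_scale[OF W0] by (simp add: \<gamma>_def)
          then show ?thesis using \<gamma>0(2)[OF elim] W0[of w] by (simp add: mult_left_le)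
        next
          case False
          then show ?thesis using L.lower_gauge_scale[of 0 0] W0[of w] by (simp add: \<gamma>_def)
        qed
        then show ?case unfolding L.lower_gauge by (rule ennreal_leI)
      qed
    qed (use exponents W0 WM in auto)
    with W1 have "Lp_norm M p (\<lambda>w. neg_part (\<gamma> w \<bullet> \<xi> w)) \<le> 1" by (rule order_trans[rotated])
    then have "(\<integral>w. f w * (\<gamma> w \<bullet> \<xi> w) \<partial>M) \<le> V" using \<gamma>D by (intro bound[OF \<gamma> \<gamma>b])
    then have upper: "(\<integral>w. a w \<bullet> \<gamma> w \<partial>M) \<le> V" using a_test[OF \<gamma> \<gamma>b] by simp
    have intW: "integrable M (\<lambda>w. W w * Z n w)"
      using W0 B Z0 B0 by (intro integrable_const_bound[of _ "B * real n"] AE_I2) (auto simp: abs_mult intro!: mult_mono)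
    have ae_le: "AE w in M. W w * Z n w \<le> a w \<bullet> \<gamma> w"
      using AE_good
    proof eventually_elim
      case (elim w)
      show ?case
        using mult_left_mono[OF \<gamma>0(3)[OF elim] W0[of w]] Y(3)[OF elim] by (auto simp: Z_def \<gamma>_def)
    qed
    have "Lp_norm M q (Z n) \<le> ennreal (real n)"
      using Z0 exponents by (intro Lp_norm_bounded_le) auto
    then have "ennreal t \<le> (\<integral>\<^sup>+ w. ennreal (W w * Z n w) \<partial>M)"
      unfolding W_def using u t le_less_trans[OF _ ennreal_less_top]
      by (intro dual_fn_attains[OF exponents(2) finite_measure_axioms ZM Z0(1)]) auto
    also have "\<dots> = ennreal (\<integral>w. W w * Z n w \<partial>M)"
      using W0 Z0 by (intro nn_integral_eq_integral intW) auto
    finally have "t \<le> (\<integral>w. W w * Z n w \<partial>M)"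
      using W0 Z0 t by (simp add: ennreal_le_iff integral_nonneg_AE)
    also have "\<dots> \<le> (\<integral>w. a w \<bullet> \<gamma> w \<partial>M)"
      using ae_le by (intro integral_mono_AE intW integrable_a_inner[OF \<gamma> \<gamma>b])
    finally show False using upper Vt by simp
  qed
  have YM [measurable]: "Y \<in> borel_measurable M" by (rule H_measurable_M[OF YH])
  have half: "Lp_norm M q (\<lambda>w. \<bar>Y w\<bar> / 2) \<le> ennreal V"
  proof (rule Lp_norm_limit_le[where X=Z])
    show "AE w in M. (\<lambda>n. Z n w) \<longlonglongrightarrow> \<bar>Y w\<bar> / 2"
    proof (rule AE_I2)
      fix w
      obtain n0 :: nat where "max (norm (\<gamma>0 w)) \<bar>Y w\<bar> \<le> real n0" using real_arch_simple by blast
      then have "\<forall>\<^sub>F n in sequentially. Z n w = \<bar>Y w\<bar> / 2"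
        unfolding eventually_sequentially by (intro exI[of _ n0]) (auto simp: Z_def A_def)
      then show "(\<lambda>n. Z n w) \<longlonglongrightarrow> \<bar>Y w\<bar> / 2" by (rule tendsto_eventually)
    qed
  qed (use exponents le \<open>0 \<le> V\<close> in auto)
  have "Lp_norm M q (\<lambda>w. 2 *\<^sub>R (\<bar>Y w\<bar> / 2)) \<le> ennreal (\<bar>2\<bar> * V)"
    using half exponents \<open>0 \<le> V\<close> by (intro Lp_norm_scaleR_le) auto
  then have "Lp_norm M q (\<lambda>w. norm (Y w)) < \<infinity>"
    using le_less_trans[OF _ ennreal_less_top] by simp
  then have "Lp_norm M q Y < \<infinity>" by (simp only: Lp_norm_norm)
  then have "Y \<in> Lp M H q" by (simp add: Lp_def)
  moreover have "AE w in M. support_fun (a w) (T_set p (K w)) = ereal (Y w)"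
    using AE_good by eventually_elim (rule Y(1))
  ultimately show ?thesis unfolding in_Lp_mod_def by blast
qed

end

section \<open>Construction of the dominating variable\<close>

context duality_setting
begin

text \<open>
  The successive approximation, run simultaneously at all points. The step \<open>n\<close> uses the first index in
  the countable family that reduces the residual \<open>R n\<close> sufficiently, so residuals, indices and the
  resulting density are measurable. The initial constant \<open>|Y| + 1\<close> makes the first step possible also
  where the support function vanishes, and the later constants \<open>2\<^sup>-\<^sup>n\<close> add up to \<open>1\<close>.
\<close>

lemma dominating_variable_exists:
  assumes "in_Lp_mod M H q (\<lambda>w. support_fun (a w) (T_set p (K w)))"
  obtains g where "g \<in> borel_measurable M" "Lp_norm M q g < \<infinity>" "\<And>w. w \<in> space M \<Longrightarrow> f w \<le> g w"
    "\<And>\<gamma> B. \<gamma> \<in> borel_measurable H \<Longrightarrow> (\<And>w. norm (\<gamma> w) \<le> B) \<Longrightarrow>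
      (\<integral>w. g w * (\<gamma> w \<bullet> \<xi> w) \<partial>M) = 0"
proof -
  obtain Y where YH [measurable]: "Y \<in> borel_measurable H" and Y_norm: "Lp_norm M q Y < \<infinity>"
    and Y: "AE w in M. support_fun (a w) (T_set p (K w)) = ereal (Y w)"
    using assms unfolding in_Lp_mod_def Lp_def by blast
  define c where "c n w = (if n = 0 then \<bar>Y w\<bar> + 1 else (1 / 2) ^ n)" for n :: nat and w
  have cH [measurable]: "c n \<in> borel_measurable H" for n unfolding c_def[abs_def] by measurable
  have c0: "0 < c n w" for n w by (auto simp: c_def)
  have c_sums: "(\<lambda>n. c n w) sums (\<bar>Y w\<bar> + 2)" for w
  proof -
    have "(\<lambda>n. (1 / 2 :: real) ^ Suc n) sums 1" using power_half_series .
    then have "(\<lambda>n. c (Suc n) w) sums 1" by (simp add: c_def)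
    then have "(\<lambda>n. c n w) sums (1 + c 0 w)" using sums_Suc_iff[of "\<lambda>n. c n w"] by simp
    then show ?thesis by (simp add: c_def add.commute)
  qed
  define P where "P n \<rho> i w \<longleftrightarrow> (\<forall>j. dense_seq j \<bullet> (\<rho> w + c n w *\<^sub>R mean p (K w) i)
      \<le> c (Suc n) w * lower_gauge p (K w) (dense_seq j))" for n and \<rho> :: "'a \<Rightarrow> 'b" and i w
  define R where "R = rec_nat a (\<lambda>n \<rho> w. \<rho> w + c n w *\<^sub>R mean p (K w) (first_index (P n \<rho>) w))"
  define I where "I n = first_index (P n (R n))" for n
  have R0: "R 0 = a" by (simp add: R_def)
  have RSuc: "R (Suc n) w = R n w + c n w *\<^sub>R mean p (K w) (I n w)" for n w
    by (simp add: R_def I_def)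
  note meanH [measurable] = mean_measurable[OF exponents(1)]
  have IH: "I n \<in> measurable H (count_space UNIV)" if [measurable]: "R n \<in> borel_measurable H" for n
    unfolding I_def
  proof (rule first_index_measurable)
    fix i
    have [measurable]: "(\<lambda>w. lower_gauge p (K w) (dense_seq j)) \<in> borel_measurable H" for j
      by (intro lower_gauge_measurable exponents) simp
    show "Measurable.pred H (P n (R n) i)"
      unfolding P_def by (rule pred_intros_countable(1), rule pred_le; measurable)
  qed
  have RH: "R n \<in> borel_measurable H" for n
  proof (induction n)
    case 0
    show ?case by (simp add: R0 a_measurable)
  next
    case (Suc n)
    note [measurable] = Suc measurable_compose_countable[OF meanH IH[OF Suc]]
    have "(\<lambda>w. R n w + c n w *\<^sub>R mean p (K w) (I n w)) \<in> borel_measurable H" by measurable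
    moreover have "R (Suc n) = (\<lambda>w. R n w + c n w *\<^sub>R mean p (K w) (I n w))" by (rule ext) (rule RSuc)
    ultimately show ?case by simp
  qed
  define k where "k w x = enn2real (\<Sum>n. ennreal (c n w * weight p (K w) (I n w) x))" for w x
  have km: "(\<lambda>(w, x). k w x) \<in> borel_measurable (H \<Otimes>\<^sub>M borel)"
  proof -
    have wm: "(\<lambda>z. weight p (K (fst z)) i (snd z)) \<in> borel_measurable (H \<Otimes>\<^sub>M borel)" for i
      using weight_joint_measurable[OF exponents(1), of i] by (simp add: case_prod_beta')
    have "(\<lambda>z. weight p (K (fst z)) (I n (fst z)) (snd z)) \<in> borel_measurable (H \<Otimes>\<^sub>M borel)" for n
      by (rule measurable_compose_countable[OF wm measurable_compose[OF measurable_fst IH[OF RH]]])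
    note [measurable] = this
    have [measurable]: "(\<lambda>z. c n (fst z)) \<in> borel_measurable (H \<Otimes>\<^sub>M borel)" for n
      by (rule measurable_compose[OF measurable_fst cH])
    show ?thesis unfolding k_def case_prod_beta' by measurable
  qed
  have k0: "0 \<le> k w x" for w x by (simp add: k_def)
  have kernel_facts: "AE w in M. Lp_norm (K w) q (k w) \<le> ennreal (\<bar>Y w\<bar> + 2) \<and> integrable (K w) (\<lambda>x. k w x *\<^sub>R x)
      \<and> (\<integral>x. k w x *\<^sub>R x \<partial>K w) = - a w"
    using AE_good AE_a_in_D Y
  proof eventually_elim
    case (elim w)
    interpret L: arbitrage_free_law "K w" p q by (rule good_law[OF elim(1)])
    have "R n w \<in> D_span (K w) \<and> (\<forall>h. h \<bullet> R n w \<le> c n w * lower_gauge p (K w) h)" for n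
    proof (induction n)
      case 0
      show ?case using elim(2,3) by (auto simp: R0 c_def intro!: L.support_fun_T_dominates)
    next
      case (Suc n)
      obtain i where "\<forall>h. h \<bullet> (R n w + c n w *\<^sub>R mean p (K w) i) \<le> c (Suc n) w * lower_gauge p (K w) h"
        using L.mean_reduces[of "R n w" "c n w" "c (Suc n) w"] Suc c0 by blast
      then have "P n (R n) i w" by (simp add: P_def)
      then have "P n (R n) (I n w) w" unfolding I_def by (rule first_index[of "P n (R n)"])
      then have P1: "dense_seq j \<bullet> R (Suc n) w \<le> c (Suc n) w * lower_gauge p (K w) (dense_seq j)" for j
        unfolding P_def RSuc by (rule spec)
      have "h \<bullet> R (Suc n) w \<le> c (Suc n) w * lower_gauge p (K w) h" for h
        by (rule L.dominated_dense[OF P1])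
      moreover have "R (Suc n) w \<in> D_span (K w)"
        using Suc L.mean_in_D[of "I n w"] by (simp add: RSuc D_span_def span_add span_scale)
      ultimately show ?case by blast
    qed
    then have dom: "h \<bullet> R n w \<le> c n w * lower_gauge p (K w) h" for h n by blast
    show ?case
      using L.density_of_residuals[of "\<lambda>n. c n w" "\<bar>Y w\<bar> + 2" "\<lambda>n. R n w" "\<lambda>n. I n w",
          OF less_imp_le[OF c0] c_sums RSuc dom]
      unfolding k_def R0 by blast
  qed
  define G where "G w = k w (\<xi> w)" for w
  have Gm [measurable]: "G \<in> borel_measurable M" unfolding G_def[abs_def] by (rule graph_measurable[OF km])
  have G_norm: "Lp_norm M q G < \<infinity>"
  proof -
    have YM [measurable]: "Y \<in> borel_measurable M" by (rule H_measurable_M[OF YH])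
    obtain C where C: "Lp_norm M q Y = ennreal C" "0 \<le> C" using Y_norm by (cases "Lp_norm M q Y") auto
    have "Lp_norm M q (\<lambda>w. \<bar>Y w\<bar>) \<le> ennreal C" using C Lp_norm_norm[of M q Y] by simp
    moreover have "Lp_norm M q (\<lambda>w. 2 :: real) \<le> ennreal 2"
      using exponents by (intro Lp_norm_bounded_le) auto
    ultimately have "Lp_norm M q (\<lambda>w. \<bar>Y w\<bar> + 2) \<le> ennreal (C + 2)"
      using C exponents by (intro Lp_norm_add_le) auto
    moreover have "Lp_norm M q G \<le> Lp_norm M q (\<lambda>w. \<bar>Y w\<bar> + 2)"
      unfolding G_def
      using kernel_facts exponents by (intro Lp_norm_disintegrate_le[OF km]) (auto elim!: eventually_mono)
    ultimately have "Lp_norm M q G \<le> ennreal (C + 2)" by (rule order_trans[rotated])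
    then show ?thesis by (rule le_less_trans) simp
  qed
  show thesis
  proof (rule that[of "\<lambda>w. f w + G w"])
    show "(\<lambda>w. f w + G w) \<in> borel_measurable M" by measurable
    obtain F where F: "Lp_norm M q f = ennreal F" "0 \<le> F" using f_norm by (cases "Lp_norm M q f") auto
    obtain G' where G': "Lp_norm M q G = ennreal G'" "0 \<le> G'" using G_norm by (cases "Lp_norm M q G") auto
    have "Lp_norm M q (\<lambda>w. f w + G w) \<le> ennreal (F + G')"
      using F G' exponents by (intro Lp_norm_add_le) auto
    then show "Lp_norm M q (\<lambda>w. f w + G w) < \<infinity>" by (rule le_less_trans) simp
    show "f w \<le> f w + G w" for w using k0 by (simp add: G_def)
    fix \<gamma> :: "'a \<Rightarrow> 'b" and B assume \<gamma>: "\<gamma> \<in> borel_measurable H" "\<And>w. norm (\<gamma> w) \<le> B"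
    have int: "integrable M (\<lambda>w. G w * (\<gamma> w \<bullet> \<xi> w))" by (rule integrable_test[OF Gm G_norm \<gamma>])
    have "(\<integral>w. G w * (\<gamma> w \<bullet> \<xi> w) \<partial>M) = (\<integral>w. \<integral>x. k w x * (\<gamma> w \<bullet> x) \<partial>K w \<partial>M)"
      unfolding G_def
    proof (rule integral_disintegrate)
      have [measurable]: "(\<lambda>z. k (fst z) (snd z)) \<in> borel_measurable (H \<Otimes>\<^sub>M borel)"
        using km by (simp add: case_prod_beta')
      have [measurable]: "(\<lambda>z. \<gamma> (fst z)) \<in> borel_measurable (H \<Otimes>\<^sub>M borel)"
        by (rule measurable_compose[OF measurable_fst \<gamma>(1)])
      show "(\<lambda>(w, x). k w x * (\<gamma> w \<bullet> x)) \<in> borel_measurable (H \<Otimes>\<^sub>M borel)"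
        unfolding case_prod_beta' by measurable
    qed (use int in \<open>simp add: G_def\<close>)
    also have "\<dots> = (\<integral>w. - (a w \<bullet> \<gamma> w) \<partial>M)"
    proof (rule Bochner_Integration.integral_cong_AE)
      show "AE w in M. (\<integral>x. k w x * (\<gamma> w \<bullet> x) \<partial>K w) = - (a w \<bullet> \<gamma> w)"
        using kernel_facts
      proof eventually_elim
        case (elim w)
        have "(\<integral>x. \<gamma> w \<bullet> (k w x *\<^sub>R x) \<partial>K w) = \<gamma> w \<bullet> (\<integral>x. k w x *\<^sub>R x \<partial>K w)"
          using elim by (intro integral_inner_right) auto
        then show ?case using elim by (simp add: inner_commute[of "a w"])
      qed
      have "(\<lambda>(w, x). k w x * (\<gamma> w \<bullet> x)) \<in> borel_measurable (H \<Otimes>\<^sub>M borel)"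
      proof -
        have [measurable]: "(\<lambda>z. k (fst z) (snd z)) \<in> borel_measurable (H \<Otimes>\<^sub>M borel)"
          using km by (simp add: case_prod_beta')
        have [measurable]: "(\<lambda>z. \<gamma> (fst z)) \<in> borel_measurable (H \<Otimes>\<^sub>M borel)"
          by (rule measurable_compose[OF measurable_fst \<gamma>(1)])
        show ?thesis unfolding case_prod_beta' by measurable
      qed
      then show "(\<lambda>w. \<integral>x. k w x * (\<gamma> w \<bullet> x) \<partial>K w) \<in> borel_measurable M"
        by (intro H_measurable_M integral_measurable_kernel[OF _ kernel])
      show "(\<lambda>w. - (a w \<bullet> \<gamma> w)) \<in> borel_measurable M"
        using H_measurable_M[OF a_measurable] H_measurable_M[OF \<gamma>(1)] by measurable
    qed
    also have "\<dots> = - (\<integral>w. f w * (\<gamma> w \<bullet> \<xi> w) \<partial>M)" using a_test[OF \<gamma>] by simp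
    finally show "(\<integral>w. (f w + G w) * (\<gamma> w \<bullet> \<xi> w) \<partial>M) = 0"
      using integrable_test[OF f_measurable f_norm \<gamma>] int by (simp add: distrib_right)
  qed
qed

end

section \<open>Vector-valued conditional expectations\<close>

context finite_measure_subalgebra
begin

lemma vec_cond_exp_eq_sum:
  "vec_cond_exp M F X = (\<lambda>w. \<Sum>i\<in>UNIV. real_cond_exp M F (\<lambda>v. X v $ i) w *\<^sub>R axis i 1)"
  by (auto simp: fun_eq_iff vec_eq_iff vec_cond_exp_def axis_def if_distrib cong: if_cong)

lemma vec_cond_exp_measurable: "vec_cond_exp M F X \<in> borel_measurable F"
  unfolding vec_cond_exp_eq_sum
  by (intro borel_measurable_sum borel_measurable_scaleR borel_measurable_const borel_measurable_cond_exp)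

lemma integrable_vec_nth:
  fixes X :: "'a \<Rightarrow> real^'d"
  assumes "integrable M X"
  shows "integrable M (\<lambda>w. X w $ i)"
  unfolding cart_eq_inner_axis by (intro integrable_inner_left impI assms)

lemma integrable_vec_cond_exp:
  fixes X :: "'a \<Rightarrow> real^'d"
  assumes "integrable M X"
  shows "integrable M (vec_cond_exp M F X)"
  unfolding vec_cond_exp_eq_sum
  by (intro Bochner_Integration.integrable_sum integrable_scaleR_left impI real_cond_exp_int integrable_vec_nth assms)

lemma vec_cond_exp_test:
  fixes X :: "'a \<Rightarrow> real^'d"
  assumes X: "integrable M X" and \<gamma>: "\<gamma> \<in> borel_measurable F" "\<And>w. norm (\<gamma> w) \<le> B"
  shows "(\<integral>w. \<gamma> w \<bullet> X w \<partial>M) = (\<integral>w. vec_cond_exp M F X w \<bullet> \<gamma> w \<partial>M)"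
proof -
  have \<gamma>i: "(\<lambda>w. \<gamma> w $ i) \<in> borel_measurable F" for i
    unfolding cart_eq_inner_axis using \<gamma>(1) by measurable
  have Xm: "(\<lambda>w. X w $ i) \<in> borel_measurable M" for i
    using integrable_vec_nth[OF X] by (rule borel_measurable_integrable)
  have int: "integrable M (\<lambda>w. \<gamma> w $ i * X w $ i)" for i
  proof (rule Bochner_Integration.integrable_bound)
    show "integrable M (\<lambda>w. B * norm (X w))" by (intro integrable_mult_right integrable_norm X)
    show "(\<lambda>w. \<gamma> w $ i * X w $ i) \<in> borel_measurable M"
      by (intro borel_measurable_times measurable_from_subalg[OF subalg \<gamma>i] Xm)
    show "AE w in M. norm (\<gamma> w $ i * X w $ i) \<le> norm (B * norm (X w))"
    proof (rule AE_I2)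
      fix w
      have "\<bar>\<gamma> w $ i\<bar> \<le> B" "\<bar>X w $ i\<bar> \<le> norm (X w)"
        using component_le_norm_cart[of "\<gamma> w" i] \<gamma>(2)[of w] component_le_norm_cart[of "X w" i] by linarith+
      then show "norm (\<gamma> w $ i * X w $ i) \<le> norm (B * norm (X w))"
        by (auto simp: abs_mult intro!: mult_mono)
    qed
  qed
  have "(\<integral>w. \<gamma> w \<bullet> X w \<partial>M) = (\<Sum>i\<in>UNIV. \<integral>w. \<gamma> w $ i * X w $ i \<partial>M)"
    unfolding inner_vec_def using int by (simp add: Bochner_Integration.integral_sum)
  also have "\<dots> = (\<Sum>i\<in>UNIV. \<integral>w. \<gamma> w $ i * real_cond_exp M F (\<lambda>v. X v $ i) w \<partial>M)"
    by (intro sum.cong refl real_cond_exp_intg(2)[symmetric] int \<gamma>i Xm)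
  also have "\<dots> = (\<integral>w. \<gamma> w \<bullet> vec_cond_exp M F X w \<partial>M)"
    unfolding inner_vec_def vec_cond_exp_def
    using real_cond_exp_intg(1)[OF int \<gamma>i Xm] by (simp add: Bochner_Integration.integral_sum)
  finally show ?thesis by (simp add: inner_commute)
qed

lemma vec_cond_exp_eq_0:
  fixes X :: "'a \<Rightarrow> real^'d"
  assumes X: "integrable M X"
    and 0: "\<And>\<gamma> B. \<gamma> \<in> borel_measurable F \<Longrightarrow> (\<And>w. norm (\<gamma> w) \<le> B) \<Longrightarrow> (\<integral>w. \<gamma> w \<bullet> X w \<partial>M) = 0"
  shows "AE w in M. vec_cond_exp M F X w = 0"
proof -
  have "AE w in M. real_cond_exp M F (\<lambda>v. X v $ i) w = 0" for i
  proof (rule real_cond_exp_charact)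
    fix A assume A: "A \<in> sets F"
    have "(\<integral>w. (indicator A w *\<^sub>R axis i 1) \<bullet> X w \<partial>M) = 0"
      using A by (intro 0[of _ 1]) (auto simp: indicator_def)
    then show "(\<integral>x\<in>A. X x $ i \<partial>M) = (\<integral>x\<in>A. 0 \<partial>M)"
      by (simp add: set_lebesgue_integral_def cart_eq_inner_axis inner_commute)
  qed (use integrable_vec_nth[OF X] in auto)
  then have "AE w in M. \<forall>i. real_cond_exp M F (\<lambda>v. X v $ i) w = 0"
    by (simp add: AE_all_countable)
  then show ?thesis by eventually_elim (simp add: vec_eq_iff vec_cond_exp_def)
qed

end

section \<open>The equivalence\<close>

theorem theorem1p3:
  fixes M H :: "'a measure"
    and \<xi> :: "'a \<Rightarrow> real^'d"
    and P\<xi> :: "'a \<Rightarrow> (real^'d) measure"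
    and f :: "'a \<Rightarrow> real"
    and p q :: ennreal
  assumes "prob_space M"
    and "subalgebra M H"
    and "1 \<le> p" and "1 / p + 1 / q = 1"
    and "\<xi> \<in> Lp M M p"
    and "f \<in> Lp_nonneg M M q"
    and "regular_cond_distr M H \<xi> P\<xi>"
    and "AE w in M. 0 \<in> rel_interior (convex hull (closed_support (P\<xi> w)))"
  defines "a \<equiv> vec_cond_exp M H (\<lambda>w. f w *\<^sub>R \<xi> w)"
    and "v \<equiv> (SUP X\<in>{X \<in> K_set M H P\<xi> \<xi>. Lp_norm M p (\<lambda>w. neg_part (X w)) \<le> 1}.
                ereal (\<integral>w. f w * X w \<partial>M))"
  shows "(v < \<infinity> \<longleftrightarrow>
            (\<exists>g\<in>Lp M M q. (AE w in M. vec_cond_exp M H (\<lambda>w. g w *\<^sub>R \<xi> w) w = 0) \<and>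
                           (AE w in M. f w \<le> g w)))
       \<and> ((\<exists>g\<in>Lp M M q. (AE w in M. vec_cond_exp M H (\<lambda>w. g w *\<^sub>R \<xi> w) w = 0) \<and>
                           (AE w in M. f w \<le> g w)) \<longleftrightarrow>
            in_Lp_mod M H q (\<lambda>w. support_fun (a w) (T_set p (P\<xi> w))))"
proof -
  have conj: "conjugate p q" using assms(3,4) by (simp add: conjugate_def)
  have f [measurable]: "f \<in> borel_measurable M" "Lp_norm M q f < \<infinity>"
    using assms(6) by (auto simp: Lp_nonneg_def Lp_def)
  have \<xi> [measurable]: "\<xi> \<in> borel_measurable M" and \<xi>_norm: "Lp_norm M p \<xi> < \<infinity>"
    using assms(5) by (auto simp: Lp_def)
  interpret prob_space M by fact
  interpret C: conditional_law M H \<xi> P\<xi>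
    by unfold_locales (use assms(2,7) \<xi> in auto)
  have int: "integrable M (\<lambda>w. k w *\<^sub>R \<xi> w)" if "k \<in> borel_measurable M" "Lp_norm M q k < \<infinity>" for k
    using Hoelder_integrable[OF conj \<xi> that(1) \<xi>_norm that(2)] .
  interpret S: duality_setting M H \<xi> P\<xi> p q f a
  proof
    show "a \<in> borel_measurable H" unfolding a_def by (rule C.vec_cond_exp_measurable)
    show "integrable M a" unfolding a_def by (rule C.integrable_vec_cond_exp[OF int[OF f]])
    fix \<gamma> :: "'a \<Rightarrow> real^'d" and B assume "\<gamma> \<in> borel_measurable H" "\<And>w. norm (\<gamma> w) \<le> B"
    from C.vec_cond_exp_test[OF int[OF f] this]
    show "(\<integral>w. f w * (\<gamma> w \<bullet> \<xi> w) \<partial>M) = (\<integral>w. a w \<bullet> \<gamma> w \<partial>M)" by (simp add: a_def)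
  qed (use conj f \<xi>_norm assms(8) in auto)
  let ?i = "v < \<infinity>"
  let ?ii = "\<exists>g\<in>Lp M M q. (AE w in M. vec_cond_exp M H (\<lambda>w. g w *\<^sub>R \<xi> w) w = 0) \<and> (AE w in M. f w \<le> g w)"
  let ?iii = "in_Lp_mod M H q (\<lambda>w. support_fun (a w) (T_set p (P\<xi> w)))"
  have 1: ?iii if ?i
  proof -
    have upper: "ereal (\<integral>w. f w * (\<gamma> w \<bullet> \<xi> w) \<partial>M) \<le> v"
      if \<gamma>: "\<gamma> \<in> borel_measurable H" "\<And>w. norm (\<gamma> w) \<le> B" "AE w in M. \<gamma> w \<in> D_span (P\<xi> w)"
        "Lp_norm M p (\<lambda>w. neg_part (\<gamma> w \<bullet> \<xi> w)) \<le> 1" for \<gamma> B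
    proof -
      have "0 \<le> B" using \<gamma>(2) norm_ge_zero order_trans by blast
      then have "Lp_norm M \<infinity> \<gamma> \<le> ennreal B"
        using \<gamma>(2) by (intro Lp_norm_bounded_le C.H_measurable_M \<gamma>(1)) auto
      then have "Lp_norm M \<infinity> \<gamma> < \<infinity>" by (rule le_less_trans) simp
      then have "(\<lambda>w. \<gamma> w \<bullet> \<xi> w) \<in> K_set M H P\<xi> \<xi>"
        using \<gamma> unfolding K_set_def Lp_sel_def Lp_def by blast
      then show ?thesis unfolding v_def using \<gamma>(4) by (intro SUP_upper2[where i="\<lambda>w. \<gamma> w \<bullet> \<xi> w"]) auto
    qed
    have "Lp_norm M p (\<lambda>w. neg_part ((0 :: real^'d) \<bullet> \<xi> w)) \<le> ennreal 0"
      using S.exponents by (intro Lp_norm_bounded_le) (auto simp: neg_part_def)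
    then have "Lp_norm M p (\<lambda>w. neg_part ((0 :: real^'d) \<bullet> \<xi> w)) \<le> 1" by (rule order_trans) simp
    then have "ereal (\<integral>w. f w * ((0 :: real^'d) \<bullet> \<xi> w) \<partial>M) \<le> v"
      by (intro upper[of "\<lambda>_. 0" 0]) (auto simp: D_span_def span_zero)
    then have "0 \<le> v" by (simp add: zero_ereal_def)
    then obtain V where V: "v = ereal V" "0 \<le> V" using \<open>?i\<close> by (cases v) auto
    show ?iii using upper V(1) by (intro S.support_fun_in_Lp[OF V(2)]) auto
  qed
  have 2: ?ii if ?iii
  proof -
    obtain g where g [measurable]: "g \<in> borel_measurable M" and g_norm: "Lp_norm M q g < \<infinity>"
      and fg: "\<And>w. w \<in> space M \<Longrightarrow> f w \<le> g w"
      and ortho: "\<And>\<gamma> B. \<gamma> \<in> borel_measurable H \<Longrightarrow> (\<And>w. norm (\<gamma> w) \<le> B) \<Longrightarrow>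
        (\<integral>w. g w * (\<gamma> w \<bullet> \<xi> w) \<partial>M) = 0"
      using S.dominating_variable_exists[OF \<open>?iii\<close>] by blast
    have "AE w in M. vec_cond_exp M H (\<lambda>w. g w *\<^sub>R \<xi> w) w = 0"
    proof (rule C.vec_cond_exp_eq_0[OF int[OF g g_norm]])
      fix \<gamma> :: "'a \<Rightarrow> real^'d" and B assume "\<gamma> \<in> borel_measurable H" "\<And>w. norm (\<gamma> w) \<le> B"
      from ortho[OF this] show "(\<integral>w. \<gamma> w \<bullet> (g w *\<^sub>R \<xi> w) \<partial>M) = 0" by simp
    qed
    moreover have "AE w in M. f w \<le> g w" using fg by (rule AE_I2)
    moreover have "g \<in> Lp M M q" using g g_norm by (simp add: Lp_def)
    ultimately show ?ii by blast
  qed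
  have 3: ?i if ?ii
  proof -
    obtain g where g [measurable]: "g \<in> borel_measurable M" and g_norm: "Lp_norm M q g < \<infinity>"
      and g0: "AE w in M. vec_cond_exp M H (\<lambda>w. g w *\<^sub>R \<xi> w) w = 0" and fg: "AE w in M. f w \<le> g w"
      using \<open>?ii\<close> by (auto simp: Lp_def)
    have ortho: "(\<integral>w. g w * (\<gamma> w \<bullet> \<xi> w) \<partial>M) = 0" if \<gamma>: "\<gamma> \<in> borel_measurable H" "\<And>w. norm (\<gamma> w) \<le> B" for \<gamma> B
    proof -
      have "(\<integral>w. g w * (\<gamma> w \<bullet> \<xi> w) \<partial>M) = (\<integral>w. vec_cond_exp M H (\<lambda>w. g w *\<^sub>R \<xi> w) w \<bullet> \<gamma> w \<partial>M)"
        using C.vec_cond_exp_test[OF int[OF g g_norm] \<gamma>] by simp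
      also have "\<dots> = 0" using g0 by (intro integral_eq_zero_AE) (auto elim!: eventually_mono)
      finally show ?thesis .
    qed
    have "\<exists>V. \<forall>\<gamma>\<in>borel_measurable H. (\<exists>B. \<forall>w. norm (\<gamma> w) \<le> B) \<longrightarrow>
        Lp_norm M p (\<lambda>w. neg_part (\<gamma> w \<bullet> \<xi> w)) \<le> 1 \<longrightarrow> (\<integral>w. f w * (\<gamma> w \<bullet> \<xi> w) \<partial>M) \<le> V"
      using ortho by (rule S.bounded_of_dominating_variable[OF g g_norm fg])
    then obtain V where V: "\<And>\<gamma> B. \<gamma> \<in> borel_measurable H \<Longrightarrow> (\<And>w. norm (\<gamma> w) \<le> B) \<Longrightarrow>
        Lp_norm M p (\<lambda>w. neg_part (\<gamma> w \<bullet> \<xi> w)) \<le> 1 \<Longrightarrow> (\<integral>w. f w * (\<gamma> w \<bullet> \<xi> w) \<partial>M) \<le> V"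
      by blast
    have "v \<le> ereal V"
      unfolding v_def
    proof (rule SUP_least)
      fix X assume "X \<in> {X \<in> K_set M H P\<xi> \<xi>. Lp_norm M p (\<lambda>w. neg_part (X w)) \<le> 1}"
      then obtain \<gamma> where X: "X = (\<lambda>w. \<gamma> w \<bullet> \<xi> w)" "Lp_norm M p (\<lambda>w. neg_part (X w)) \<le> 1"
        and \<gamma>H [measurable]: "\<gamma> \<in> borel_measurable H" and \<gamma>_norm: "Lp_norm M \<infinity> \<gamma> < \<infinity>"
        by (auto simp: K_set_def Lp_sel_def Lp_def)
      have \<gamma>M [measurable]: "\<gamma> \<in> borel_measurable M" by (rule C.H_measurable_M[OF \<gamma>H])
      obtain B where B: "Lp_norm M \<infinity> \<gamma> = ennreal B" "0 \<le> B" using \<gamma>_norm by (cases "Lp_norm M \<infinity> \<gamma>") auto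
      have ae: "AE w in M. norm (\<gamma> w) \<le> B"
        using B Lp_norm_top_le_iff[OF \<gamma>M, of "ennreal B"] by simp
      \<comment> \<open>An everywhere bounded version of \<open>\<gamma>\<close>.\<close>
      define \<gamma>' where "\<gamma>' w = (if norm (\<gamma> w) \<le> B then \<gamma> w else 0)" for w
      have \<gamma>': "\<gamma>' \<in> borel_measurable H" "norm (\<gamma>' w) \<le> B" for w
        using B unfolding \<gamma>'_def[abs_def] by (measurable, simp)
      have \<gamma>'M [measurable]: "\<gamma>' \<in> borel_measurable M" by (rule C.H_measurable_M[OF \<gamma>'(1)])
      have eq: "AE w in M. \<gamma>' w = \<gamma> w" using ae by eventually_elim (simp add: \<gamma>'_def)
      have "Lp_norm M p (\<lambda>w. neg_part (\<gamma>' w \<bullet> \<xi> w)) \<le> Lp_norm M p (\<lambda>w. neg_part (X w))"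
        unfolding X(1) using eq S.exponents by (intro Lp_norm_mono) (auto elim!: eventually_mono)
      then have "(\<integral>w. f w * (\<gamma>' w \<bullet> \<xi> w) \<partial>M) \<le> V"
        using X(2) by (intro V[OF \<gamma>']) (rule order_trans)
      also have "(\<integral>w. f w * (\<gamma>' w \<bullet> \<xi> w) \<partial>M) = (\<integral>w. f w * X w \<partial>M)"
        unfolding X(1) using eq f by (intro integral_cong_AE) (auto elim!: eventually_mono)
      finally show "ereal (\<integral>w. f w * X w \<partial>M) \<le> ereal V" by simp
    qed
    then show ?i by (rule le_less_trans) simp
  qed
  show ?thesis using 1 2 3 by blast
qed

end
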